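(* Let $p\ge5$ be a prime and $e\ge1$. Let $\mathcal M$ be an orientably-regular embedding of $K_{p[p^e]}$, let $G=\mathrm{Aut}^+(\mathcal M)$ and let $P$ be a Sylow $p$-subgroup of $G$. Suppose that the exponent of $P$ is $p^{e+1}$. Then $\mathcal M$ is isomorphic to one of the maps $\mathcal M_1(p,e,j)$, $j\in\mathbb Z^*_{p^e(p-1)}$. Moreover, all of the maps $\mathcal M_1(p,e,j)$ are orientably-regular embeddings of $K_{p[p^e]}$, and $\mathcal M_1(p,e,j_1)\cong\mathcal M_1(p,e,j_2)$ only if $j_1= j_2$ in $\mathbb Z_{p^e(p-1)}$.
   Context: $K_{m[n]}$ is the complete multipartite graph with $m$ parts of $n$ vertices each. An orientably-regular embedding of a graph is an orientable map with that underlying graph whose group $\mathrm{Aut}^+(\mathcal M)$ of orientation-preserving automorphisms acts regularly on arcs. For a finite group $G$ generated by $a$ and an involution $b$ with $\langle a\rangle$ core-free, $\mathcal M(G;a,b)$ is the orientably-regular map with underlying graph the coset graph $\mathrm{Cos}(G,\langle a\rangle,b)$ (vertices the right cosets $\langle a\rangle g$, arcs $(\langle a\rangle g,\langle a\rangle bg)$) and local rotation $(\langle a\rangle g,\langle a\rangle bg)\mapsto(\langle a\rangle g,\langle a\rangle bag)$; $\mathcal M(G;a,b)\cong\mathcal M(G;a',b')$ iff some automorphism of $G$ maps $a\mapsto a'$, $b\mapsto b'$. Let $r$ be a fixed generator of $\mathbb Z_{p^{e+1}}^*$ and $G_1(p,e)=\langle a,c\mid a^{p^e(p-1)}=c^{p^{e+1}}=1,\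 c^a=c^r\rangle$ (with $c^a=a^{-1}ca$); define $\mathcal M_1(p,e,j)=\mathcal M\big(G_1(p,e);a^j,a^{p^e(p-1)/2}c\big)$. *)

theory Defs
  imports "HOL-Algebra.Algebra" "HOL-Number_Theory.Number_Theory"
begin

section \<open>Combinatorial orientable maps\<close>

text \<open>An orientable map is given by its finite nonempty set of darts (arcs) D,
  the rotation R (a permutation of D) and the arc-reversing involution L
  (fixed-point-free), such that the monodromy group generated by R and L is
  transitive on D (connectedness).\<close>

definition orientable_map :: "'d set \<Rightarrow> ('d \<Rightarrow> 'd) \<Rightarrow> ('d \<Rightarrow> 'd) \<Rightarrow> bool" where
  "orientable_map D R L \<longleftrightarrow>
     finite D \<and> D \<noteq> {} \<and> bij_betw R D D \<and> bij_betw L D D \<and>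
     (\<forall>x\<in>D. L (L x) = x \<and> L x \<noteq> x) \<and>
     (\<forall>x\<in>D. \<forall>y\<in>D. (x, y) \<in> ({(z, R z) | z. z \<in> D} \<union> {(z, L z) | z. z \<in> D})\<^sup>*)"

text \<open>The vertex at which a dart starts: its orbit under the rotation.\<close>
definition map_vertex :: "('d \<Rightarrow> 'd) \<Rightarrow> 'd \<Rightarrow> 'd set" where
  "map_vertex R d = {(R ^^ n) d | n. True}"

text \<open>The group Aut^+ of orientation-preserving automorphisms: permutations of
  the darts commuting with R and L (as a subgroup of the symmetric group of D).\<close>
definition map_aut :: "'d set \<Rightarrow> ('d \<Rightarrow> 'd) \<Rightarrow> ('d \<Rightarrow> 'd) \<Rightarrow> ('d \<Rightarrow> 'd) monoid" where
  "map_aut D R L = (BijGroup D)\<lparr>carrier :=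
     {f \<in> Bij D. \<forall>x\<in>D. f (R x) = R (f x) \<and> f (L x) = L (f x)}\<rparr>"

text \<open>Isomorphism of orientable maps.\<close>
definition map_iso :: "'d set \<Rightarrow> ('d \<Rightarrow> 'd) \<Rightarrow> ('d \<Rightarrow> 'd) \<Rightarrow>
                       'e set \<Rightarrow> ('e \<Rightarrow> 'e) \<Rightarrow> ('e \<Rightarrow> 'e) \<Rightarrow> bool" where
  "map_iso D R L D' R' L' \<longleftrightarrow>
     (\<exists>\<phi>. bij_betw \<phi> D D' \<and> (\<forall>x\<in>D. \<phi> (R x) = R' (\<phi> x) \<and> \<phi> (L x) = L' (\<phi> x)))"

text \<open>The complete multipartite graph K_{m[n]} has vertex set
  {0..<m} \<times> {0..<n}, with (i,x) adjacent to (j,y) iff i \<noteq> j.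
  The underlying graph of the map (vertices = R-orbits, the dart d being an arc
  from the vertex of d to the vertex of L d, edges = L-orbits) is isomorphic to
  K_{m[n]}: a bijection of vertices under which the arcs of the map correspond
  bijectively to the arcs of K_{m[n]}.\<close>
definition underlying_graph_is_Kmn :: "'d set \<Rightarrow> ('d \<Rightarrow> 'd) \<Rightarrow> ('d \<Rightarrow> 'd) \<Rightarrow> nat \<Rightarrow> nat \<Rightarrow> bool" where
  "underlying_graph_is_Kmn D R L m n \<longleftrightarrow>
     (\<exists>\<phi>. bij_betw \<phi> (map_vertex R ` D) ({0..<m} \<times> {0..<n}) \<and>
        (\<forall>d\<in>D. fst (\<phi> (map_vertex R d)) \<noteq> fst (\<phi> (map_vertex R (L d)))) \<and>
        (\<forall>u\<in>{0..<m} \<times> {0..<n}. \<forall>v\<in>{0..<m} \<times> {0..<n}. fst u \<noteq> fst v \<longrightarrow>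
            (\<exists>!d. d \<in> D \<and> \<phi> (map_vertex R d) = u \<and> \<phi> (map_vertex R (L d)) = v)))"

definition orientably_regular_embedding_Kmn ::
  "'d set \<Rightarrow> ('d \<Rightarrow> 'd) \<Rightarrow> ('d \<Rightarrow> 'd) \<Rightarrow> nat \<Rightarrow> nat \<Rightarrow> bool" where
  "orientably_regular_embedding_Kmn D R L m n \<longleftrightarrow>
     orientable_map D R L \<and> underlying_graph_is_Kmn D R L m n \<and>
     (\<forall>x\<in>D. \<forall>y\<in>D. \<exists>!f. f \<in> carrier (map_aut D R L) \<and> f x = y)"

section \<open>Group notions\<close>

definition sylow_p_subgroup :: "('g, 'b) monoid_scheme \<Rightarrow> nat \<Rightarrow> 'g set \<Rightarrow> bool" where
  "sylow_p_subgroup G p P \<longleftrightarrow> subgroup P G \<and> card P = p ^ multiplicity p (order G)"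

definition group_exponent :: "('g, 'b) monoid_scheme \<Rightarrow> 'g set \<Rightarrow> nat" where
  "group_exponent G H = (LEAST n. 0 < n \<and> (\<forall>x\<in>H. x [^]\<^bsub>G\<^esub> n = \<one>\<^bsub>G\<^esub>))"

section \<open>The coset map M(G;a,b)\<close>

text \<open>Darts are the arcs (<a>g, <a>bg) of the coset graph Cos(G,<a>,b) (pairs of
  right cosets); reversal swaps the pair, and the local rotation sends
  (<a>g, <a>bg) to (<a>g, <a>bag).\<close>
definition coset_map_darts :: "('g, 'b) monoid_scheme \<Rightarrow> 'g \<Rightarrow> 'g \<Rightarrow> ('g set \<times> 'g set) set" where
  "coset_map_darts G a b =
     {(generate G {a} #>\<^bsub>G\<^esub> g, generate G {a} #>\<^bsub>G\<^esub> (b \<otimes>\<^bsub>G\<^esub> g)) | g. g \<in> carrier G}"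

definition coset_map_R :: "('g, 'b) monoid_scheme \<Rightarrow> 'g \<Rightarrow> 'g \<Rightarrow> ('g set \<times> 'g set) \<Rightarrow> ('g set \<times> 'g set)" where
  "coset_map_R G a b uv =
     (let g = (SOME g. g \<in> carrier G \<and> fst uv = generate G {a} #>\<^bsub>G\<^esub> g \<and>
                       snd uv = generate G {a} #>\<^bsub>G\<^esub> (b \<otimes>\<^bsub>G\<^esub> g))
      in (fst uv, generate G {a} #>\<^bsub>G\<^esub> (b \<otimes>\<^bsub>G\<^esub> a \<otimes>\<^bsub>G\<^esub> g)))"

definition coset_map_L :: "('g set \<times> 'g set) \<Rightarrow> ('g set \<times> 'g set)" where
  "coset_map_L uv = (snd uv, fst uv)"

section \<open>The group G_1(p,e) and the maps M_1(p,e,j)\<close>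

text \<open>G_1(p,e) = < a, c | a^(p^e(p-1)) = c^(p^(e+1)) = 1, a^-1 c a = c^r >,
  realised concretely as the semidirect product: the pair (i,k) stands for
  a^i c^k, with a^i c^k * a^j c^l = a^(i+j) c^(k r^j + l).\<close>
definition G1 :: "nat \<Rightarrow> nat \<Rightarrow> nat \<Rightarrow> (nat \<times> nat) monoid" where
  "G1 p e r =
    \<lparr>carrier = {0..<p^e*(p-1)} \<times> {0..<p^(e+1)},
     monoid.mult = (\<lambda>x y. ((fst x + fst y) mod (p^e*(p-1)),
                      (snd x * r ^ fst y + snd y) mod (p^(e+1)))),
     one = (0, 0)\<rparr>"

definition G1_a :: "nat \<times> nat" where "G1_a = (1, 0)"
definition G1_c :: "nat \<times> nat" where "G1_c = (0, 1)"

definition M1_a :: "nat \<Rightarrow> nat \<Rightarrow> nat \<Rightarrow> nat \<Rightarrow> nat \<times> nat" where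
  "M1_a p e r j = G1_a [^]\<^bsub>G1 p e r\<^esub> j"

definition M1_b :: "nat \<Rightarrow> nat \<Rightarrow> nat \<Rightarrow> nat \<times> nat" where
  "M1_b p e r = G1_a [^]\<^bsub>G1 p e r\<^esub> (p^e*(p-1) div 2) \<otimes>\<^bsub>G1 p e r\<^esub> G1_c"

text \<open>M_1(p,e,j) = M(G_1(p,e); a^j, a^(p^e(p-1)/2) c), as (darts, R, L).\<close>
definition M1_D where "M1_D p e r j = coset_map_darts (G1 p e r) (M1_a p e r j) (M1_b p e r)"
definition M1_R where "M1_R p e r j = coset_map_R (G1 p e r) (M1_a p e r j) (M1_b p e r)"
definition M1_L :: "((nat \<times> nat) set \<times> (nat \<times> nat) set) \<Rightarrow> _" where "M1_L = coset_map_L"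

end

theory Submission
  imports Defs
begin

text \<open>
  Let \<open>n = p ^ (e + 1)\<close>.  The map \<open>M\<^sub>1(p, e, j)\<close> is the affine model: its darts are the pairs \<open>(x, y)\<close> of
  residues modulo \<open>n\<close> with \<open>x\<close> and \<open>y\<close> distinct modulo \<open>p\<close>, reversal swaps the pair, and the rotation is
  \<open>(x, y) \<mapsto> (x, x + s (y - x))\<close> with \<open>s = r ^ j\<close>.  The affine group over the residues acts regularly on
  the darts, and \<open>s\<close> can be read off from a relation between monodromy words.

  Conversely, an element of order \<open>n\<close> of the Sylow subgroup must permute the \<open>n\<close> vertices in one cycle,
  which identifies the vertices with the residues modulo \<open>n\<close> and the parts with the classes modulo \<open>p\<close>.
  The generator \<open>a\<close> of the stabiliser of \<open>0\<close> is then a skew morphism: \<open>a (y + z) = a y + a\<^sup>l z\<close> with \<open>l\<close>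
  depending on \<open>y\<close>.  Lifting from \<open>p\<^sup>m\<close> to \<open>p\<^sup>m\<^sup>+\<^sup>1\<close>, the permutations \<open>z \<mapsto> u + a\<^sup>(\<^sup>p\<^sup>-\<^sup>1\<^sup>)\<^sup>v z\<close> with \<open>u\<close> prime
  to \<open>p\<close> turn out to be \<open>n\<close>-cycles.  One of them is the product of the involution reversing an arc at \<open>0\<close>
  and the involution in the stabiliser of \<open>0\<close>, which inverts it.  After relabelling the vertices along
  that cycle the second involution is \<open>x \<mapsto> - x\<close>, and this forces \<open>a\<close> to be a multiplication.
\<close>

section \<open>Orbits of a permutation\<close>


text \<open>The obstacle is that the cycle supplied by the exponent need not be normalised by the
  stabiliser, so in its labelling negation need not come from an automorphism and nothing makes
  \<open>a\<close> additive. A second cycle is therefore sought, one inverted by an involution that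
  fixes a vertex. A product of two involutions has this property for free; what has to be shown is
  that it is a full cycle. Modulo \<open>p\<close> it fixes no class: a fixed class and its image
  under the involution would be two fixed classes, and these force a trivial action although
  \<open>0\<close> is sent to \<open>1\<close>. Absence of fixed classes puts the linear part
  \<open>a^i\<close> into the powers of \<open>a^(p-1)\<close>, since otherwise
  \<open>z - a^i z\<close> is a bijection modulo \<open>p\<close> and takes the value of the
  constant term. These powers have \<open>p\<close>-power order, and a skew morphism of
  \<open>p\<close>-power order descends to every smaller power of \<open>p\<close>, because its
  fixed residues contain a nontrivial subgroup. This descent is what makes the induction on the
  exponent possible.\<close>

lemma funpow_eq_iff_cong_card_orbit:
  fixes F :: "'a \<Rightarrow> 'a"
  assumes fin: "finite S" and inj: "inj_on F S" and S: "S = range (\<lambda>i. (F ^^ i) x)"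
  shows "(F ^^ i) x = (F ^^ j) x \<longleftrightarrow> [i = j] (mod card S)"
proof -
  have mem: "(F ^^ k) x \<in> S" for k unfolding S by (rule rangeI)
  \<comment> \<open>Injectivity on the orbit strips common iterates, so any repetition forces a
    return to \<open>x\<close>: the orbit is purely periodic, and its least period \<open>m\<close>
    below is its size.\<close>
  have cancel: "(F ^^ k) x = x" if "(F ^^ (l + k)) x = (F ^^ l) x" for l k
    using that
  proof (induction l)
    case (Suc l)
    have "F ((F ^^ (l + k)) x) = F ((F ^^ l) x)" using Suc.prems by simp
    then have "(F ^^ (l + k)) x = (F ^^ l) x" using inj_onD[OF inj] mem by blast
    then show ?case by (rule Suc.IH)
  qed simp
  have "\<not> inj (\<lambda>i. (F ^^ i) x)"
    using fin finite_imageD infinite_UNIV_nat unfolding S by blast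
  then obtain k l where kl: "k < l" "(F ^^ k) x = (F ^^ l) x"
    using linorder_injI[of "\<lambda>i. (F ^^ i) x"] by blast
  then have "(F ^^ (l - k)) x = x" using cancel[of k "l - k"] by simp
  then have ex: "\<exists>m>0. (F ^^ m) x = x" using kl(1) by (intro exI[of _ "l - k"]) simp
  define m where "m = (LEAST m. 0 < m \<and> (F ^^ m) x = x)"
  have m: "0 < m" "(F ^^ m) x = x"
    using LeastI_ex[OF ex] by (auto simp: m_def)
  have least: "m \<le> k" if "0 < k" "(F ^^ k) x = x" for k
    unfolding m_def using that by (intro Least_le) auto
  have red: "(F ^^ (k mod m)) x = (F ^^ k) x" for k
    using funpow_mod_eq[OF m(2)] .
  have inj_m: "inj_on (\<lambda>i. (F ^^ i) x) {..<m}"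
  proof (rule linorder_inj_onI)
    fix k l assume kl: "k < l" "k \<in> {..<m}" "l \<in> {..<m}"
    show "(F ^^ k) x \<noteq> (F ^^ l) x"
    proof
      assume "(F ^^ k) x = (F ^^ l) x"
      then have "(F ^^ (l - k)) x = x" using cancel[of k "l - k"] kl by simp
      then show False using least[of "l - k"] kl by auto
    qed
  qed auto
  have "S = (\<lambda>i. (F ^^ i) x) ` {..<m}"
  proof
    show "S \<subseteq> (\<lambda>i. (F ^^ i) x) ` {..<m}"
    proof
      fix y assume "y \<in> S"
      then obtain i where "y = (F ^^ (i mod m)) x" unfolding S using red by auto
      then show "y \<in> (\<lambda>i. (F ^^ i) x) ` {..<m}" using m(1) by (intro image_eqI[of _ _ "i mod m"]) auto
    qed
  qed (use mem in auto)
  then have "card S = m" using inj_m by (simp add: card_image)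
  moreover have "(F ^^ i) x = (F ^^ j) x \<longleftrightarrow> i mod m = j mod m"
    using inj_on_eq_iff[OF inj_m, of "i mod m" "j mod m"] m(1) by (simp add: red)
  ultimately show ?thesis by (simp add: cong_def)
qed

corollary funpow_eq_self_iff_card_orbit_dvd:
  assumes "finite S" "inj_on F S" "S = range (\<lambda>i. (F ^^ i) x)"
  shows "(F ^^ i) x = x \<longleftrightarrow> card S dvd i"
  using funpow_eq_iff_cong_card_orbit[OF assms, of i 0] by (simp add: cong_0_iff)

text \<open>Induction by removing one nontrivial cycle at a time. Its length divides
  \<open>p ^ k\<close> and is not 1, so it is a multiple of \<open>p\<close>, and no fixed point
  lies on it.\<close>

lemma card_fixpoints_cong:
  fixes p :: nat
  assumes p: "Factorial_Ring.prime p" and "finite Y" "inj_on F Y" "F ` Y \<subseteq> Y"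
    and "\<And>x. x \<in> Y \<Longrightarrow> (F ^^ (p ^ k)) x = x"
  shows "[card Y = card {x \<in> Y. F x = x}] (mod p)"
  using assms(2-)
proof (induction "card Y" arbitrary: Y rule: less_induct)
  case less
  show ?case
  proof (cases "\<forall>x\<in>Y. F x = x")
    case True
    then have "{x \<in> Y. F x = x} = Y" by auto
    then show ?thesis by simp
  next
    case False
    then obtain x where x: "x \<in> Y" "F x \<noteq> x" by auto
    define S where "S = range (\<lambda>i. (F ^^ i) x)"
    have SX: "S \<subseteq> Y"
    proof -
      have "(F ^^ i) x \<in> Y" for i
        using x less.prems(3) by (induction i) auto
      then show ?thesis by (auto simp: S_def)
    qed
    have S: "finite S" "inj_on F S"
      using SX less.prems by (auto intro: finite_subset inj_on_subset)
    note per = funpow_eq_self_iff_card_orbit_dvd[OF S S_def]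
    have "card S dvd p ^ k" using per less.prems(4) x by blast
    moreover have "card S \<noteq> 1"
      using per[of 1] x by auto
    ultimately have pS: "p dvd card S"
    proof -
      obtain i where "card S = p ^ i" using \<open>card S dvd p ^ k\<close> p by (auto simp: divides_primepow_nat)
      then show ?thesis using \<open>card S \<noteq> 1\<close> by (cases i) auto
    qed
    have FS: "F y \<in> S" if "y \<in> S" for y
    proof -
      obtain i where "y = (F ^^ i) x" using \<open>y \<in> S\<close> by (auto simp: S_def)
      then have "F y = (F ^^ Suc i) x" by simp
      then show ?thesis unfolding S_def by blast
    qed
    \<comment> \<open>The rest \<open>Y - S\<close> must again be invariant: \<open>F\<close>
      permutes \<open>S\<close>, so by injectivity no outside point is sent into
      \<open>S\<close>.\<close>
    have preim: "y \<in> S" if y: "y \<in> Y" "F y \<in> S" for y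
    proof -
      have "F ` S = S" using S FS by (meson endo_inj_surj image_subsetI)
      then obtain z where "z \<in> S" "F y = F z" using y(2) by blast
      then have "y = z" using SX less.prems(2) y(1) by (meson inj_onD subsetD)
      then show ?thesis using \<open>z \<in> S\<close> by simp
    qed
    have nofix: "F y \<noteq> y" if y: "y \<in> S" for y
    proof
      assume "F y = y"
      obtain i where i: "y = (F ^^ i) x" using y by (auto simp: S_def)
      \<comment> \<open>A fixed point on the cycle would identify consecutive iterates, hence give a
        cycle of length 1.\<close>
      have "[Suc i = i] (mod card S)"
        using funpow_eq_iff_cong_card_orbit[OF S S_def, of "Suc i" i] \<open>F y = y\<close> i by simp
      then have "card S dvd 1"
        using cong_add_rcancel_0_nat[of 1 i "card S"] by (simp add: cong_0_iff)
      then show False using \<open>card S \<noteq> 1\<close> by simp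
    qed
    have "[card (Y - S) = card {x \<in> Y - S. F x = x}] (mod p)"
    proof (rule less.hyps)
      have "x \<in> S" unfolding S_def by (metis funpow_0 rangeI)
      then show "card (Y - S) < card Y"
        using less.prems(1) x by (intro psubset_card_mono) auto
    qed (use less.prems preim in \<open>auto intro: inj_on_subset\<close>)
    moreover have "{x \<in> Y - S. F x = x} = {x \<in> Y. F x = x}"
      using nofix by auto
    moreover have "card Y = card (Y - S) + card S"
      using SX less.prems(1) S(1) by (simp add: card_Diff_subset card_mono)
    ultimately show ?thesis
      using cong_add[of "card (Y - S)" _ p "card S" 0] pS by (simp add: cong_0_iff)
  qed
qed

section \<open>The affine model\<close>


lemma int_prime_not_dvd_iff_coprime_power:
  fixes p :: nat
  assumes "Factorial_Ring.prime p"
  shows "\<not> int p dvd d \<longleftrightarrow> coprime d (int p ^ Suc e)"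
proof -
  have "\<not> int p dvd d \<longleftrightarrow> coprime (int p) d"
    using assms by (metis coprime_absorb_left not_prime_unit prime_imp_coprime prime_nat_int_transfer)
  then show ?thesis by (auto simp: coprime_commute)
qed

text \<open>The bound on \<open>i\<close> is kept because the discrete logarithm of the rotation
  factor later becomes the parameter \<open>j\<close>, which must lie below
  \<open>p ^ e * (p - 1)\<close>.\<close>

lemma residue_primroot_generates_units:
  fixes p s e :: nat
  assumes p: "Factorial_Ring.prime p" and s: "residue_primroot (p ^ Suc e) s" and d: "\<not> int p dvd d"
  obtains i where "i < totient (p ^ Suc e)" "[d = int s ^ i] (mod int p ^ Suc e)"
proof -
  define n where "n = int p ^ Suc e"
  have n: "n > 1" "p ^ Suc e > 1"
    unfolding n_def using prime_gt_1_nat[OF p] by (intro one_less_power; simp)+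
  have "coprime d n"
    using d int_prime_not_dvd_iff_coprime_power[OF p] unfolding n_def by blast
  then have c: "coprime (d mod n) n" using n by simp
  have m: "0 \<le> d mod n" "d mod n < n" using n by auto
  have "coprime (int (nat (d mod n))) (int (p ^ Suc e))" using c m(1) by (simp add: n_def)
  then have "coprime (nat (d mod n)) (p ^ Suc e)" by (simp only: coprime_int_iff)
  moreover have "d mod n \<noteq> 0" using c n by auto
  moreover have "nat (d mod n) < p ^ Suc e" using m by (simp add: nat_less_iff n_def)
  ultimately have "nat (d mod n) \<in> totatives (p ^ Suc e)"
    using m(1) by (auto simp: in_totatives_iff)
  then obtain i where i: "i < totient (p ^ Suc e)" "nat (d mod n) = s ^ i mod p ^ Suc e"
    using residue_primroot_is_generator[OF n(2) s] by (auto simp: bij_betw_def)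
  have "int (nat (d mod n)) = int (s ^ i mod p ^ Suc e)" using i(2) by (rule arg_cong)
  then have "d mod n = int s ^ i mod n" using m(1) by (simp add: zmod_int n_def)
  then show ?thesis using that i(1) by (simp add: cong_def n_def)
qed

lemma cong_modulus_dvd:
  fixes x y m k :: "'a :: unique_euclidean_ring"
  shows "[x = y] (mod m) \<Longrightarrow> k dvd m \<Longrightarrow> k dvd x \<longleftrightarrow> k dvd y"
  by (meson cong_dvd_iff cong_dvd_modulus)

text \<open>Integers stand for residues modulo \<open>n\<close>.\<close>

locale affine_map =
  fixes p e s :: nat and n :: int and dart :: "int \<Rightarrow> int \<Rightarrow> 'd"
    and D :: "'d set" and R L :: "'d \<Rightarrow> 'd"
  assumes prime_p: "Factorial_Ring.prime p" and p_ge: "p \<ge> 3" and n_eq: "n = int p ^ Suc e"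
    and primroot: "residue_primroot (p ^ Suc e) s"
    and D_eq: "D = {dart x y | x y. \<not> int p dvd y - x}"
    and dart_eq_iff: "\<lbrakk>\<not> int p dvd y - x; \<not> int p dvd y' - x'\<rbrakk> \<Longrightarrow>
      dart x y = dart x' y' \<longleftrightarrow> [x = x'] (mod n) \<and> [y = y'] (mod n)"
    and R_dart: "\<not> int p dvd y - x \<Longrightarrow> R (dart x y) = dart x (x + int s * (y - x))"
    and L_dart: "\<not> int p dvd y - x \<Longrightarrow> L (dart x y) = dart y x"
begin

lemma n_gt_1: "n > 1"
  using p_ge unfolding n_eq by (intro one_less_power) auto

lemma unit_iff: "\<not> int p dvd d \<longleftrightarrow> coprime d n"
  unfolding n_eq by (rule int_prime_not_dvd_iff_coprime_power[OF prime_p])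

lemma not_dvd_swap: "\<not> int p dvd x - y \<longleftrightarrow> \<not> int p dvd y - x"
  by (simp add: dvd_diff_commute)

lemma s_unit: "\<not> int p dvd int s"
proof -
  have "coprime (p ^ Suc e) s" using primroot by (simp add: residue_primroot_def)
  then have "coprime (int s) n" unfolding n_eq by (metis coprime_commute coprime_int_iff of_nat_power)
  then show ?thesis by (simp only: unit_iff)
qed

lemma s_power_unit: "\<not> int p dvd int s ^ i"
  using s_unit prime_p by (meson prime_dvd_power prime_nat_int_transfer)

lemma unit_mult: "\<not> int p dvd u \<Longrightarrow> \<not> int p dvd v \<Longrightarrow> \<not> int p dvd u * v"
  using prime_p by (simp add: prime_dvd_mult_iff)

lemma unit_eq_power:
  assumes "\<not> int p dvd d" obtains i where "[d = int s ^ i] (mod n)"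
  using residue_primroot_generates_units[OF prime_p primroot assms] unfolding n_eq by blast

lemma unit_cong: "[d = d'] (mod n) \<Longrightarrow> int p dvd d \<longleftrightarrow> int p dvd d'"
  by (rule cong_modulus_dvd) (auto simp: n_eq)

lemma unit_ratio:
  assumes d: "\<not> int p dvd d" and d': "\<not> int p dvd d'"
  obtains u where "\<not> int p dvd u" "[u * d = d'] (mod n)"
proof -
  have "coprime d n" using d by (simp only: unit_iff)
  then obtain v where v: "[d * v = 1] (mod n)" using cong_solve_coprime_int by blast
  have "[d' * v * d = d' * (d * v)] (mod n)" by (simp add: mult_ac)
  also have "[d' * (d * v) = d' * 1] (mod n)" by (intro cong_mult v cong_refl)
  finally have *: "[d' * v * d = d'] (mod n)" by simp
  moreover have "\<not> int p dvd d' * v" using unit_cong[OF *] d' by auto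
  ultimately show ?thesis using that by blast
qed

lemma dart_in_D [simp, intro]: "\<not> int p dvd y - x \<Longrightarrow> dart x y \<in> D"
  by (auto simp: D_eq)

lemma dart_cases:
  assumes "d \<in> D" obtains x y where "d = dart x y" "\<not> int p dvd y - x"
  using assms by (auto simp: D_eq)

lemma diff_unit_cong:
  assumes "[x = x'] (mod n)" "[y = y'] (mod n)"
  shows "int p dvd y - x \<longleftrightarrow> int p dvd y' - x'"
  by (intro unit_cong cong_diff assms)

lemma dart_cong:
  assumes "\<not> int p dvd y - x" "[x = x'] (mod n)" "[y = y'] (mod n)"
  shows "dart x y = dart x' y'"
  using assms diff_unit_cong by (subst dart_eq_iff) auto

lemma rot_unit: "\<not> int p dvd y - x \<Longrightarrow> \<not> int p dvd (x + int s ^ i * (y - x)) - x"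
  using unit_mult s_power_unit by simp

lemma R_funpow_dart:
  assumes "\<not> int p dvd y - x"
  shows "(R ^^ i) (dart x y) = dart x (x + int s ^ i * (y - x))"
proof (induction i)
  case (Suc i)
  show ?case using Suc R_dart[OF rot_unit[OF assms, of i]] by (simp add: algebra_simps)
qed simp

definition vert :: "int \<Rightarrow> 'd set" where
  "vert x = {dart x y | y. \<not> int p dvd y - x}"

text \<open>Primitivity of \<open>s\<close> makes a single rotation orbit out of all darts at
  \<open>x\<close>: the ratio of two units is a unit, hence a power of \<open>s\<close>.\<close>

lemma map_vertex_dart:
  assumes xy: "\<not> int p dvd y - x" shows "map_vertex R (dart x y) = vert x"
proof
  show "map_vertex R (dart x y) \<subseteq> vert x"
    using R_funpow_dart[OF xy] rot_unit[OF xy] by (fastforce simp: map_vertex_def vert_def)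
  show "vert x \<subseteq> map_vertex R (dart x y)"
  proof
    fix d assume "d \<in> vert x"
    then obtain y' where d: "d = dart x y'" "\<not> int p dvd y' - x" by (auto simp: vert_def)
    obtain u where u: "\<not> int p dvd u" "[u * (y - x) = y' - x] (mod n)"
      using unit_ratio[OF xy d(2)] .
    obtain k where k: "[u = int s ^ k] (mod n)" using unit_eq_power u(1) by blast
    have "[x + int s ^ k * (y - x) = x + u * (y - x)] (mod n)"
      using k by (intro cong_add cong_mult cong_refl) (rule cong_sym)
    also have "[x + u * (y - x) = x + (y' - x)] (mod n)"
      by (intro cong_add u cong_refl)
    finally have "[x + int s ^ k * (y - x) = y'] (mod n)" by simp
    then have "d = (R ^^ k) (dart x y)"
      using R_funpow_dart[OF xy] dart_cong[OF rot_unit[OF xy] cong_refl] d by metis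
    then show "d \<in> map_vertex R (dart x y)" by (auto simp: map_vertex_def)
  qed
qed

lemma vert_eq_iff: "vert x = vert x' \<longleftrightarrow> [x = x'] (mod n)"
proof
  assume "vert x = vert x'"
  moreover have unit1: "\<not> int p dvd (z + 1) - z" for z
    using p_ge by simp
  moreover have "dart x (x + 1) \<in> vert x" using unit1 unfolding vert_def by blast
  ultimately have "dart x (x + 1) \<in> vert x'" by simp
  then obtain y where "dart x (x + 1) = dart x' y" "\<not> int p dvd y - x'" by (auto simp: vert_def)
  then show "[x = x'] (mod n)" using dart_eq_iff[OF unit1] by blast
next
  have "vert a \<subseteq> vert b" if ab: "[a = b] (mod n)" for a b
  proof
    fix d assume "d \<in> vert a"
    then obtain y where "d = dart a y" "\<not> int p dvd y - a" by (auto simp: vert_def)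
    then show "d \<in> vert b"
      using dart_cong[OF _ ab cong_refl] diff_unit_cong[OF ab cong_refl] unfolding vert_def by blast
  qed
  then show "vert x = vert x'" if "[x = x'] (mod n)" using that by (metis cong_sym subset_antisym)
qed

lemma finite_D: "finite D"
proof -
  have "D \<subseteq> (\<lambda>(x, y). dart x y) ` ({0..<n} \<times> {0..<n})"
  proof
    fix d assume "d \<in> D"
    then obtain x y where d: "d = dart x y" "\<not> int p dvd y - x" by (rule dart_cases)
    then have "d = dart (x mod n) (y mod n)" using dart_cong[OF d(2), of "x mod n" "y mod n"] by (simp add: cong_def)
    moreover have "(x mod n, y mod n) \<in> {0..<n} \<times> {0..<n}" using n_gt_1 by simp
    ultimately show "d \<in> (\<lambda>(x, y). dart x y) ` ({0..<n} \<times> {0..<n})" by force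
  qed
  then show ?thesis by (rule finite_subset) simp
qed

lemma RL_in_D: "d \<in> D \<Longrightarrow> R d \<in> D" "d \<in> D \<Longrightarrow> L d \<in> D"
  using rot_unit[of _ _ 1] by (auto elim!: dart_cases simp: R_dart L_dart not_dvd_swap)

lemma R_inj: "inj_on R D"
proof
  fix c d assume "c \<in> D" "d \<in> D" "R c = R d"
  obtain x y where c: "c = dart x y" "\<not> int p dvd y - x" using \<open>c \<in> D\<close> by (rule dart_cases)
  obtain x' y' where d: "d = dart x' y'" "\<not> int p dvd y' - x'" using \<open>d \<in> D\<close> by (rule dart_cases)
  have *: "[x = x'] (mod n)" "[x + int s * (y - x) = x' + int s * (y' - x')] (mod n)"
    using \<open>R c = R d\<close> c d rot_unit[of _ _ 1] by (auto simp: R_dart dart_eq_iff)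
  then have "[int s * (y - x) = int s * (y' - x')] (mod n)"
    by (metis add_diff_cancel_left' cong_diff)
  moreover have "coprime (int s) n" using s_unit by (simp only: unit_iff)
  ultimately have "[y - x = y' - x'] (mod n)" by (simp only: cong_mult_lcancel)
  then have "[(y - x) + x = (y' - x') + x'] (mod n)" using *(1) by (rule cong_add)
  then show "c = d" using c d * by (simp add: dart_eq_iff)
qed

lemma LL: "d \<in> D \<Longrightarrow> L (L d) = d"
  by (auto elim!: dart_cases simp: L_dart not_dvd_swap)

lemma L_inj: "inj_on L D"
  using LL by (metis inj_onI)

lemma bij_R: "bij_betw R D D" and bij_L: "bij_betw L D D"
  using endo_inj_surj[OF finite_D _ R_inj] endo_inj_surj[OF finite_D _ L_inj] R_inj L_inj RL_in_D
  by (simp_all add: bij_betw_def image_subsetI)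

section \<open>Connectedness of the affine map\<close>

abbreviation step :: "('d \<times> 'd) set" where
  "step \<equiv> {(z, R z) | z. z \<in> D} \<union> {(z, L z) | z. z \<in> D}"

lemma reach_vertex:
  assumes xy: "\<not> int p dvd y - x" "\<not> int p dvd y' - x"
  shows "(dart x y, dart x y') \<in> step\<^sup>*"
proof -
  have "dart x y' \<in> map_vertex R (dart x y)"
    using map_vertex_dart[OF xy(1)] xy(2) by (auto simp: vert_def)
  then obtain k where k: "dart x y' = (R ^^ k) (dart x y)" by (auto simp: map_vertex_def)
  have "(dart x y, (R ^^ i) (dart x y)) \<in> step\<^sup>*" for i
  proof (induction i)
    case (Suc i)
    have "(R ^^ i) (dart x y) \<in> D" using R_funpow_dart[OF xy(1)] rot_unit[OF xy(1)] by auto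
    then have "((R ^^ i) (dart x y), (R ^^ Suc i) (dart x y)) \<in> step" by auto
    with Suc show ?case by (rule rtrancl_into_rtrancl)
  qed simp
  then show ?thesis using k by simp
qed

lemma reach_L: "\<not> int p dvd y - x \<Longrightarrow> (dart x y, dart y x) \<in> step\<^sup>*"
  using L_dart[of y x] by (intro r_into_rtrancl) force

lemma reach:
  assumes "c \<in> D" "d \<in> D" shows "(c, d) \<in> step\<^sup>*"
proof -
  obtain x y where c: "c = dart x y" "\<not> int p dvd y - x" using \<open>c \<in> D\<close> by (rule dart_cases)
  obtain u v where d: "d = dart u v" "\<not> int p dvd v - u" using \<open>d \<in> D\<close> by (rule dart_cases)
  \<comment> \<open>A common neighbour of \<open>x\<close> and \<open>u\<close>: both
    \<open>x + 1\<close> and \<open>x + 2\<close> differ from \<open>x\<close> modulo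
    \<open>p\<close>, as \<open>p\<close> is at least 3, and they cannot both be congruent to
    \<open>u\<close>.\<close>
  obtain w where w: "\<not> int p dvd w - x" "\<not> int p dvd w - u"
  proof -
    have two: "\<not> int p dvd 1" "\<not> int p dvd 2"
      using p_ge zdvd_imp_le[of "int p" 1] zdvd_imp_le[of "int p" 2] by auto
    show ?thesis
    proof (cases "int p dvd x + 1 - u")
      case True
      have "\<not> int p dvd (x + 2) - u"
      proof
        assume "int p dvd (x + 2) - u"
        then have "int p dvd ((x + 2) - u) - (x + 1 - u)" using True by (rule dvd_diff)
        then show False using two by simp
      qed
      then show ?thesis using that[of "x + 2"] two by simp
    qed (use that[of "x + 1"] two in simp)
  qed
  have "(dart x y, dart x w) \<in> step\<^sup>*" using c w by (intro reach_vertex)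
  also have "(dart x w, dart w x) \<in> step\<^sup>*" using w by (intro reach_L)
  also have "(dart w x, dart w u) \<in> step\<^sup>*" using w by (intro reach_vertex) (auto simp: not_dvd_swap)
  also have "(dart w u, dart u w) \<in> step\<^sup>*" using w by (intro reach_L) (auto simp: not_dvd_swap)
  also have "(dart u w, dart u v) \<in> step\<^sup>*" using w d by (intro reach_vertex) (auto simp: not_dvd_swap)
  finally show ?thesis using c d by simp
qed

lemma D_nonempty: "D \<noteq> {}"
proof -
  have "\<not> int p dvd 1 - 0" using p_ge by auto
  then have "dart 0 1 \<in> D" by (rule dart_in_D)
  then show ?thesis by blast
qed

lemma L_neq: "d \<in> D \<Longrightarrow> L d \<noteq> d"
proof (elim dart_cases)
  fix x y assume d: "d = dart x y" "\<not> int p dvd y - x"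
  show "L d \<noteq> d"
  proof
    assume "L d = d"
    then have "[y = x] (mod n)" using d by (simp add: L_dart dart_eq_iff not_dvd_swap)
    then have "int p dvd y - x" using diff_unit_cong[of x x y x] by simp
    then show False using d by simp
  qed
qed

lemma orientable: "orientable_map D R L"
  unfolding orientable_map_def
  using finite_D D_nonempty bij_R bij_L LL L_neq reach by blast

lemma underlying_graph: "underlying_graph_is_Kmn D R L p (p ^ e)"
proof -
  \<comment> \<open>Remainder and quotient of the representative by \<open>p\<close>: the remainder
    names the part, as the parts are the classes modulo \<open>p\<close>, and the quotient numbers
    the vertices inside it.\<close>
  define label :: "int \<Rightarrow> nat \<times> nat" where
    "label x = (nat (x mod n) mod p, nat (x mod n) div p)" for x
  \<comment> \<open>The choice of \<open>x\<close> does no harm, because \<open>label\<close>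
    depends only on the class modulo \<open>n\<close>.\<close>
  define \<phi> where "\<phi> v = label (SOME x. v = vert x)" for v
  have p0: "p > 0" using p_ge by simp
  have label_cong: "label x = label y \<longleftrightarrow> [x = y] (mod n)" for x y
  proof
    assume "label x = label y"
    then have "nat (x mod n) = nat (y mod n)"
      unfolding label_def by (metis Pair_inject div_mult_mod_eq)
    then show "[x = y] (mod n)" using n_gt_1 by (simp add: cong_def nat_eq_iff2)
  qed (simp add: label_def cong_def)
  have label_vert: "\<phi> (vert x) = label x" for x
  proof -
    have "vert x = vert (SOME y. vert x = vert y)" by (rule someI) (rule refl)
    then have "[x = (SOME y. vert x = vert y)] (mod n)" by (simp only: vert_eq_iff)
    then show ?thesis unfolding \<phi>_def using label_cong by metis
  qed
  have label_fst: "fst (label x) = fst (label y) \<longleftrightarrow> int p dvd y - x" for x y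
  proof -
    have f: "int (fst (label z)) = z mod int p" for z
      using n_gt_1 p0 by (simp add: label_def zmod_int mod_mod_cancel n_eq)
    have "fst (label x) = fst (label y) \<longleftrightarrow> x mod int p = y mod int p" by (metis f of_nat_eq_iff)
    then show ?thesis by (simp add: mod_eq_dvd_iff dvd_diff_commute)
  qed
  have label_range: "label x \<in> {0..<p} \<times> {0..<p ^ e}" for x
  proof -
    have "nat (x mod n) < p * p ^ e" using n_gt_1 by (simp add: nat_less_iff n_eq)
    then show ?thesis using p0 by (simp add: label_def less_mult_imp_div_less mult.commute)
  qed
  have label_surj: "\<exists>x. label x = u" if u: "u \<in> {0..<p} \<times> {0..<p ^ e}" for u
  proof -
    obtain i j where ij: "u = (i, j)" "i < p" "j < p ^ e" using u by auto
    have "i + p * j < p + p * j" using ij by simp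
    also have "\<dots> = p * Suc j" by simp
    also have "\<dots> \<le> p * p ^ e" using ij(3) by (intro mult_le_mono2) simp
    finally have lt: "int (i + p * j) < n" by (simp add: n_eq flip: of_nat_power of_nat_mult)
    then have "int (i + p * j) mod n = int (i + p * j)" by (intro mod_pos_pos_trivial) auto
    then have "nat (int (i + p * j) mod n) = i + p * j" by (simp only: nat_int)
    then have "label (int (i + p * j)) = u" using ij by (simp only: label_def) simp
    then show ?thesis ..
  qed
  have ex_unit: "\<exists>y. \<not> int p dvd y - x" for x using p_ge by (intro exI[of _ "x + 1"]) simp
  have V: "map_vertex R ` D = range vert"
  proof
    show "map_vertex R ` D \<subseteq> range vert" by (auto elim!: dart_cases simp: map_vertex_dart)
    show "range vert \<subseteq> map_vertex R ` D"
    proof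
      fix v assume "v \<in> range vert"
      then obtain x where x: "v = vert x" by blast
      obtain y where "\<not> int p dvd y - x" using ex_unit by blast
      then show "v \<in> map_vertex R ` D" using x map_vertex_dart dart_in_D by (metis image_eqI)
    qed
  qed
  have bij: "bij_betw \<phi> (map_vertex R ` D) ({0..<p} \<times> {0..<p ^ e})"
    unfolding V bij_betw_def
  proof
    show "inj_on \<phi> (range vert)" by (auto simp: inj_on_def label_vert label_cong vert_eq_iff)
    show "\<phi> ` range vert = {0..<p} \<times> {0..<p ^ e}"
    proof
      show "\<phi> ` range vert \<subseteq> {0..<p} \<times> {0..<p ^ e}" 
        unfolding image_image label_vert using label_range by (rule image_subsetI)
      show "{0..<p} \<times> {0..<p ^ e} \<subseteq> \<phi> ` range vert"
        using label_surj label_vert by (metis image_eqI rangeI subsetI)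
    qed
  qed
  have ends: "\<phi> (map_vertex R (dart x y)) = label x" "\<phi> (map_vertex R (L (dart x y))) = label y"
    if "\<not> int p dvd y - x" for x y
    using that by (simp_all add: L_dart map_vertex_dart not_dvd_swap label_vert)
  show ?thesis
    unfolding underlying_graph_is_Kmn_def
  proof (intro exI[of _ \<phi>] conjI bij ballI impI)
    fix d assume "d \<in> D"
    then obtain x y where d: "d = dart x y" "\<not> int p dvd y - x" by (rule dart_cases)
    then show "fst (\<phi> (map_vertex R d)) \<noteq> fst (\<phi> (map_vertex R (L d)))"
      by (simp add: ends label_fst)
  next
    fix u v assume u: "u \<in> {0..<p} \<times> {0..<p ^ e}" and v: "v \<in> {0..<p} \<times> {0..<p ^ e}"
      and uv: "fst u \<noteq> fst v"
    obtain x where x: "label x = u" using label_surj[OF u] by blast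
    obtain y where y: "label y = v" using label_surj[OF v] by blast
    have xy: "\<not> int p dvd y - x" using uv x y label_fst by metis
    show "\<exists>!d. d \<in> D \<and> \<phi> (map_vertex R d) = u \<and> \<phi> (map_vertex R (L d)) = v"
    proof (rule ex1I[of _ "dart x y"])
      show "dart x y \<in> D \<and> \<phi> (map_vertex R (dart x y)) = u \<and> \<phi> (map_vertex R (L (dart x y))) = v"
        using xy x y by (simp add: ends)
      fix d assume d: "d \<in> D \<and> \<phi> (map_vertex R d) = u \<and> \<phi> (map_vertex R (L d)) = v"
      then obtain x' y' where d': "d = dart x' y'" "\<not> int p dvd y' - x'" by (auto elim: dart_cases)
      then have "label x' = label x" "label y' = label y" using d x y ends by auto
      then show "d = dart x y" using d' dart_cong[OF d'(2)] by (simp add: label_cong)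
    qed
  qed
qed

section \<open>Regularity of the automorphism group on the arcs\<close>

lemma aut_unique:
  assumes f: "f \<in> carrier (map_aut D R L)" and g: "g \<in> carrier (map_aut D R L)"
    and d: "d \<in> D" "f d = g d"
  shows "f = g"
proof -
  have f': "f \<in> extensional D" "\<And>x. x \<in> D \<Longrightarrow> f (R x) = R (f x) \<and> f (L x) = L (f x)"
    using f by (auto simp: map_aut_def Bij_def)
  have g': "g \<in> extensional D" "\<And>x. x \<in> D \<Longrightarrow> g (R x) = R (g x) \<and> g (L x) = L (g x)"
    using g by (auto simp: map_aut_def Bij_def)
  have "f c = g c" if "c \<in> D" for c
    using reach[OF d(1) that]
  \<comment> \<open>Both maps commute with \<open>R\<close> and \<open>L\<close>, so their agreement
    at one dart spreads along every connecting word.\<close>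
  proof (induction rule: rtrancl_induct)
    case (step y z)
    then show ?case using f' g' by auto
  qed (rule d(2))
  then show ?thesis using f'(1) g'(1) by (rule extensionalityI[rotated 2])
qed

text \<open>Coordinates of a dart are determined only modulo \<open>n\<close>, hence chosen; every
  use must therefore be stable under congruence.\<close>

definition src :: "'d \<Rightarrow> int" where "src d = fst (SOME (x, y). d = dart x y \<and> \<not> int p dvd y - x)"
definition tgt :: "'d \<Rightarrow> int" where "tgt d = snd (SOME (x, y). d = dart x y \<and> \<not> int p dvd y - x)"

lemma src_tgt:
  assumes "d \<in> D"
  shows "dart (src d) (tgt d) = d" "\<not> int p dvd tgt d - src d"
proof -
  have "\<exists>q. case q of (x, y) \<Rightarrow> d = dart x y \<and> \<not> int p dvd y - x"
    using assms by (auto simp: D_eq)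
  from someI_ex[OF this]
  show "dart (src d) (tgt d) = d" "\<not> int p dvd tgt d - src d"
    by (auto simp: src_def tgt_def split: prod.splits)
qed

lemma src_tgt_dart:
  assumes "\<not> int p dvd y - x"
  shows "[src (dart x y) = x] (mod n)" "[tgt (dart x y) = y] (mod n)"
  using src_tgt[OF dart_in_D[OF assms]] dart_eq_iff assms by blast+

text \<open>An affine substitution \<open>z \<mapsto> x' + u * (z - x)\<close> commutes with a
  rotation that multiplies differences by a constant. The unit \<open>u\<close> is the ratio of the
  two prescribed differences.\<close>

lemma aut_exists:
  assumes "c \<in> D" "d \<in> D"
  shows "\<exists>f. f \<in> carrier (map_aut D R L) \<and> f c = d"
proof -
  obtain x y where c: "c = dart x y" "\<not> int p dvd y - x" using \<open>c \<in> D\<close> by (rule dart_cases)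
  obtain x' y' where d: "d = dart x' y'" "\<not> int p dvd y' - x'" using \<open>d \<in> D\<close> by (rule dart_cases)
  obtain u where u: "\<not> int p dvd u" "[u * (y - x) = y' - x'] (mod n)"
    using unit_ratio[OF c(2) d(2)] .
  define g where "g z = x' + u * (z - x)" for z
  have g_diff: "g b - g a = u * (b - a)" for a b by (simp add: g_def algebra_simps)
  have g_unit: "\<not> int p dvd g b - g a" if "\<not> int p dvd b - a" for a b
    using unit_mult[OF u(1) that] by (simp add: g_diff)
  have g_cong: "[g a = g b] (mod n) \<longleftrightarrow> [a = b] (mod n)" for a b
  proof -
    have "coprime u n" using u(1) by (simp only: unit_iff)
    then have "coprime n u" by (simp add: coprime_commute)
    then show ?thesis
      by (simp add: cong_iff_dvd_diff g_diff coprime_dvd_mult_right_iff)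
  qed
  define f where "f = (\<lambda>d\<in>D. dart (g (src d)) (g (tgt d)))"
  have f_dart: "f (dart a b) = dart (g a) (g b)" if ab: "\<not> int p dvd b - a" for a b
  proof -
    have "dart (g (src (dart a b))) (g (tgt (dart a b))) = dart (g a) (g b)"
      using src_tgt_dart[OF ab] src_tgt(2)[OF dart_in_D[OF ab]]
      by (intro dart_cong g_unit) (simp_all add: g_cong)
    then show ?thesis using ab by (simp add: f_def)
  qed
  have f_in: "f d \<in> D" if "d \<in> D" for d using that by (auto elim!: dart_cases simp: f_dart g_unit)
  have f_inj: "inj_on f D"
  proof
    fix a b assume "a \<in> D" "b \<in> D" "f a = f b"
    obtain x1 y1 where a: "a = dart x1 y1" "\<not> int p dvd y1 - x1" using \<open>a \<in> D\<close> by (rule dart_cases)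
    obtain x2 y2 where b: "b = dart x2 y2" "\<not> int p dvd y2 - x2" using \<open>b \<in> D\<close> by (rule dart_cases)
    show "a = b" using \<open>f a = f b\<close> a b by (simp add: f_dart dart_eq_iff g_unit g_cong)
  qed
  have "f ` D = D" using endo_inj_surj[OF finite_D _ f_inj] f_in by auto
  then have "f \<in> Bij D" using f_inj by (auto simp: Bij_def bij_betw_def f_def)
  moreover have "f (R a) = R (f a) \<and> f (L a) = L (f a)" if "a \<in> D" for a
  proof -
    obtain x1 y1 where a: "a = dart x1 y1" "\<not> int p dvd y1 - x1" using \<open>a \<in> D\<close> by (rule dart_cases)
    have "f (R a) = dart (g x1) (g (x1 + int s * (y1 - x1)))"
      using a rot_unit[OF a(2), of 1] by (simp add: R_dart f_dart)
    also have "g (x1 + int s * (y1 - x1)) = g x1 + int s * (g y1 - g x1)"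
      by (simp add: g_def algebra_simps)
    finally show ?thesis
      using a by (simp add: R_dart L_dart f_dart g_unit not_dvd_swap)
  qed
  moreover have "f c = d"
  proof -
    have "[x' + u * (y - x) = x' + (y' - x')] (mod n)" by (intro cong_add u cong_refl)
    then have "dart x' y' = dart (g x) (g y)" using d(2) by (intro dart_cong) (simp_all add: g_def cong_sym)
    then show ?thesis using c d by (simp add: f_dart)
  qed
  ultimately show ?thesis by (auto simp: map_aut_def)
qed

theorem orientably_regular: "orientably_regular_embedding_Kmn D R L p (p ^ e)"
  unfolding orientably_regular_embedding_Kmn_def
  using orientable underlying_graph aut_exists aut_unique by metis

end

section \<open>Isomorphisms between affine maps\<close>

lemma affine_map_iso:
  assumes "affine_map p e s n dart D R L" "affine_map p e s n dart' D' R' L'"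
  shows "map_iso D R L D' R' L'"
proof -
  interpret M: affine_map p e s n dart D R L by fact
  interpret N: affine_map p e s n dart' D' R' L' by fact
  \<comment> \<open>Darts, rotation and reversal are all given by formulas in the coordinates, so
    keeping the coordinates is an isomorphism.\<close>
  define \<phi> where "\<phi> d = dart' (M.src d) (M.tgt d)" for d
  have \<phi>_dart: "\<phi> (dart x y) = dart' x y" if xy: "\<not> int p dvd y - x" for x y
    unfolding \<phi>_def
    using M.src_tgt_dart[OF xy] M.src_tgt(2)[OF M.dart_in_D[OF xy]] by (intro N.dart_cong)
  have "inj_on \<phi> D"
  proof
    fix a b assume "a \<in> D" "b \<in> D" "\<phi> a = \<phi> b"
    obtain x y where a: "a = dart x y" "\<not> int p dvd y - x" using \<open>a \<in> D\<close> by (rule M.dart_cases)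
    obtain x' y' where b: "b = dart x' y'" "\<not> int p dvd y' - x'" using \<open>b \<in> D\<close> by (rule M.dart_cases)
    show "a = b" using \<open>\<phi> a = \<phi> b\<close> a b by (simp add: \<phi>_dart M.dart_eq_iff N.dart_eq_iff)
  qed
  moreover have "\<phi> ` D = D'"
  proof
    show "\<phi> ` D \<subseteq> D'" by (auto elim!: M.dart_cases simp: \<phi>_dart)
    show "D' \<subseteq> \<phi> ` D"
    proof
      fix d assume "d \<in> D'"
      then obtain x y where "d = dart' x y" "\<not> int p dvd y - x" by (rule N.dart_cases)
      then show "d \<in> \<phi> ` D" using \<phi>_dart by (metis M.dart_in_D image_eqI)
    qed
  qed
  moreover have "\<phi> (R d) = R' (\<phi> d) \<and> \<phi> (L d) = L' (\<phi> d)" if "d \<in> D" for d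
  proof -
    obtain x y where d: "d = dart x y" "\<not> int p dvd y - x" using \<open>d \<in> D\<close> by (rule M.dart_cases)
    then show ?thesis using M.rot_unit[OF d(2), of 1]
      by (simp add: \<phi>_dart M.R_dart M.L_dart N.R_dart N.L_dart M.not_dvd_swap)
  qed
  ultimately show ?thesis by (auto simp: map_iso_def bij_betw_def)
qed

text \<open>The translation \<open>U\<close> of a dart by \<open>s - 1\<close> times its difference is the word
  \<open>(R L)\<^sup>-\<^sup>1 L R\<close> in the monodromy, and \<open>U R = R U\<^sup>s\<close> recovers \<open>s\<close> from the map.\<close>

lemma affine_map_iso_imp_cong:
  assumes "affine_map p e s n dart D R L" "affine_map p e s' n dart' D' R' L'"
    and iso: "map_iso D R L D' R' L'"
  shows "[int s = int s'] (mod n)"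
proof -
  interpret M: affine_map p e s n dart D R L by fact
  interpret N: affine_map p e s' n dart' D' R' L' by fact
  define U where "U d = (let u = (int s - 1) * (M.tgt d - M.src d) in dart (M.src d + u) (M.tgt d + u))" for d
  define U' where "U' d = (let u = (int s' - 1) * (N.tgt d - N.src d) in dart' (N.src d + u) (N.tgt d + u))" for d
  have U_dart: "U (dart x y) = dart (x + (int s - 1) * (y - x)) (y + (int s - 1) * (y - x))"
    if xy: "\<not> int p dvd y - x" for x y
    unfolding U_def Let_def using M.src_tgt(2)[OF M.dart_in_D[OF xy]]
    by (intro M.dart_cong cong_add cong_mult cong_diff cong_refl M.src_tgt_dart[OF xy]) simp
  have U'_dart: "U' (dart' x y) = dart' (x + (int s' - 1) * (y - x)) (y + (int s' - 1) * (y - x))"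
    if xy: "\<not> int p dvd y - x" for x y
    unfolding U'_def Let_def using N.src_tgt(2)[OF N.dart_in_D[OF xy]]
    by (intro N.dart_cong cong_add cong_mult cong_diff cong_refl N.src_tgt_dart[OF xy]) simp
  have U_pow: "(U ^^ k) (dart x y) =
      dart (x + int k * ((int s - 1) * (y - x))) (y + int k * ((int s - 1) * (y - x)))"
    if xy: "\<not> int p dvd y - x" for x y k
    using xy by (induction k) (simp_all add: U_dart algebra_simps)
  have U'_pow: "(U' ^^ k) (dart' x y) =
      dart' (x + int k * ((int s' - 1) * (y - x))) (y + int k * ((int s' - 1) * (y - x)))"
    if xy: "\<not> int p dvd y - x" for x y k
    using xy by (induction k) (simp_all add: U'_dart algebra_simps)
  have U_in: "(U ^^ k) d \<in> D" if "d \<in> D" for d k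
    using that by (auto elim!: M.dart_cases simp: U_pow)
  have U'_in: "(U' ^^ k) d \<in> D'" if "d \<in> D'" for d k
    using that by (auto elim!: N.dart_cases simp: U'_pow)
  have RLU: "R (L (U d)) = L (R d)" "U (R d) = R ((U ^^ s) d)" if "d \<in> D" for d
  proof -
    obtain x y where d: "d = dart x y" "\<not> int p dvd y - x" using \<open>d \<in> D\<close> by (rule M.dart_cases)
    have r: "\<not> int p dvd (x + int s * (y - x)) - x" using M.rot_unit[OF d(2), of 1] by simp
    have "R (L (U d)) = dart (y + (int s - 1) * (y - x)) (y + (int s - 1) * (y - x) + int s * (x - y))"
      using d by (simp add: U_dart M.L_dart M.R_dart M.not_dvd_swap)
    also have "\<dots> = dart (x + int s * (y - x)) x" by (rule arg_cong2[where f = dart]) (simp_all add: algebra_simps)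
    finally show "R (L (U d)) = L (R d)" using d r by (simp add: M.R_dart M.L_dart)
    show "U (R d) = R ((U ^^ s) d)" using d r by (simp add: M.R_dart U_dart U_pow algebra_simps)
  qed
  have RLU': "R' (L' (U' d)) = L' (R' d)" "U' (R' d) = R' ((U' ^^ s') d)" if "d \<in> D'" for d
  proof -
    obtain x y where d: "d = dart' x y" "\<not> int p dvd y - x" using \<open>d \<in> D'\<close> by (rule N.dart_cases)
    have r: "\<not> int p dvd (x + int s' * (y - x)) - x" using N.rot_unit[OF d(2), of 1] by simp
    have "R' (L' (U' d)) = dart' (y + (int s' - 1) * (y - x)) (y + (int s' - 1) * (y - x) + int s' * (x - y))"
      using d by (simp add: U'_dart N.L_dart N.R_dart N.not_dvd_swap)
    also have "\<dots> = dart' (x + int s' * (y - x)) x" by (rule arg_cong2[where f = dart']) (simp_all add: algebra_simps)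
    finally show "R' (L' (U' d)) = L' (R' d)" using d r by (simp add: N.R_dart N.L_dart)
    show "U' (R' d) = R' ((U' ^^ s') d)" using d r by (simp add: N.R_dart U'_dart U'_pow algebra_simps)
  qed
  obtain \<phi> where \<phi>: "bij_betw \<phi> D D'" "\<And>x. x \<in> D \<Longrightarrow> \<phi> (R x) = R' (\<phi> x)" "\<And>x. x \<in> D \<Longrightarrow> \<phi> (L x) = L' (\<phi> x)"
    using iso by (auto simp: map_iso_def)
  have \<phi>_in: "\<phi> d \<in> D'" if "d \<in> D" for d using \<phi>(1) that by (auto simp: bij_betw_def)
  \<comment> \<open>The relation \<open>R (L (U d)) = L (R d)\<close> pins \<open>U\<close> down, as
    \<open>R'\<close> and \<open>L'\<close> are injective on the darts; hence any isomorphism of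
    maps carries \<open>U\<close> to \<open>U'\<close>.\<close>
  have \<phi>U: "\<phi> (U d) = U' (\<phi> d)" if d: "d \<in> D" for d
  proof -
    have Ud: "U d \<in> D" "U' (\<phi> d) \<in> D'" using U_in[OF d, of 1] U'_in[OF \<phi>_in[OF d], of 1] by simp_all
    have "R' (L' (\<phi> (U d))) = \<phi> (R (L (U d)))" using Ud M.RL_in_D \<phi> by simp
    also have "\<dots> = R' (L' (U' (\<phi> d)))" using d \<phi>_in M.RL_in_D RLU(1) RLU'(1) \<phi> by simp
    finally show ?thesis
      using Ud \<phi>_in N.RL_in_D N.R_inj N.L_inj by (metis inj_onD)
  qed
  have \<phi>U_pow: "\<phi> ((U ^^ k) d) = (U' ^^ k) (\<phi> d)" if "d \<in> D" for d k
    using that by (induction k) (simp_all add: \<phi>U U_in)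
  obtain d where d: "d \<in> D" using M.D_nonempty by blast
  obtain x y where xy: "\<phi> d = dart' x y" "\<not> int p dvd y - x" using \<phi>_in[OF d] by (rule N.dart_cases)
  have "R' ((U' ^^ s) (\<phi> d)) = \<phi> (R ((U ^^ s) d))" using d U_in \<phi>U_pow \<phi> by simp
  also have "\<dots> = \<phi> (U (R d))" using RLU d by simp
  also have "\<dots> = U' (R' (\<phi> d))" using d M.RL_in_D \<phi>U \<phi> by simp
  also have "\<dots> = R' ((U' ^^ s') (\<phi> d))" using RLU' d \<phi>_in by simp
  finally have "(U' ^^ s) (\<phi> d) = (U' ^^ s') (\<phi> d)"
    using N.R_inj U'_in \<phi>_in d by (metis inj_onD)
  then have "[x + int s * ((int s' - 1) * (y - x)) = x + int s' * ((int s' - 1) * (y - x))] (mod n)"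
    using xy by (simp add: U'_pow N.dart_eq_iff)
  then have *: "[int s * ((int s' - 1) * (y - x)) = int s' * ((int s' - 1) * (y - x))] (mod n)"
    by (simp only: cong_add_lcancel)
  \<comment> \<open>Needed to cancel the factor \<open>s' - 1\<close>. If \<open>s'\<close> were 1
    modulo \<open>p\<close>, so would be all its powers, yet the unit \<open>2\<close> is one of
    them.\<close>
  have "\<not> int p dvd int s' - 1"
  proof
    assume "int p dvd int s' - 1"
    then have s1: "[int s' = 1] (mod int p)" by (simp add: cong_iff_dvd_diff)
    have p2: "\<not> int p dvd 2" using N.p_ge zdvd_imp_le[of "int p" 2] by auto
    then obtain i where i: "[2 = int s' ^ i] (mod n)" by (rule N.unit_eq_power)
    then have "[2 = int s' ^ i] (mod int p)" by (rule cong_dvd_modulus) (simp add: N.n_eq)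
    also have "[int s' ^ i = 1 ^ i] (mod int p)" using s1 by (rule cong_pow)
    finally have "int p dvd 1" by (simp add: cong_iff_dvd_diff)
    then show False using p2 by (meson dvd_trans one_dvd)
  qed
  then have "coprime ((int s' - 1) * (y - x)) n"
    using N.unit_mult xy(2) N.unit_iff by blast
  then show ?thesis using * by (simp only: cong_mult_rcancel)
qed

section \<open>The maps \<open>M\<^sub>1(p, e, j)\<close> in the affine model\<close>


lemma residue_primroot_power:
  assumes g: "residue_primroot m g" and k: "coprime k (totient m)"
  shows "residue_primroot m (g ^ k)"
  using assms by (auto simp: residue_primroot_def ord_power)

locale G1_params =
  fixes p e r :: nat
  assumes prime_p: "Factorial_Ring.prime p" and p_ge: "p \<ge> 3"
    and primroot: "residue_primroot (p ^ Suc e) r"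
begin

definition M :: nat where "M = p ^ Suc e"
definition N :: nat where "N = p ^ e * (p - 1)"

abbreviation G where "G \<equiv> G1 p e r"

lemma N_eq_totient: "N = totient M"
  unfolding N_def M_def by (rule totient_prime_power_Suc[OF prime_p, symmetric])

lemma M_gt_1: "M > 1"
  unfolding M_def using p_ge by (intro one_less_power) auto

lemma N_pos: "N > 0"
  using p_ge by (simp add: N_def)

lemma carrier_G: "carrier G = {0..<N} \<times> {0..<M}"
  by (simp add: G1_def N_def M_def)

lemma mult_G: "x \<otimes>\<^bsub>G\<^esub> y = ((fst x + fst y) mod N, (snd x * r ^ fst y + snd y) mod M)"
  by (simp add: G1_def N_def M_def)

lemma one_G: "\<one>\<^bsub>G\<^esub> = (0, 0)"
  by (simp add: G1_def)

lemma r_pow_cong: "[i = j] (mod N) \<Longrightarrow> [r ^ i = r ^ j] (mod M)"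
proof -
  have "coprime M r" using primroot by (simp add: residue_primroot_def M_def)
  moreover assume "[i = j] (mod N)"
  moreover have "ord M r = N" using primroot by (simp add: residue_primroot_def M_def N_eq_totient)
  ultimately show ?thesis by (simp add: order_divides_expdiff)
qed

text \<open>First coordinates are reduced modulo \<open>N\<close> and then used as exponents of
  \<open>r\<close>, so associativity rests on \<open>N\<close> being the order of \<open>r\<close>
  modulo \<open>M\<close>. Inverses exist because powers of \<open>r\<close> are invertible modulo
  \<open>M\<close>.\<close>

lemma group_G: "group G"
proof (rule groupI)
  fix x y z assume "x \<in> carrier G" "y \<in> carrier G" "z \<in> carrier G"
  have "[snd x * r ^ ((fst y + fst z) mod N) = snd x * r ^ (fst y + fst z)] (mod M)"
    by (intro cong_mult cong_refl r_pow_cong) (simp add: cong_def)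
  moreover have "[(snd y * r ^ fst z + snd z) mod M = snd y * r ^ fst z + snd z] (mod M)"
    by (simp add: cong_def)
  ultimately have "[snd x * r ^ ((fst y + fst z) mod N) + (snd y * r ^ fst z + snd z) mod M
      = snd x * r ^ (fst y + fst z) + (snd y * r ^ fst z + snd z)] (mod M)"
    by (rule cong_add)
  moreover have "[(snd x * r ^ fst y + snd y) mod M * r ^ fst z + snd z
      = (snd x * r ^ fst y + snd y) * r ^ fst z + snd z] (mod M)"
    by (intro cong_add cong_mult cong_refl) (simp add: cong_def)
  ultimately show "x \<otimes>\<^bsub>G\<^esub> y \<otimes>\<^bsub>G\<^esub> z = x \<otimes>\<^bsub>G\<^esub> (y \<otimes>\<^bsub>G\<^esub> z)"
    by (simp add: mult_G cong_def algebra_simps power_add mod_simps)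
next
  fix x assume x: "x \<in> carrier G"
  show "\<exists>y\<in>carrier G. y \<otimes>\<^bsub>G\<^esub> x = \<one>\<^bsub>G\<^esub>"
  proof -
    define i where "i = (N - fst x) mod N"
    have fx: "fst x < N" "snd x < M" using x by (auto simp: carrier_G)
    have "coprime (r ^ fst x) M"
      using primroot by (simp add: residue_primroot_def M_def coprime_commute)
    then obtain u where u: "[r ^ fst x * u = 1] (mod M)"
      using cong_solve_coprime_nat[of "r ^ fst x" M] by auto
    define k where "k = (M - snd x) * u mod M"
    have "[k * r ^ fst x + snd x = (M - snd x) * u * r ^ fst x + snd x] (mod M)"
      unfolding k_def by (intro cong_add cong_mult cong_refl) (simp add: cong_def)
    also have "(M - snd x) * u * r ^ fst x = (M - snd x) * (r ^ fst x * u)" by (simp add: mult_ac)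
    also have "[(M - snd x) * (r ^ fst x * u) + snd x = (M - snd x) * 1 + snd x] (mod M)"
      by (intro cong_add cong_mult cong_refl u)
    finally have "(k * r ^ fst x + snd x) mod M = 0" using fx by (simp add: cong_def)
    moreover have "(i + fst x) mod N = 0" using fx by (simp add: i_def mod_simps)
    ultimately have "(i, k) \<otimes>\<^bsub>G\<^esub> x = \<one>\<^bsub>G\<^esub>" by (simp add: mult_G one_G)
    moreover have "(i, k) \<in> carrier G"
      using N_pos M_gt_1 by (simp add: carrier_G i_def k_def)
    ultimately show ?thesis by blast
  qed
qed (use N_pos M_gt_1 in \<open>auto simp: carrier_G mult_G one_G\<close>)

lemma G1_a_pow: "G1_a [^]\<^bsub>G\<^esub> j = (j mod N, 0)"
proof -
  interpret group G by (rule group_G)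
  show ?thesis by (induction j) (simp_all add: one_G mult_G G1_a_def mod_simps)
qed

lemma M1_b_eq: "M1_b p e r = (N div 2, 1)"
proof -
  have "N div 2 < N" using N_pos by simp
  then show ?thesis
    unfolding M1_b_def N_def[symmetric] using G1_a_pow[of "N div 2"] M_gt_1 by (simp add: mult_G G1_c_def)
qed

text \<open>For \<open>j\<close> prime to \<open>N\<close> the subgroup generated by
  \<open>a^j\<close> is the whole first factor, so a right coset is recognised by the exponent of
  \<open>c\<close> alone. This is the vertex with residue \<open>x\<close>.\<close>

definition coset :: "int \<Rightarrow> (nat \<times> nat) set" where
  "coset x = {0..<N} \<times> {nat (x mod int M)}"

lemma coset_eq_iff: "coset x = coset y \<longleftrightarrow> [x = y] (mod int M)"
proof -
  have "coset x = coset y \<longleftrightarrow> nat (x mod int M) = nat (y mod int M)"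
    using N_pos by (auto simp: coset_def times_eq_iff)
  then show ?thesis using M_gt_1 by (auto simp: cong_def nat_eq_iff2)
qed

lemma unit_eq_r_power:
  assumes "\<not> int p dvd d" obtains i where "i < N" "[d = int r ^ i] (mod int M)"
  using residue_primroot_generates_units[OF prime_p primroot assms] that
  unfolding N_eq_totient M_def by auto

lemma r_power_unit: "\<not> int p dvd int r ^ i"
proof
  assume "int p dvd int r ^ i"
  then have "p dvd r" using prime_p by (metis int_dvd_int_iff of_nat_power prime_dvd_power)
  then show False
    using primroot prime_p p_ge by (auto simp: residue_primroot_def dest: coprime_common_divisor)
qed

section \<open>Vertices and darts of the coset map\<close>

context
  fixes j :: nat assumes j: "coprime j N" "j < N"
begin

lemma M1_a_eq: "M1_a p e r j = (j, 0)"
  using j by (simp add: M1_a_def G1_a_pow)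

lemma generate_M1_a: "generate G {(j, 0)} = {0..<N} \<times> {0}"
proof -
  interpret group G by (rule group_G)
  have a: "(j, 0) \<in> carrier G" using j M_gt_1 by (simp add: carrier_G)
  have pow: "(j, 0) [^]\<^bsub>G\<^esub> k = (j * k mod N, 0)" for k :: nat
    by (induction k) (simp_all add: one_G mult_G mod_simps add.commute)
  have "generate G {(j, 0)} = {(j * k mod N, 0) | k. True}"
    using generate_pow_on_finite_carrier[OF _ a] by (auto simp: pow carrier_G)
  also have "\<dots> = {0..<N} \<times> {0}"
  proof
    show "{0..<N} \<times> {0} \<subseteq> {(j * k mod N, 0) | k. True}"
    proof clarify
      fix i assume "i \<in> {0..<N}"
      obtain u where u: "[j * u = 1] (mod N)" using cong_solve_coprime_nat[OF j(1)] by auto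
      have "[j * u * i = 1 * i] (mod N)" by (intro cong_mult u cong_refl)
      then have "j * (u * i) mod N = i" using \<open>i \<in> {0..<N}\<close> by (simp add: cong_def mult.assoc)
      then show "\<exists>k. (i, 0) = (j * k mod N, 0) \<and> True" by (intro exI[of _ "u * i"]) simp
    qed
  qed (use N_pos in auto)
  finally show ?thesis .
qed

lemma coset_of:
  assumes g: "snd g < M"
  shows "generate G {(j, 0)} #>\<^bsub>G\<^esub> g = coset (int (snd g))"
proof -
  have "generate G {(j, 0)} #>\<^bsub>G\<^esub> g = (\<lambda>i. ((i + fst g) mod N, snd g)) ` {0..<N}"
    using g by (auto simp: generate_M1_a r_coset_def mult_G)
  also have "\<dots> = {0..<N} \<times> {snd g}"
  proof
    show "{0..<N} \<times> {snd g} \<subseteq> (\<lambda>i. ((i + fst g) mod N, snd g)) ` {0..<N}"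
    proof clarify
      fix i assume i: "i \<in> {0..<N}"
      define k where "k = (i + (N - fst g mod N)) mod N"
      have "(k + fst g) mod N = (i + (N - fst g mod N) + fst g mod N) mod N"
        by (simp add: k_def mod_simps)
      also have "i + (N - fst g mod N) + fst g mod N = i + N"
        using mod_less_divisor[OF N_pos, of "fst g"] by linarith
      also have "(i + N) mod N = i" using i by simp
      finally show "(i, snd g) \<in> (\<lambda>i. ((i + fst g) mod N, snd g)) ` {0..<N}"
        using N_pos by (intro image_eqI[of _ _ k]) (auto simp: k_def)
    qed
  qed (use N_pos in auto)
  finally show ?thesis using g by (simp add: coset_def flip: of_nat_mod)
qed

text \<open>Multiplying \<open>g = a^i c^k\<close> by \<open>b\<close> on the left turns the
  exponent of \<open>c\<close> into \<open>r^i + k\<close>, while the power of \<open>a\<close> in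
  front is absorbed by the coset. Source and target thus differ by \<open>r^i\<close>, and the extra
  factor \<open>a^j\<close> multiplies this difference by \<open>r^j\<close>.\<close>

lemma dart_of:
  assumes g: "g \<in> carrier G"
  shows "generate G {(j, 0)} #>\<^bsub>G\<^esub> g = coset (int (snd g))"
    "generate G {(j, 0)} #>\<^bsub>G\<^esub> (M1_b p e r \<otimes>\<^bsub>G\<^esub> g) = coset (int (snd g) + int r ^ fst g)"
    "generate G {(j, 0)} #>\<^bsub>G\<^esub> (M1_b p e r \<otimes>\<^bsub>G\<^esub> (j, 0) \<otimes>\<^bsub>G\<^esub> g) =
       coset (int (snd g) + int (r ^ j) * int r ^ fst g)"
proof -
  show "generate G {(j, 0)} #>\<^bsub>G\<^esub> g = coset (int (snd g))"
    using g by (intro coset_of) (auto simp: carrier_G)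
  have m: "[int (k mod M) = int k] (mod int M)" for k
    by (simp add: cong_def zmod_int)
  have "generate G {(j, 0)} #>\<^bsub>G\<^esub> (M1_b p e r \<otimes>\<^bsub>G\<^esub> g) = coset (int ((r ^ fst g + snd g) mod M))"
    using M_gt_1 by (subst coset_of) (simp_all add: mult_G M1_b_eq)
  also have "\<dots> = coset (int (r ^ fst g + snd g))" using m by (simp only: coset_eq_iff)
  finally show "generate G {(j, 0)} #>\<^bsub>G\<^esub> (M1_b p e r \<otimes>\<^bsub>G\<^esub> g) = coset (int (snd g) + int r ^ fst g)"
    by (simp add: add.commute)
  have "generate G {(j, 0)} #>\<^bsub>G\<^esub> (M1_b p e r \<otimes>\<^bsub>G\<^esub> (j, 0) \<otimes>\<^bsub>G\<^esub> g) =
      coset (int ((r ^ j mod M * r ^ fst g + snd g) mod M))"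
    using M_gt_1 by (subst coset_of) (simp_all add: mult_G M1_b_eq)
  also have "(r ^ j mod M * r ^ fst g + snd g) mod M = (r ^ j * r ^ fst g + snd g) mod M"
    by (intro mod_add_cong mod_mult_cong) simp_all
  also have "coset (int ((r ^ j * r ^ fst g + snd g) mod M)) = coset (int (r ^ j * r ^ fst g + snd g))" using m by (simp only: coset_eq_iff)
  finally show "generate G {(j, 0)} #>\<^bsub>G\<^esub> (M1_b p e r \<otimes>\<^bsub>G\<^esub> (j, 0) \<otimes>\<^bsub>G\<^esub> g) =
      coset (int (snd g) + int (r ^ j) * int r ^ fst g)"
    by (simp add: add.commute)
qed

lemma affine_map_M1:
  "affine_map p e (r ^ j) (int M) (\<lambda>x y. (coset x, coset y)) (M1_D p e r j) (M1_R p e r j) M1_L"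
proof
  show "Factorial_Ring.prime p" "3 \<le> p" by (fact prime_p p_ge)+
  show "int M = int p ^ Suc e" by (simp add: M_def)
  show "residue_primroot (p ^ Suc e) (r ^ j)"
    using primroot j by (intro residue_primroot_power) (simp_all add: N_eq_totient M_def)
next
  \<comment> \<open>The required \<open>g\<close> has the discrete logarithm of \<open>y - x\<close>
    to base \<open>r\<close> as its first coordinate and the residue of \<open>x\<close> as its
    second.\<close>
  have key: "(\<exists>g\<in>carrier G. [x = int (snd g)] (mod int M) \<and> [y = int (snd g) + int r ^ fst g] (mod int M))"
    if xy: "\<not> int p dvd y - x" for x y
  proof -
    obtain i where i: "i < N" "[y - x = int r ^ i] (mod int M)" using unit_eq_r_power xy by blast
    define k where "k = nat (x mod int M)"
    have k: "int k = x mod int M" "k < M" using M_gt_1 by (simp_all add: k_def nat_less_iff)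
    have xk: "[x = int k] (mod int M)" using k by (simp add: cong_def)
    have "[x + (y - x) = int k + int r ^ i] (mod int M)" by (intro cong_add xk i)
    then show ?thesis using xk i k by (intro bexI[of _ "(i, k)"]) (auto simp: carrier_G)
  qed
  show "M1_D p e r j = {(coset x, coset y) | x y. \<not> int p dvd y - x}"
  proof
    show "M1_D p e r j \<subseteq> {(coset x, coset y) | x y. \<not> int p dvd y - x}"
    proof
      fix d assume "d \<in> M1_D p e r j"
      then obtain g where "g \<in> carrier G" "d = (coset (int (snd g)), coset (int (snd g) + int r ^ fst g))"
        by (auto simp: M1_D_def coset_map_darts_def M1_a_eq dart_of)
      moreover have "\<not> int p dvd (int (snd g) + int r ^ fst g) - int (snd g)"
        using r_power_unit by simp
      ultimately show "d \<in> {(coset x, coset y) | x y. \<not> int p dvd y - x}" by blast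
    qed
    show "{(coset x, coset y) | x y. \<not> int p dvd y - x} \<subseteq> M1_D p e r j"
    proof
      fix d assume "d \<in> {(coset x, coset y) | x y. \<not> int p dvd y - x}"
      then obtain x y where d: "d = (coset x, coset y)" "\<not> int p dvd y - x" by blast
      then obtain g where g: "g \<in> carrier G" "[x = int (snd g)] (mod int M)"
          "[y = int (snd g) + int r ^ fst g] (mod int M)" using key by blast
      then have "d = (coset (int (snd g)), coset (int (snd g) + int r ^ fst g))"
        using d by (simp add: coset_eq_iff)
      then show "d \<in> M1_D p e r j"
        unfolding M1_D_def coset_map_darts_def M1_a_eq using g(1)
        by (intro CollectI exI[of _ g]) (simp add: dart_of)
    qed
  qed
  fix x y :: int assume xy: "\<not> int p dvd y - x"
  show "M1_L (coset x, coset y) = (coset y, coset x)" by (simp add: M1_L_def coset_map_L_def)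
  \<comment> \<open>The predicate under the choice operator in \<open>coset_map_R\<close>. Any
    \<open>g\<close> satisfying it has the same residues \<open>x\<close> and \<open>y\<close> at
    its ends, so the rotation does not depend on the choice.\<close>
  define P where "P g \<longleftrightarrow> g \<in> carrier G \<and> coset x = generate G {(j, 0)} #>\<^bsub>G\<^esub> g \<and>
    coset y = generate G {(j, 0)} #>\<^bsub>G\<^esub> (M1_b p e r \<otimes>\<^bsub>G\<^esub> g)" for g
  obtain h where "h \<in> carrier G" "[x = int (snd h)] (mod int M)"
      "[y = int (snd h) + int r ^ fst h] (mod int M)" using key[OF xy] by blast
  then have "P h" by (simp add: P_def dart_of coset_eq_iff)
  then have "P (SOME g. P g)" by (rule someI)
  then obtain g where g: "g = (SOME g. P g)" "P g" by blast
  then have g': "g \<in> carrier G" "[x = int (snd g)] (mod int M)" "[y = int (snd g) + int r ^ fst g] (mod int M)"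
    by (auto simp: P_def dart_of coset_eq_iff)
  have "M1_R p e r j (coset x, coset y) = (coset x, coset (int (snd g) + int (r ^ j) * int r ^ fst g))"
    using dart_of(3)[OF g'(1)] g(1)
    by (simp add: M1_R_def coset_map_R_def M1_a_eq P_def Let_def)
  also have "coset (int (snd g) + int (r ^ j) * int r ^ fst g) = coset (x + int (r ^ j) * (y - x))"
  proof -
    have "[y - x = int (snd g) + int r ^ fst g - int (snd g)] (mod int M)"
      by (intro cong_diff g')
    then have "[x + int (r ^ j) * (y - x) = int (snd g) + int (r ^ j) * int r ^ fst g] (mod int M)"
      by (intro cong_add cong_mult cong_refl g') simp
    then show ?thesis by (simp add: coset_eq_iff cong_sym)
  qed
  finally show "M1_R p e r j (coset x, coset y) = (coset x, coset (x + int (r ^ j) * (y - x)))" .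
next
  fix x y x' y' :: int
  show "(coset x, coset y) = (coset x', coset y') \<longleftrightarrow> [x = x'] (mod int M) \<and> [y = y'] (mod int M)"
    by (simp add: coset_eq_iff)
qed

end

end

section \<open>Skew morphisms of prime power order\<close>


lemma funpow_cong_mod:
  fixes f g :: "int \<Rightarrow> int"
  assumes "\<And>x. [f x = g x] (mod q)" "\<And>x y. [x = y] (mod q) \<Longrightarrow> [g x = g y] (mod q)"
  shows "[(f ^^ i) x = (g ^^ i) x] (mod q)"
proof (induction i)
  case (Suc i)
  have "[f ((f ^^ i) x) = g ((f ^^ i) x)] (mod q)" by (rule assms(1))
  also have "[g ((f ^^ i) x) = g ((g ^^ i) x)] (mod q)" by (intro assms(2) Suc)
  finally show ?case by simp
qed simp

text \<open>Functions on the integers stand for maps of the residues modulo \<open>q\<close>.\<close>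

locale skew_morphism =
  fixes p :: nat and q :: int and A :: "int \<Rightarrow> int"
  assumes prime_p: "Factorial_Ring.prime p" and q_pos: "q > 0"
    and zero: "[A 0 = 0] (mod q)"
    and cong_iff: "[A x = A y] (mod q) \<longleftrightarrow> [x = y] (mod q)"
    and skew: "\<exists>l. \<forall>z. [A (y + z) = A y + (A ^^ l) z] (mod q)"
    and p_order: "\<exists>k. \<forall>z. [(A ^^ (p ^ k)) z = z] (mod q)"
begin

lemma pow_cong_iff: "[(A ^^ i) x = (A ^^ i) y] (mod q) \<longleftrightarrow> [x = y] (mod q)"
  by (induction i) (simp_all add: cong_iff)

lemma pow_zero: "[(A ^^ i) 0 = 0] (mod q)"
proof (induction i)
  case (Suc i)
  then have "[A ((A ^^ i) 0) = A 0] (mod q)" by (simp only: cong_iff)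
  then show ?case using cong_trans[OF _ zero] by simp
qed simp

lemma pow_skew: "\<exists>l. \<forall>z. [(A ^^ i) (y + z) = (A ^^ i) y + (A ^^ l) z] (mod q)"
proof (induction i)
  case 0
  show ?case by (intro exI[of _ 0]) simp
next
  case (Suc i)
  then obtain l where l: "\<And>z. [(A ^^ i) (y + z) = (A ^^ i) y + (A ^^ l) z] (mod q)" by blast
  obtain k where k: "\<And>z. [A ((A ^^ i) y + z) = A ((A ^^ i) y) + (A ^^ k) z] (mod q)"
    using skew by blast
  show ?case
  proof (intro exI[of _ "k + l"] allI)
    fix z
    have "[A ((A ^^ i) (y + z)) = A ((A ^^ i) y + (A ^^ l) z)] (mod q)"
      using l by (simp only: cong_iff)
    also have "[A ((A ^^ i) y + (A ^^ l) z) = A ((A ^^ i) y) + (A ^^ k) ((A ^^ l) z)] (mod q)" by (rule k)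
    finally show "[(A ^^ Suc i) (y + z) = (A ^^ Suc i) y + (A ^^ (k + l)) z] (mod q)"
      by (simp add: funpow_add)
  qed
qed

definition trivial :: "nat \<Rightarrow> bool" where "trivial i \<longleftrightarrow> (\<forall>z. [(A ^^ i) z = z] (mod q))"

lemma trivial_add: "trivial i \<Longrightarrow> trivial (i + k) \<longleftrightarrow> trivial k"
proof -
  assume "trivial i"
  then have "[(A ^^ (i + k)) z = (A ^^ k) z] (mod q)" for z
    by (simp add: trivial_def funpow_add)
  then show ?thesis unfolding trivial_def by (meson cong_sym cong_trans)
qed

lemma trivial_mult: "trivial i \<Longrightarrow> trivial (i * k)"
proof (induction k)
  case 0
  show ?case by (simp add: trivial_def)
next
  case (Suc k)
  then show ?case using trivial_add[of i "i * k"] by simp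
qed

lemma trivial_gcd:
  assumes "trivial i" "trivial k" "i \<noteq> 0" shows "trivial (gcd i k)"
proof -
  obtain x y where "i * x = k * y + gcd i k" using bezout_nat[OF assms(3)] by blast
  then show ?thesis
    using trivial_mult[OF assms(1), of x] trivial_mult[OF assms(2), of y] trivial_add by metis
qed

text \<open>The exponents acting trivially are closed under gcd, and some power of \<open>p\<close>
  is among them; the least such power therefore divides all of them.\<close>

lemma order_prime_power: obtains j where "\<And>i. trivial i \<longleftrightarrow> p ^ j dvd i"
proof -
  have ex: "\<exists>k. trivial (p ^ k)" using p_order by (auto simp: trivial_def)
  define j where "j = (LEAST k. trivial (p ^ k))"
  have j: "trivial (p ^ j)" unfolding j_def by (rule LeastI_ex[OF ex])
  have "trivial i \<longleftrightarrow> p ^ j dvd i" for i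
  proof
    assume "trivial i"
    then have "trivial (gcd (p ^ j) i)" using j prime_p by (intro trivial_gcd) auto
    moreover obtain k where k: "k \<le> j" "gcd (p ^ j) i = p ^ k"
      using divides_primepow_nat[OF prime_p] by (metis gcd_dvd1)
    ultimately have "j \<le> k" unfolding j_def by (metis Least_le)
    then show "p ^ j dvd i" using k by (metis gcd_dvd2 le_antisym)
  qed (use j trivial_mult in blast)
  then show ?thesis by (rule that)
qed

text \<open>Orbit counting for a \<open>p\<close>-group: the number of fixed residues is congruent
  to \<open>q\<close>, hence to 0, modulo \<open>p\<close>. Since \<open>0\<close> is fixed, it
  cannot be the only one.\<close>

lemma ex_nonzero_fixpoint:
  assumes "int p dvd q" obtains y where "\<not> q dvd y" "[A y = y] (mod q)"
proof -
  define F where "F y = A y mod q" for y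
  define Y where "Y = {0..<q}"
  have F_pow: "(F ^^ i) y = (A ^^ i) y mod q" if "y \<in> Y" for i y
  proof (induction i)
    case (Suc i)
    have "[A ((A ^^ i) y mod q) = A ((A ^^ i) y)] (mod q)" by (simp add: cong_iff)
    then show ?case using Suc by (simp add: F_def cong_def)
  qed (use that in \<open>simp add: Y_def\<close>)
  have inj: "inj_on F Y"
  proof
    fix x y assume "x \<in> Y" "y \<in> Y" "F x = F y"
    then have "[x = y] (mod q)" using cong_iff by (simp add: F_def cong_def)
    then show "x = y" using \<open>x \<in> Y\<close> \<open>y \<in> Y\<close> by (simp add: Y_def cong_def)
  qed
  obtain k where k: "\<And>z. [(A ^^ (p ^ k)) z = z] (mod q)" using p_order by blast
  have "(F ^^ (p ^ k)) y = y" if "y \<in> Y" for y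
    using F_pow[OF that] k[of y] that by (simp add: Y_def cong_def)
  moreover have "F ` Y \<subseteq> Y" using q_pos by (auto simp: F_def Y_def)
  moreover have "finite Y" by (simp add: Y_def)
  ultimately have "[card Y = card {y \<in> Y. F y = y}] (mod p)"
    using inj by (intro card_fixpoints_cong[OF prime_p]) auto
  moreover have "p dvd card Y"
    using assms q_pos by (simp add: Y_def flip: int_dvd_int_iff)
  ultimately have pd: "p dvd card {y \<in> Y. F y = y}" by (simp add: cong_dvd_iff)
  have "0 \<in> {y \<in> Y. F y = y}" using zero q_pos by (simp add: F_def Y_def cong_def)
  then have "{y \<in> Y. F y = y} \<noteq> {0}" using pd prime_p by (metis card_1_singleton_iff nat_dvd_1_iff_1 not_prime_1 One_nat_def)
  then obtain y where "y \<in> Y" "F y = y" "y \<noteq> 0" using \<open>0 \<in> _\<close> by blast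
  then have "\<not> q dvd y" "[A y = y] (mod q)"
    by (auto simp: Y_def F_def cong_def dest: zdvd_not_zless[rotated])
  then show ?thesis by (rule that)
qed

text \<open>A residue fixed by \<open>A\<close> is fixed by all powers of \<open>A\<close>, so the
  unknown exponent in the skew rule has no effect on it.\<close>

lemma fix_add:
  assumes "[A x = x] (mod q)" "[A y = y] (mod q)" shows "[A (x + y) = x + y] (mod q)"
proof -
  have pow: "[(A ^^ i) y = y] (mod q)" for i
  proof (induction i)
    case (Suc i)
    then have "[A ((A ^^ i) y) = A y] (mod q)" by (simp only: cong_iff)
    then show ?case using cong_trans[OF _ assms(2)] by simp
  qed simp
  obtain l where "\<And>z. [A (x + z) = A x + (A ^^ l) z] (mod q)" using skew by blast
  from this[of y] show ?thesis using cong_trans[OF _ cong_add[OF assms(1) pow]] by blast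
qed

lemma fix_mult: "[A x = x] (mod q) \<Longrightarrow> [A (int k * x) = int k * x] (mod q)"
proof (induction k)
  case (Suc k)
  then show ?case using fix_add[of x "int k * x"] by (simp add: algebra_simps)
qed (simp add: zero)

end

section \<open>Reduction of a skew morphism from \<open>p ^ Suc m\<close> to
  \<open>p ^ m\<close>\<close>

locale skew_morphism_Suc = skew_morphism p "int p ^ Suc m" A for p m A
begin

abbreviation q where "q \<equiv> int p ^ Suc m"
abbreviation q' where "q' \<equiv> int p ^ m"

text \<open>Multiples of a fixed residue are fixed, and a residue not divisible by \<open>q\<close>
  has \<open>q'\<close> among its multiples, because its gcd with \<open>q\<close> is a power of
  \<open>p\<close> dividing \<open>q'\<close>.\<close>

lemma fix_q': "[A q' = q'] (mod q)"
proof -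
  obtain y where y: "\<not> q dvd y" "[A y = y] (mod q)" by (rule ex_nonzero_fixpoint) simp
  have "gcd y q dvd q" by simp
  then have "nat (gcd y q) dvd p ^ Suc m" by (simp add: nat_dvd_iff flip: of_nat_power)
  then obtain i where i: "i \<le> Suc m" "nat (gcd y q) = p ^ i"
    using divides_primepow_nat[OF prime_p] by blast
  then have g: "gcd y q = int p ^ i" by (metis gcd_ge_0_int int_nat_eq of_nat_power)
  have "i \<noteq> Suc m" using g y(1) by (metis gcd_dvd1)
  then have "gcd y q dvd q'" using g i(1) by (auto intro: le_imp_power_dvd)
  then obtain c where c: "q' = gcd y q * c" by blast
  obtain x where x: "[y * x = gcd y q] (mod q)" using cong_solve_int by blast
  define k where "k = nat (x * c mod q)"
  have "[int k * y = (x * c) * y] (mod q)"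
    using q_pos by (intro cong_mult cong_refl) (simp add: k_def)
  also have "(x * c) * y = (y * x) * c" by simp
  also have "[(y * x) * c = gcd y q * c] (mod q)" by (intro cong_mult x cong_refl)
  finally have k: "[int k * y = q'] (mod q)" by (simp only: c[symmetric])
  have "[A q' = A (int k * y)] (mod q)" using k by (simp only: cong_iff cong_sym)
  also have "[A (int k * y) = int k * y] (mod q)" using y(2) by (rule fix_mult)
  also note k
  finally show ?thesis .
qed

text \<open>Multiples of \<open>q'\<close> are fixed by every power of \<open>A\<close>, so here the
  skew rule degenerates to additivity, whatever its exponent is.\<close>

lemma shift_nat: "[A (y + int c * q') = A y + int c * q'] (mod q)"
proof -
  obtain l where l: "\<And>z. [A (y + z) = A y + (A ^^ l) z] (mod q)" using skew by blast
  have "[(A ^^ i) (int c * q') = int c * q'] (mod q)" for i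
  proof (induction i)
    case (Suc i)
    then have "[A ((A ^^ i) (int c * q')) = A (int c * q')] (mod q)" by (simp only: cong_iff)
    also have "[A (int c * q') = int c * q'] (mod q)" by (intro fix_mult fix_q')
    finally show ?case by simp
  qed simp
  then show ?thesis using cong_trans[OF l cong_add[OF cong_refl]] by blast
qed

lemma shift: "[A (y + c * q') = A y + c * q'] (mod q)"
proof -
  define k where "k = nat (c mod int p)"
  have "[int k = c] (mod int p)" using prime_gt_0_nat[OF prime_p] by (simp add: k_def)
  then have k: "[int k * q' = c * q'] (mod q)"
    by (simp add: cong_iff_dvd_diff flip: left_diff_distrib)
  then have "[A (y + c * q') = A (y + int k * q')] (mod q)"
    by (simp only: cong_iff cong_add_lcancel cong_sym)
  also have "[A (y + int k * q') = A y + int k * q'] (mod q)" by (rule shift_nat)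
  also have "[A y + int k * q' = A y + c * q'] (mod q)" using k by (intro cong_add cong_refl)
  finally show ?thesis .
qed

lemma pow_shift: "[(A ^^ i) (y + c * q') = (A ^^ i) y + c * q'] (mod q)"
proof (induction i)
  case (Suc i)
  then have "[A ((A ^^ i) (y + c * q')) = A ((A ^^ i) y + c * q')] (mod q)" by (simp only: cong_iff)
  also have "[A ((A ^^ i) y + c * q') = A ((A ^^ i) y) + c * q'] (mod q)" by (rule shift)
  finally show ?case by simp
qed simp

lemma cong_q'E:
  assumes "[x = y] (mod q')" obtains c where "x = y + c * q'"
proof -
  obtain c where "x - y = q' * c" using assms by (auto simp: cong_iff_dvd_diff)
  then show ?thesis using that[of c] by (simp add: algebra_simps)
qed

lemma cong_q: "[x = y] (mod q) \<Longrightarrow> [x = y] (mod q')"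
  by (rule cong_dvd_modulus) auto

text \<open>Commuting with translations by multiples of \<open>q'\<close> makes \<open>A\<close>
  well defined modulo \<open>q'\<close>, and injectivity modulo \<open>q\<close> then yields
  injectivity modulo \<open>q'\<close>.\<close>

lemma reduce: "skew_morphism p q' A"
proof
  show "Factorial_Ring.prime p" by (rule prime_p)
  show "q' > 0" using prime_gt_0_nat[OF prime_p] by simp
  show "[A 0 = 0] (mod q')" using cong_q[OF zero] .
  show "[A x = A y] (mod q') \<longleftrightarrow> [x = y] (mod q')" for x y
  proof
    assume "[x = y] (mod q')"
    then obtain c where "x = y + c * q'" by (rule cong_q'E)
    then have "[A x = A y + c * q'] (mod q')" using cong_q[OF shift] by simp
    then show "[A x = A y] (mod q')" by (simp add: cong_def)
  next
    assume "[A x = A y] (mod q')"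
    then obtain c where "A x = A y + c * q'" by (rule cong_q'E)
    then have "[A x = A (y + c * q')] (mod q)" using cong_sym[OF shift] by metis
    then have "[x = y + c * q'] (mod q')" using cong_q by (simp only: cong_iff)
    then show "[x = y] (mod q')" by (simp add: cong_def)
  qed
  show "\<exists>l. \<forall>z. [A (y + z) = A y + (A ^^ l) z] (mod q')" for y using skew cong_q by blast
  show "\<exists>k. \<forall>z. [(A ^^ (p ^ k)) z = z] (mod q')" using p_order cong_q by blast
qed

text \<open>The displacement \<open>h z * q'\<close> is a multiple of \<open>q'\<close>, and
  translations by such multiples commute with \<open>A\<close>; displacements therefore simply add
  up.\<close>

lemma funpow_mult_offset:
  assumes l: "\<And>z. [(A ^^ l) z = z + h z * q'] (mod q)"
  shows "[(A ^^ (l * i)) z = z + int i * h z * q'] (mod q)"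
proof (induction i)
  case (Suc i)
  have "(A ^^ (l * Suc i)) z = (A ^^ l) ((A ^^ (l * i)) z)" by (simp add: funpow_add)
  also have "[\<dots> = (A ^^ l) (z + int i * h z * q')] (mod q)" using Suc by (simp only: pow_cong_iff)
  also have "[(A ^^ l) (z + int i * h z * q') = (A ^^ l) z + int i * h z * q'] (mod q)" by (rule pow_shift)
  also have "[(A ^^ l) z + int i * h z * q' = (z + h z * q') + int i * h z * q'] (mod q)"
    by (intro cong_add l cong_refl)
  also have "(z + h z * q') + int i * h z * q' = z + int (Suc i) * h z * q'" by (simp add: algebra_simps)
  finally show ?case .
qed simp

lemma offset_cong: "[x + c * q' = x + d * q'] (mod q) \<longleftrightarrow> [c = d] (mod int p)"
proof -
  have "p > 0" by (rule prime_gt_0_nat[OF prime_p])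
  then show ?thesis by (simp add: cong_iff_dvd_diff flip: left_diff_distrib)
qed

lemma offset_function:
  assumes "\<And>z. [(A ^^ l) z = z] (mod q')" obtains h where "\<And>z. (A ^^ l) z = z + h z * q'"
proof
  fix z
  have "q' dvd (A ^^ l) z - z" using assms by (simp add: cong_iff_dvd_diff)
  then show "(A ^^ l) z = z + (((A ^^ l) z - z) div q') * q'" by simp
qed

text \<open>The powers of \<open>A\<close> that are trivial modulo \<open>q'\<close> have order dividing \<open>p\<close>, so they are all powers of
  any nontrivial one among them.\<close>

lemma trivial_below_is_power:
  assumes v: "\<And>z. [(A ^^ v) z = z] (mod q')" "\<not> trivial v" and l: "\<And>z. [(A ^^ l) z = z] (mod q')"
  obtains i where "\<And>z. [(A ^^ l) z = (A ^^ (v * i)) z] (mod q)"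
proof -
  obtain j where j: "\<And>i. trivial i \<longleftrightarrow> p ^ j dvd i" by (rule order_prime_power) blast
  have "j \<noteq> 0" using j[of v] v(2) by (metis one_dvd power_0)
  then obtain j' where j': "j = Suc j'" by (cases j) auto
  \<comment> \<open>Repeating \<open>p\<close> times a power that is trivial modulo
    \<open>q'\<close> multiplies its displacement by \<open>p\<close>, which makes it vanish modulo
    \<open>q\<close>.\<close>
  have div: "p ^ j' dvd l" if l: "\<And>z. [(A ^^ l) z = z] (mod q')" for l
  proof -
    obtain h where "\<And>z. (A ^^ l) z = z + h z * q'" using offset_function[OF l] by blast
    then have "[(A ^^ (l * p)) z = z + int p * h z * q'] (mod q)" for z
      by (intro funpow_mult_offset) simp
    moreover have "[z + int p * h z * q' = z] (mod q)" for z by (simp add: cong_iff_dvd_diff)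
    ultimately have "trivial (l * p)" unfolding trivial_def using cong_trans by blast
    then have "p ^ j dvd l * p" by (simp only: j)
    then have "p ^ j' * p dvd l * p" by (simp only: j' power_Suc2)
    then show ?thesis using prime_gt_0_nat[OF prime_p] by simp
  qed
  obtain v' where v': "v = p ^ j' * v'" using div[OF v(1)] by blast
  obtain l' where l': "l = p ^ j' * l'" using div[OF l] by blast
  \<comment> \<open>This is where nontriviality of \<open>v\<close> is spent: \<open>v'\<close>
    becomes invertible modulo \<open>p\<close>, and \<open>l\<close> is obtained from
    \<open>v\<close> by solving a linear congruence.\<close>
  have "\<not> p dvd v'" using v(2) v' j[of v] j' prime_gt_0_nat[OF prime_p] by (simp add: mult.commute)
  then have "coprime v' p" using prime_p by (metis coprime_commute prime_imp_coprime)
  then obtain w where w: "[v' * w = 1] (mod p)" using cong_solve_coprime_nat by auto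
  have "[v' * w * l' = 1 * l'] (mod p)" by (intro cong_mult w cong_refl)
  then have "[p ^ j' * (v' * w * l') = p ^ j' * l'] (mod p ^ j' * p)"
    by (simp add: cong_def mod_mult_mult1)
  then have vl: "[v * (w * l') = l] (mod p ^ j)" by (simp add: v' l' j' mult_ac)
  have red: "[(A ^^ i) z = (A ^^ (i mod p ^ j)) z] (mod q)" for i z
  proof -
    have "trivial (p ^ j * (i div p ^ j))" by (simp only: j dvd_triv_left)
    then have "[(A ^^ (p ^ j * (i div p ^ j))) ((A ^^ (i mod p ^ j)) z) = (A ^^ (i mod p ^ j)) z] (mod q)"
      unfolding trivial_def by blast
    then show ?thesis by (simp add: flip: comp_apply[of "A ^^ _"] funpow_add)
  qed
  have "[(A ^^ l) z = (A ^^ (v * (w * l'))) z] (mod q)" for z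
    using red[of l z] red[of "v * (w * l')" z] vl by (metis cong_def)
  then show ?thesis by (rule that)
qed

text \<open>With displacement \<open>f\<close>, the skew rule reads
  \<open>f (1 + z) = f 1 + i * f z\<close> modulo \<open>p\<close>, so \<open>f k\<close> is
  \<open>f 1\<close> times a geometric sum with ratio \<open>i\<close>. Unless \<open>f 1\<close>
  vanishes, \<open>f q' = 0\<close> forces \<open>i\<close> to be 1 modulo \<open>p\<close>, and
  then the sum is \<open>k\<close>.\<close>

lemma trivial_below_linear:
  assumes v: "\<And>z. [(A ^^ v) z = z] (mod q')"
  obtains b where "\<And>z. [(A ^^ v) z = z + b * z * q'] (mod q)"
proof (cases "trivial v")
  case True
  then show ?thesis using that[of 0] unfolding trivial_def by simp
next
  case False
  obtain f where f: "\<And>z. (A ^^ v) z = z + f z * q'" using offset_function[OF v] by blast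
  obtain l where l: "\<And>z. [(A ^^ v) (1 + z) = (A ^^ v) 1 + (A ^^ l) z] (mod q)" using pow_skew by blast
  \<comment> \<open>Comparing the two sides of the skew rule modulo \<open>q'\<close> shows that the
    unknown power is trivial there as well; it is thus a power of \<open>A ^^ v\<close> modulo
    \<open>q\<close>.\<close>
  have "[(A ^^ l) z = z] (mod q')" for z
  proof -
    have "[1 + z = (A ^^ v) (1 + z)] (mod q')" by (rule cong_sym[OF v])
    also have "[(A ^^ v) (1 + z) = (A ^^ v) 1 + (A ^^ l) z] (mod q')" by (rule cong_q[OF l])
    also have "[(A ^^ v) 1 + (A ^^ l) z = 1 + (A ^^ l) z] (mod q')" by (intro cong_add v cong_refl)
    finally show ?thesis by (simp only: cong_add_lcancel cong_sym)
  qed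
  then obtain i where i: "\<And>z. [(A ^^ l) z = (A ^^ (v * i)) z] (mod q)"
    using trivial_below_is_power[OF v False] by blast
  have rec: "[f (1 + z) = f 1 + int i * f z] (mod int p)" for z
  proof -
    have "[(1 + z) + f (1 + z) * q' = (A ^^ v) 1 + (A ^^ l) z] (mod q)" using l[of z] by (simp add: f)
    also have "[(A ^^ v) 1 + (A ^^ l) z = (A ^^ v) 1 + (A ^^ (v * i)) z] (mod q)"
      by (intro cong_add i cong_refl)
    also have "[(A ^^ v) 1 + (A ^^ (v * i)) z = (1 + f 1 * q') + (z + int i * f z * q')] (mod q)"
      by (intro cong_add funpow_mult_offset) (simp_all add: f)
    also have "(1 + f 1 * q') + (z + int i * f z * q') = (1 + z) + (f 1 + int i * f z) * q'"
      by (simp add: algebra_simps)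
    finally show ?thesis by (simp only: offset_cong)
  qed
  have f0: "[f 0 = 0] (mod int p)"
    using pow_zero[of v] offset_cong[of 0 "f 0" 0] by (simp add: f)
  have f_sum: "[f (int k) = f 1 * (\<Sum>t<k. int i ^ t)] (mod int p)" for k
  proof (induction k)
    case (Suc k)
    have "[f (int (Suc k)) = f 1 + int i * f (int k)] (mod int p)" using rec[of "int k"] by simp
    also have "[f 1 + int i * f (int k) = f 1 + int i * (f 1 * (\<Sum>t<k. int i ^ t))] (mod int p)"
      by (intro cong_add cong_mult cong_refl Suc)
    also have "f 1 + int i * (f 1 * (\<Sum>t<k. int i ^ t)) = f 1 * (\<Sum>t<Suc k. int i ^ t)"
      by (simp only: sum.lessThan_Suc_shift) (simp add: sum_distrib_left algebra_simps)
    finally show ?case .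
  qed (simp add: f0)
  have f_nat: "[f (int k) = f 1 * int k] (mod int p)" for k
  proof (cases "int p dvd f 1")
    case True
    then have "[f 1 * c = f 1 * int k] (mod int p)" for c by (simp add: cong_iff_dvd_diff)
    then show ?thesis using f_sum[of k] cong_trans by blast
  next
    case False
    \<comment> \<open>All powers of \<open>A\<close> fix \<open>q'\<close>, so its displacement is
      zero; this is the closing condition on the geometric sum.\<close>
    have "[q' + f q' * q' = 0 + 1 * q'] (mod q)"
      using cong_trans[OF pow_shift[of v 0 1] cong_add[OF pow_zero cong_refl]] by (simp add: f)
    then have "[q' + f q' * q' = q' + 0 * q'] (mod q)" by simp
    then have "[f q' = 0] (mod int p)" by (simp only: offset_cong)
    then have "[f 1 * (\<Sum>t<p ^ m. int i ^ t) = 0] (mod int p)"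
      using f_sum[of "p ^ m"] by (metis cong_sym cong_trans of_nat_power)
    then have "int p dvd (\<Sum>t<p ^ m. int i ^ t)"
      using False prime_p by (simp add: cong_0_iff prime_dvd_mult_iff)
    \<comment> \<open>Multiplying by \<open>i - 1\<close> telescopes the sum to
      \<open>i ^ (p ^ m) - 1\<close>, and by Fermat the power equals \<open>i\<close> modulo
      \<open>p\<close>.\<close>
    then have "int p dvd (int i - 1) * (\<Sum>t<p ^ m. int i ^ t)" by simp
    also have "(int i - 1) * (\<Sum>t<p ^ m. int i ^ t) = int i ^ (p ^ m) - 1"
      by (rule power_diff_1_eq[symmetric])
    finally have "[int i ^ (p ^ m) = 1] (mod int p)" by (simp add: cong_iff_dvd_diff)
    moreover have "[int i ^ (p ^ k) = int i] (mod int p)" for k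
    proof (induction k)
      case (Suc k)
      have "int i ^ (p ^ Suc k) = (int i ^ (p ^ k)) ^ p" by (simp only: power_Suc2 power_mult)
      also have "[(int i ^ (p ^ k)) ^ p = int i ^ p] (mod int p)" by (intro cong_pow Suc)
      also have "[int i ^ p = int i] (mod int p)"
      proof (cases "p dvd i")
        case True
        then have "[int i = 0] (mod int p)" by (simp add: cong_0_iff)
        then have "[int i ^ p = 0 ^ p] (mod int p)" by (rule cong_pow)
        then show ?thesis using prime_gt_0_nat[OF prime_p] \<open>[int i = 0] (mod int p)\<close>
          by (metis cong_sym cong_trans zero_power)
      next
        case False
        then have "[i ^ (p - 1) = 1] (mod p)" using fermat_theorem prime_p by blast
        then have "[i ^ (p - 1) * i = 1 * i] (mod p)" by (intro cong_mult cong_refl)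
        moreover have "i ^ (p - 1) * i = i ^ p" by (rule power_minus_mult[OF prime_gt_0_nat[OF prime_p]])
        ultimately have "[i ^ p = i] (mod p)" by simp
        then show ?thesis by (metis cong_int_iff of_nat_power)
      qed
      finally show ?case .
    qed simp
    ultimately have i1: "[int i = 1] (mod int p)" by (metis cong_sym cong_trans)
    have "[(\<Sum>t<k. int i ^ t) = (\<Sum>t<k. 1)] (mod int p)"
      by (intro cong_sum) (metis i1 cong_pow power_one)
    then have "[f 1 * (\<Sum>t<k. int i ^ t) = f 1 * int k] (mod int p)" by (intro cong_mult cong_refl) simp
    then show ?thesis using f_sum[of k] cong_trans by blast
  qed
  have "[(A ^^ v) z = z + f 1 * z * q'] (mod q)" for z
  proof -
    define k where "k = nat (z mod q)"
    have k: "[z = int k] (mod q)" using q_pos by (simp add: k_def cong_sym)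
    then have "[(A ^^ v) z = (A ^^ v) (int k)] (mod q)" by (simp only: pow_cong_iff)
    also have "(A ^^ v) (int k) = int k + f (int k) * q'" by (rule f)
    also have "[int k + f (int k) * q' = int k + f 1 * int k * q'] (mod q)"
      using f_nat by (simp only: offset_cong)
    also have "[int k + f 1 * int k * q' = z + f 1 * z * q'] (mod q)"
      by (intro cong_add cong_mult cong_refl cong_sym[OF k])
    finally show ?thesis .
  qed
  then show ?thesis by (rule that)
qed

end

section \<open>Full cycles among the affine skew maps\<close>

lemma sum_lessThan_id_dvd:
  assumes "odd p" shows "int p dvd (\<Sum>k<p. int k)"
proof -
  obtain h where h: "p = 2 * h + 1" using assms by (rule oddE)
  have "2 * (\<Sum>k<n. int k) = int n * (int n - 1)" for n
    by (induction n) (simp_all add: algebra_simps)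
  from this[of p] have "(\<Sum>k<p. int k) = int p * int h" using h by simp
  then show ?thesis by simp
qed

text \<open>For \<open>u\<close> prime to \<open>p\<close> the conclusion says that the map is one
  cycle modulo \<open>p ^ Suc m\<close>. In the inductive step the \<open>p ^ m\<close>-th iterate
  \<open>h\<close> is a translation modulo \<open>q'\<close>, so its linear part is trivial there
  and \<open>h z = w + z + b * z * q'\<close> modulo \<open>q\<close>. In the \<open>p\<close>-th
  iterate of \<open>h\<close> the corrections add up to a multiple of \<open>p * q'\<close>.\<close>

lemma skew_affine_funpow:
  assumes "skew_morphism p (int p ^ Suc m) A" and odd: "odd p"
    and A_p: "\<And>z. [A z = z] (mod int p)"
  shows "[((\<lambda>z. u + (A ^^ v) z) ^^ (p ^ m)) z = z + int p ^ m * u] (mod int p ^ Suc m)"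
  using assms(1)
proof (induction m arbitrary: z)
  case 0
  have "[(A ^^ v) z = z] (mod int p)"
    using funpow_cong_mod[of A id "int p" v z] A_p by simp
  then show ?case by (simp add: cong_def mod_simps add.commute) (metis mod_add_right_eq)
next
  case (Suc m)
  interpret skew_morphism_Suc p "Suc m" A
    using Suc.prems by (simp add: skew_morphism_Suc_def)
  define g where "g z = u + (A ^^ v) z" for z
  define h where "h = g ^^ (p ^ m)"
  have IH: "[h z = z + int p ^ m * u] (mod q')" for z
    unfolding h_def g_def by (rule Suc.IH[OF reduce])
  \<comment> \<open>By the skew rule, maps whose linear part is a power of \<open>A\<close> are
    closed under composition.\<close>
  have form: "\<exists>w l. \<forall>z. [(g ^^ i) z = w + (A ^^ l) z] (mod q)" for i
  proof (induction i)
    case 0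
    show ?case by (intro exI[of _ 0]) simp
  next
    case (Suc i)
    then obtain w l where wl: "\<And>z. [(g ^^ i) z = w + (A ^^ l) z] (mod q)" by blast
    obtain k where k: "\<And>z. [(A ^^ v) (w + z) = (A ^^ v) w + (A ^^ k) z] (mod q)"
      using pow_skew by blast
    show ?case
    proof (intro exI[of _ "u + (A ^^ v) w"] exI[of _ "k + l"] allI)
      fix z
      have "(g ^^ Suc i) z = u + (A ^^ v) ((g ^^ i) z)" by (simp add: g_def)
      also have "[\<dots> = u + (A ^^ v) (w + (A ^^ l) z)] (mod q)"
        using wl by (simp only: cong_add_lcancel pow_cong_iff)
      also have "[u + (A ^^ v) (w + (A ^^ l) z) = u + ((A ^^ v) w + (A ^^ k) ((A ^^ l) z))] (mod q)"
        using k by (simp only: cong_add_lcancel)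
      finally show "[(g ^^ Suc i) z = u + (A ^^ v) w + (A ^^ (k + l)) z] (mod q)"
        by (simp add: funpow_add add.assoc)
    qed
  qed
  obtain w l where wl: "\<And>z. [h z = w + (A ^^ l) z] (mod q)" using form unfolding h_def by blast
  have w: "[w = int p ^ m * u] (mod q')"
  proof -
    have "[w + 0 = w + (A ^^ l) 0] (mod q)" using pow_zero by (simp only: cong_add_lcancel cong_sym)
    also have "[w + (A ^^ l) 0 = h 0] (mod q)" by (rule cong_sym[OF wl])
    finally have "[w = h 0] (mod q)" by simp
    then have "[w = h 0] (mod q')" by (rule cong_q)
    also note IH[of 0]
    finally show ?thesis by simp
  qed
  have "[(A ^^ l) z = z] (mod q')" for z
  proof -
    have "[w + (A ^^ l) z = h z] (mod q')" by (rule cong_q[OF cong_sym[OF wl]])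
    also note IH
    also have "[z + int p ^ m * u = z + w] (mod q')" using w by (simp only: cong_add_lcancel cong_sym)
    also have "z + w = w + z" by simp
    finally show ?thesis by (simp only: cong_add_lcancel)
  qed
  then obtain b where b: "\<And>z. [(A ^^ l) z = z + b * z * q'] (mod q)"
    using trivial_below_linear[of l] by auto
  have h: "[h z = w + z + b * z * q'] (mod q)" for z
    using cong_trans[OF wl cong_add[OF cong_refl b]] by (simp add: add.assoc)
  \<comment> \<open>Here \<open>q'\<close> is divisible by \<open>p\<close>, the exponent being
    positive, so \<open>q' * q'\<close> vanishes modulo \<open>q\<close>. At exponent 0 this would
    fail, whence the separate base case.\<close>
  have q'q': "[x * q' * q' = 0] (mod q)" for x by (simp add: cong_0_iff)
  have iter: "[(h ^^ i) z = z + int i * w + b * (int i * z + w * (\<Sum>k<i. int k)) * q'] (mod q)" for i z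
  proof (induction i)
    case (Suc i)
    define t where "t = z + int i * w"
    define c where "c = b * (int i * z + w * (\<Sum>k<i. int k))"
    have I: "[(h ^^ i) z = t + c * q'] (mod q)" using Suc by (simp add: t_def c_def)
    have "[(h ^^ Suc i) z = w + (h ^^ i) z + b * (h ^^ i) z * q'] (mod q)" using h by simp
    also have "[w + (h ^^ i) z + b * (h ^^ i) z * q' = w + (t + c * q') + b * (t + c * q') * q'] (mod q)"
      by (intro cong_add cong_mult cong_refl I)
    also have "w + (t + c * q') + b * (t + c * q') * q' = (w + t + (c + b * t) * q') + b * c * q' * q'"
      by (simp only: algebra_simps)
    also have "[(w + t + (c + b * t) * q') + b * c * q' * q' = (w + t + (c + b * t) * q') + 0] (mod q)"
      by (intro cong_add cong_refl q'q')
    also have "(w + t + (c + b * t) * q') + 0 =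
        z + int (Suc i) * w + b * (int (Suc i) * z + w * (\<Sum>k<Suc i. int k)) * q'"
      by (simp add: t_def c_def algebra_simps)
    finally show ?case .
  qed simp
  have "h ^^ p = g ^^ (p ^ Suc m)" by (simp add: h_def funpow_mult mult.commute)
  then have "[(g ^^ (p ^ Suc m)) z = z + int p * w + b * (int p * z + w * (\<Sum>k<p. int k)) * q'] (mod q)"
    using iter[of p z] by simp
  also have "[z + int p * w + b * (int p * z + w * (\<Sum>k<p. int k)) * q' = z + int p ^ Suc m * u + 0] (mod q)"
  proof (intro cong_add cong_refl)
    \<comment> \<open>The constant \<open>w\<close> is known only modulo \<open>q'\<close>, but
      \<open>p * w\<close> is then known modulo \<open>q\<close>.\<close>
    have "int p * q' dvd int p * (w - int p ^ m * u)"
      using w by (intro mult_dvd_mono) (auto simp: cong_iff_dvd_diff)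
    then show "[int p * w = int p ^ Suc m * u] (mod q)"
      by (simp add: cong_iff_dvd_diff algebra_simps)
    \<comment> \<open>Oddness enters here: the sum of \<open>k\<close> below \<open>p\<close> is
      \<open>p * (p - 1) / 2\<close>, a multiple of \<open>p\<close>.\<close>
    have "int p dvd b * (int p * z + w * (\<Sum>k<p. int k))"
      using sum_lessThan_id_dvd[OF odd] by simp
    then have "int p * q' dvd b * (int p * z + w * (\<Sum>k<p. int k)) * q'" by (rule mult_dvd_mono[OF _ dvd_refl])
    then show "[b * (int p * z + w * (\<Sum>k<p. int k)) * q' = 0] (mod q)" by (simp add: cong_0_iff)
  qed
  finally show ?case by (simp add: g_def[abs_def])
qed

section \<open>Arc-regular permutation groups of the residues\<close>


lemma card_units_mod_prime_power:
  fixes p :: nat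
  assumes p: "Factorial_Ring.prime p"
  shows "card {z \<in> {0..<int p ^ Suc e}. \<not> int p dvd z} = p ^ e * (p - 1)"
proof -
  define Q where "Q = p ^ Suc e"
  have Q: "Q > 1" unfolding Q_def using prime_gt_1_nat[OF p] by (intro one_less_power) auto
  have unit: "\<not> int p dvd int k \<longleftrightarrow> coprime k Q" for k
    using int_prime_not_dvd_iff_coprime_power[OF p, of "int k" e]
    unfolding Q_def by (simp only: of_nat_power[symmetric] coprime_int_iff)
  have "{z \<in> {0..<int Q}. \<not> int p dvd z} = int ` totatives Q"
  proof
    show "{z \<in> {0..<int Q}. \<not> int p dvd z} \<subseteq> int ` totatives Q"
    proof
      fix z assume z: "z \<in> {z \<in> {0..<int Q}. \<not> int p dvd z}"
      then obtain k where k: "z = int k" by (auto elim: nonneg_int_cases)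
      then have "coprime k Q" "k < Q" using z unit by auto
      moreover have "k \<noteq> 0" using \<open>coprime k Q\<close> Q by (auto intro: Nat.gr0I)
      ultimately show "z \<in> int ` totatives Q" using k by (simp add: totatives_def)
    qed
    show "int ` totatives Q \<subseteq> {z \<in> {0..<int Q}. \<not> int p dvd z}"
    proof
      fix z assume "z \<in> int ` totatives Q"
      then obtain k where k: "z = int k" "coprime k Q" "k \<le> Q" by (auto simp: totatives_def)
      then have "k \<noteq> Q" using Q by auto
      then show "z \<in> {z \<in> {0..<int Q}. \<not> int p dvd z}" using k unit by simp
    qed
  qed
  then have "card {z \<in> {0..<int Q}. \<not> int p dvd z} = totient Q"
    by (simp add: card_image totient_def)
  then show ?thesis
    using totient_prime_power_Suc[OF p, of e] by (simp only: Q_def of_nat_power)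
qed

text \<open>The parts of the complete multipartite graph on the residues modulo \<open>n\<close> are the classes
  modulo \<open>p\<close>.\<close>

locale arc_group =
  fixes p e :: nat and n :: int and H :: "(int \<Rightarrow> int) set" and a :: "int \<Rightarrow> int"
  assumes prime_p: "Factorial_Ring.prime p" and p_ge: "p \<ge> 3" and n_eq: "n = int p ^ Suc e"
    and cong_n: "g \<in> H \<Longrightarrow> [g x = g y] (mod n) \<longleftrightarrow> [x = y] (mod n)"
    and cong_p: "g \<in> H \<Longrightarrow> [g x = g y] (mod int p) \<longleftrightarrow> [x = y] (mod int p)"
    and comp: "g \<in> H \<Longrightarrow> h \<in> H \<Longrightarrow> g \<circ> h \<in> H"
    and translation: "(\<lambda>x. x + c) \<in> H"
    and arc_transitive: "\<not> int p dvd y - x \<Longrightarrow> \<not> int p dvd y' - x' \<Longrightarrow>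
      \<exists>g\<in>H. [g x = x'] (mod n) \<and> [g y = y'] (mod n)"
    and arc_fix: "g \<in> H \<Longrightarrow> [g x = x] (mod n) \<Longrightarrow> [g y = y] (mod n) \<Longrightarrow> \<not> int p dvd y - x \<Longrightarrow>
      [g z = z] (mod n)"
    and a_in: "a \<in> H" and a_zero: "[a 0 = 0] (mod n)"
    and stabilizer: "g \<in> H \<Longrightarrow> [g 0 = 0] (mod n) \<Longrightarrow> \<exists>i. \<forall>z. [g z = (a ^^ i) z] (mod n)"
begin

lemma p_dvd_n: "int p dvd n"
  by (simp add: n_eq)

lemma n_gt_1: "n > 1"
  unfolding n_eq using p_ge by (intro one_less_power) auto

lemma mod_p: "[x = y] (mod n) \<Longrightarrow> [x = y] (mod int p)"
  using p_dvd_n by (rule cong_dvd_modulus[rotated])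

lemma odd_p: "odd p"
  using prime_p p_ge by (intro prime_odd_nat) auto

lemma not_p_dvd_1: "\<not> int p dvd 1"
  using p_ge by auto

section \<open>Group elements as a translation after a power of \<open>a\<close>\<close>

lemma pow_in: "g \<in> H \<Longrightarrow> g ^^ i \<in> H"
proof (induction i)
  case 0
  have "(\<lambda>x. x + 0) \<in> H" by (rule translation)
  then show ?case by (simp add: id_def)
qed (simp add: comp)

lemmas a_pow_in = pow_in[OF a_in]

lemma a_pow_zero: "[(a ^^ i) 0 = 0] (mod n)"
proof (induction i)
  case (Suc i)
  then have "[a ((a ^^ i) 0) = a 0] (mod n)" by (simp only: cong_n[OF a_in])
  then show ?case using cong_trans[OF _ a_zero] by simp
qed simp

lemma affine_form:
  assumes "g \<in> H" obtains i where "\<And>z. [g z = g 0 + (a ^^ i) z] (mod n)"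
proof -
  have "(\<lambda>x. x + - g 0) \<circ> g \<in> H" using assms by (intro comp translation)
  from stabilizer[OF this] obtain i where i: "\<And>z. [g z - g 0 = (a ^^ i) z] (mod n)" by auto
  have "[g z = g 0 + (a ^^ i) z] (mod n)" for z
    using cong_add[OF cong_refl i, of "g 0"] by simp
  then show ?thesis by (rule that)
qed

lemma skew_form:
  assumes "g \<in> H" obtains i where "\<And>z. [g (y + z) = g y + (a ^^ i) z] (mod n)"
proof -
  have "g \<circ> (\<lambda>x. x + y) \<in> H" using assms by (intro comp translation)
  from affine_form[OF this]
  obtain i where "\<And>z. [(g \<circ> (\<lambda>x. x + y)) z = (g \<circ> (\<lambda>x. x + y)) 0 + (a ^^ i) z] (mod n)"
    by blast
  then have "\<And>z. [g (y + z) = g y + (a ^^ i) z] (mod n)" by (simp add: add.commute)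
  then show ?thesis by (rule that)
qed

lemma a_transitive:
  assumes "\<not> int p dvd y" "\<not> int p dvd y'"
  obtains i where "[(a ^^ i) y = y'] (mod n)"
proof -
  obtain g where g: "g \<in> H" "[g 0 = 0] (mod n)" "[g y = y'] (mod n)"
    using arc_transitive[of y 0 y' 0] assms by auto
  obtain i where "[g y = (a ^^ i) y] (mod n)" using stabilizer[OF g(1,2)] by blast
  then have "[(a ^^ i) y = y'] (mod n)" using g(3) by (metis cong_sym cong_trans)
  then show ?thesis by (rule that)
qed

lemma a_dvd_p: "int p dvd a z \<longleftrightarrow> int p dvd z"
proof -
  have "int p dvd a z \<longleftrightarrow> [a z = a 0] (mod int p)"
    using mod_p[OF a_zero] by (metis cong_0_iff cong_sym cong_trans)
  also have "\<dots> \<longleftrightarrow> int p dvd z" using cong_p[OF a_in] by (simp add: cong_0_iff)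
  finally show ?thesis .
qed

lemma a_pow_dvd_p: "int p dvd (a ^^ i) z \<longleftrightarrow> int p dvd z"
  by (induction i) (simp_all add: a_dvd_p)

text \<open>The stabiliser of \<open>0\<close> is transitive on the residues prime to
  \<open>p\<close>, so these form a single cycle of \<open>a\<close> and its length is their number.
  The modulus is kept general because both \<open>n\<close> and \<open>p\<close> are needed.\<close>

lemma a_period:
  assumes q: "q > 0" "int p dvd q" "q dvd n" and cong_q: "\<And>x y. [a x = a y] (mod q) \<longleftrightarrow> [x = y] (mod q)"
    and y: "\<not> int p dvd y"
  shows "[(a ^^ i) y = y] (mod q) \<longleftrightarrow> card {z \<in> {0..<q}. \<not> int p dvd z} dvd i"
proof -
  define F where "F z = a z mod q" for z
  define S where "S = {z \<in> {0..<q}. \<not> int p dvd z}"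
  have dvd_mod: "int p dvd z mod q \<longleftrightarrow> int p dvd z" for z using q(2) by (rule dvd_mod_iff)
  have F_pow: "(F ^^ i) (y mod q) = (a ^^ i) y mod q" for i
  proof (induction i)
    case (Suc i)
    have "[a ((a ^^ i) y mod q) = a ((a ^^ i) y)] (mod q)" by (simp add: cong_q)
    then show ?case using Suc by (simp add: F_def cong_def)
  qed simp
  have "inj_on F S"
  proof
    fix u v assume "u \<in> S" "v \<in> S" "F u = F v"
    then have "[u = v] (mod q)" using cong_q by (simp add: F_def cong_def)
    then show "u = v" using \<open>u \<in> S\<close> \<open>v \<in> S\<close> by (simp add: S_def cong_def)
  qed
  moreover have "S = range (\<lambda>i. (F ^^ i) (y mod q))"
  proof
    show "S \<subseteq> range (\<lambda>i. (F ^^ i) (y mod q))"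
    proof
      fix z assume z: "z \<in> S"
      then have "\<not> int p dvd z" by (simp add: S_def)
      then obtain i where "[(a ^^ i) y = z] (mod n)" using a_transitive[OF y] by blast
      then have "[(a ^^ i) y = z] (mod q)" using q(3) by (rule cong_dvd_modulus)
      then have "z = (F ^^ i) (y mod q)" using z by (simp add: F_pow S_def cong_def)
      then show "z \<in> range (\<lambda>i. (F ^^ i) (y mod q))" by (rule range_eqI)
    qed
    show "range (\<lambda>i. (F ^^ i) (y mod q)) \<subseteq> S"
      using q(1) y by (auto simp: F_pow S_def dvd_mod a_pow_dvd_p)
  qed
  moreover have "finite S" unfolding S_def by (rule finite_Collect_conjI) simp
  ultimately have "(F ^^ i) (y mod q) = y mod q \<longleftrightarrow> card S dvd i"
    by (intro funpow_eq_self_iff_card_orbit_dvd)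
  then show ?thesis by (simp add: F_pow S_def cong_def)
qed

definition N :: nat where "N = p ^ e * (p - 1)"

lemma a_period_n: "\<not> int p dvd y \<Longrightarrow> [(a ^^ i) y = y] (mod n) \<longleftrightarrow> N dvd i"
  using a_period[of n y i] n_gt_1 p_dvd_n cong_n[OF a_in] card_units_mod_prime_power[OF prime_p, of e]
  by (simp add: N_def n_eq)

lemma a_period_p: "\<not> int p dvd y \<Longrightarrow> [(a ^^ i) y = y] (mod int p) \<longleftrightarrow> p - 1 dvd i"
  using a_period[of "int p" y i] p_ge p_dvd_n cong_p[OF a_in] card_units_mod_prime_power[OF prime_p, of 0]
  by simp

text \<open>The power fixes the arc from \<open>0\<close> to \<open>1\<close>, and an element fixing
  an arc is trivial.\<close>

lemma a_pow_N: "[(a ^^ N) z = z] (mod n)"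
  by (rule arc_fix[OF a_pow_in a_pow_zero, of N 1]) (use a_period_n[of 1 N] not_p_dvd_1 in simp_all)

lemma a_pow_trivial_p: "p - 1 dvd i \<Longrightarrow> [(a ^^ i) z = z] (mod int p)"
proof (cases "int p dvd z")
  case True
  then show ?thesis using a_pow_dvd_p[of i z] by (metis cong_0_iff cong_sym cong_trans)
qed (simp add: a_period_p)

lemma trivial_p_iff: "(\<forall>z. [(a ^^ i) z = z] (mod int p)) \<longleftrightarrow> p - 1 dvd i"
  using a_pow_trivial_p a_period_p[OF not_p_dvd_1] by blast

text \<open>The powers of \<open>a\<close> that are trivial modulo \<open>p\<close> are exactly the
  powers of \<open>a ^^ (p - 1)\<close>. The exponent in its skew rule again gives such a power, and
  \<open>p ^ e\<close> is a multiple of its order.\<close>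

lemma skew_morphism_A: "skew_morphism p n (a ^^ (p - 1))"
proof
  define A where "A = a ^^ (p - 1)"
  have A_in: "A \<in> H" by (simp add: A_def a_pow_in)
  have A_p: "[A z = z] (mod int p)" for z unfolding A_def by (rule a_pow_trivial_p) simp
  show "Factorial_Ring.prime p" by (rule prime_p)
  show "n > 0" using n_gt_1 by simp
  show "[(a ^^ (p - 1)) 0 = 0] (mod n)" by (rule a_pow_zero)
  show "[(a ^^ (p - 1)) x = (a ^^ (p - 1)) y] (mod n) \<longleftrightarrow> [x = y] (mod n)" for x y
    by (rule cong_n[OF a_pow_in])
  show "\<exists>l. \<forall>z. [(a ^^ (p - 1)) (y + z) = (a ^^ (p - 1)) y + ((a ^^ (p - 1)) ^^ l) z] (mod n)" for y
  proof -
    obtain i where i: "\<And>z. [A (y + z) = A y + (a ^^ i) z] (mod n)" using skew_form[OF A_in] by blast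
    have "[(a ^^ i) z = z] (mod int p)" for z
    proof -
      have "[A y + z = y + z] (mod int p)" by (intro cong_add A_p cong_refl)
      also have "[y + z = A (y + z)] (mod int p)" by (rule cong_sym[OF A_p])
      also have "[A (y + z) = A y + (a ^^ i) z] (mod int p)" by (rule mod_p[OF i])
      finally show ?thesis by (simp only: cong_add_lcancel cong_sym)
    qed
    then obtain l where "i = (p - 1) * l" using trivial_p_iff[of i] by auto
    then show ?thesis using i by (auto simp: A_def funpow_mult mult.commute)
  qed
  show "\<exists>k. \<forall>z. [((a ^^ (p - 1)) ^^ (p ^ k)) z = z] (mod n)"
    using a_pow_N by (intro exI[of _ e]) (simp add: funpow_mult N_def mult.commute)
qed

text \<open>Recentred at \<open>x\<close>, the element acts modulo \<open>p\<close> as a power of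
  \<open>a\<close>; fixing a unit makes that power trivial modulo \<open>p\<close>.\<close>

lemma two_classes_fixed:
  assumes g: "g \<in> H" and fixed: "[g x = x] (mod int p)" "[g y = y] (mod int p)" "\<not> [x = y] (mod int p)"
  shows "[g z = z] (mod int p)"
proof -
  obtain i where i: "\<And>z. [g (x + z) = g x + (a ^^ i) z] (mod n)" using skew_form[OF g] by blast
  have gi: "[g (x + z) = x + (a ^^ i) z] (mod int p)" for z
    using cong_trans[OF mod_p[OF i] cong_add[OF fixed(1) cong_refl]] .
  have "[x + (y - x) = x + (a ^^ i) (y - x)] (mod int p)"
    using gi[of "y - x"] fixed(2) by (metis add_diff_cancel_left' add_diff_eq cong_sym cong_trans)
  then have "[(a ^^ i) (y - x) = y - x] (mod int p)" by (simp only: cong_add_lcancel cong_sym)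
  moreover have "\<not> int p dvd y - x" using fixed(3) by (metis cong_iff_dvd_diff cong_sym)
  ultimately have "p - 1 dvd i" by (simp add: a_period_p)
  then have "[x + (a ^^ i) (z - x) = x + (z - x)] (mod int p)" by (intro cong_add cong_refl a_pow_trivial_p)
  then show ?thesis using cong_trans[OF gi[of "z - x"]] by simp
qed

text \<open>If \<open>p - 1\<close> does not divide \<open>i\<close>, the map
  \<open>z - (a ^^ i) z\<close> is injective on the classes modulo \<open>p\<close>, hence onto. A
  preimage of \<open>g 0\<close> is then a fixed class of \<open>g\<close>.\<close>

lemma fixpoint_free_form:
  assumes g: "g \<in> H" and free: "\<And>z. \<not> [g z = z] (mod int p)"
  obtains k where "\<And>z. [g z = g 0 + ((a ^^ (p - 1)) ^^ k) z] (mod n)"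
proof -
  obtain i where i: "\<And>z. [g z = g 0 + (a ^^ i) z] (mod n)" using affine_form[OF g] by blast
  have "p - 1 dvd i"
  proof (rule ccontr)
    assume ndvd: "\<not> p - 1 dvd i"
    define F where "F z = (z - (a ^^ i) z) mod int p" for z
    have "inj_on F {0..<int p}"
    proof
      fix u v assume uv: "u \<in> {0..<int p}" "v \<in> {0..<int p}" "F u = F v"
      show "u = v"
      proof (rule ccontr)
        assume "u \<noteq> v"
        then have d: "\<not> int p dvd v - u"
          using uv by (metis atLeastLessThan_iff mod_eq_dvd_iff mod_pos_pos_trivial)
        obtain k where k: "\<And>z. [(a ^^ i) (u + z) = (a ^^ i) u + (a ^^ k) z] (mod n)"
          using skew_form[OF a_pow_in] by blast
        have "[(a ^^ i) v = (a ^^ i) u + (a ^^ k) (v - u)] (mod int p)" using mod_p[OF k[of "v - u"]] by simp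
        moreover have "[u - (a ^^ i) u = v - (a ^^ i) v] (mod int p)" using uv by (simp add: F_def cong_def)
        ultimately have "int p dvd (a ^^ i) v - ((a ^^ i) u + (a ^^ k) (v - u))"
          "int p dvd (u - (a ^^ i) u) - (v - (a ^^ i) v)" by (simp_all add: cong_iff_dvd_diff)
        then have "int p dvd ((u - (a ^^ i) u) - (v - (a ^^ i) v)) - ((a ^^ i) v - ((a ^^ i) u + (a ^^ k) (v - u)))"
          using dvd_diff by blast
        \<comment> \<open>A collision at \<open>u\<close> and \<open>v\<close> makes
          \<open>a ^^ k\<close> fix a unit modulo \<open>p\<close>. Then \<open>a ^^ i\<close> is a
          translation modulo \<open>p\<close>, and as it fixes \<open>0\<close> it is
          trivial.\<close>
        then have "[(a ^^ k) (v - u) = v - u] (mod int p)" by (simp add: cong_iff_dvd_diff algebra_simps)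
        then have "p - 1 dvd k" using d by (simp add: a_period_p)
        have ak: "[(a ^^ i) (u + z) = (a ^^ i) u + z] (mod int p)" for z
          using cong_trans[OF mod_p[OF k] cong_add[OF cong_refl a_pow_trivial_p[OF \<open>p - 1 dvd k\<close>]]] .
        have "[(a ^^ i) z = z] (mod int p)" for z
        proof -
          have "[(a ^^ i) u + (- u) = (a ^^ i) (u + (- u))] (mod int p)" by (rule cong_sym[OF ak])
          also have "[(a ^^ i) (u + (- u)) = 0] (mod int p)" using mod_p[OF a_pow_zero] by simp
          finally have u: "[(a ^^ i) u = u] (mod int p)" by (simp add: cong_iff_dvd_diff)
          have "[(a ^^ i) (u + (z - u)) = (a ^^ i) u + (z - u)] (mod int p)" by (rule ak)
          also have "[(a ^^ i) u + (z - u) = u + (z - u)] (mod int p)" by (intro cong_add u cong_refl)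
          finally show ?thesis by simp
        qed
        then show False using ndvd trivial_p_iff by blast
      qed
    qed
    then have "F ` {0..<int p} = {0..<int p}"
      using p_ge by (intro endo_inj_surj) (auto simp: F_def)
    moreover have "g 0 mod int p \<in> {0..<int p}" using p_ge by simp
    ultimately obtain z where "F z = g 0 mod int p" by (metis imageE)
    then have "[z - (a ^^ i) z = g 0] (mod int p)" by (simp add: F_def cong_def)
    then have "[(z - (a ^^ i) z) + (a ^^ i) z = g 0 + (a ^^ i) z] (mod int p)" by (intro cong_add cong_refl)
    then have "[g z = z] (mod int p)" using cong_trans[OF mod_p[OF i[of z]]] by (simp add: cong_sym)
    then show False using free by blast
  qed
  then obtain k where "i = (p - 1) * k" by blast
  then have "\<And>z. [g z = g 0 + ((a ^^ (p - 1)) ^^ k) z] (mod n)" using i by (simp add: funpow_mult mult.commute)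
  then show ?thesis by (rule that)
qed

text \<open>If \<open>b\<close> reverses the arc \<open>(0, 1)\<close> and \<open>z\<close> is the involution fixing \<open>0\<close>, then \<open>c = b z\<close> is inverted
  by \<open>z\<close> and permutes all residues in a single cycle.\<close>

lemma inverted_cycle:
  obtains c z where "c \<in> H" "z \<in> H" "[z 0 = 0] (mod n)"
    "\<And>x. [z (c (z (c x))) = x] (mod n)" "\<And>x. [z (z x) = x] (mod n)"
    "\<And>x. [(c ^^ (p ^ e)) x = x + int p ^ e] (mod n)"
proof -
  define z where "z = a ^^ (N div 2)"
  have z_in: "z \<in> H" by (simp add: z_def a_pow_in)
  have "even N" using odd_p by (simp add: N_def)
  then have "N div 2 + N div 2 = N" by presburger
  then have zz: "[z (z x) = x] (mod n)" for x
    using a_pow_N[of x] by (simp add: z_def flip: comp_apply[of "a ^^ _"] funpow_add)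
  \<comment> \<open>As \<open>p ^ e\<close> is odd, \<open>p - 1\<close> does not divide
    \<open>N div 2\<close>; so the involution \<open>z\<close> moves every nonzero class modulo
    \<open>p\<close>.\<close>
  have z_p: "int p dvd v" if "[z v = v] (mod int p)" for v
  proof (rule ccontr)
    assume "\<not> int p dvd v"
    then have "p - 1 dvd N div 2" using that by (simp add: z_def a_period_p)
    then obtain k where "N div 2 = (p - 1) * k" by blast
    then have "p ^ e * (p - 1) = (2 * k) * (p - 1)" using \<open>even N\<close> by (simp add: N_def mult_ac dvd_div_eq_mult)
    then have "p ^ e = 2 * k" using p_ge by simp
    then show False using odd_p by (metis dvd_triv_left even_power)
  qed
  obtain b where b: "b \<in> H" "[b 0 = 1] (mod n)" "[b 1 = 0] (mod n)"
    using arc_transitive[of 1 0 0 1] not_p_dvd_1 by auto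
  have "[b (b 0) = 0] (mod n)" using b cong_n[OF b(1)] by (metis cong_trans)
  moreover have "[b (b 1) = 1] (mod n)" using b cong_n[OF b(1)] by (metis cong_trans)
  ultimately have bb: "[b (b x) = x] (mod n)" for x
    using arc_fix[OF comp[OF b(1) b(1)], of 0 1 x] not_p_dvd_1 by simp
  define c where "c = b \<circ> z"
  have c_in: "c \<in> H" using b z_in by (simp add: c_def comp)
  have zczc: "[z (c (z (c x))) = x] (mod n)" for x
  proof -
    have "[z (b (z (z (b (z x))))) = z (b (b (z x)))] (mod n)"
      using zz by (simp only: cong_n[OF z_in] cong_n[OF b(1)])
    also have "[z (b (b (z x))) = z (z x)] (mod n)" using bb by (simp only: cong_n[OF z_in])
    also note zz
    finally show ?thesis by (simp add: c_def)
  qed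
  have z0: "[z 0 = 0] (mod n)" by (simp add: z_def a_pow_zero)
  have c0: "[c 0 = 1] (mod n)"
  proof -
    have "[b (z 0) = b 0] (mod n)" using z0 by (simp only: cong_n[OF b(1)])
    also note b(2)
    finally show ?thesis by (simp add: c_def)
  qed
  \<comment> \<open>The relation \<open>z c z c = 1\<close> turns a fixed class \<open>v\<close>
    into a second one, \<open>z v\<close>. These differ unless \<open>v\<close> is the zero class,
    and \<open>c 0 = 1\<close> excludes that case.\<close>
  have free: "\<not> [c v = v] (mod int p)" for v
  proof
    assume v: "[c v = v] (mod int p)"
    have "[z (c (z v)) = z (c (z (c v)))] (mod int p)"
      using v by (simp only: cong_p[OF z_in] cong_p[OF c_in] cong_sym)
    also have "[z (c (z (c v))) = v] (mod int p)" by (rule mod_p[OF zczc])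
    finally have "[z (z (c (z v))) = z v] (mod int p)" by (simp only: cong_p[OF z_in])
    then have czv: "[c (z v) = z v] (mod int p)" using mod_p[OF zz] by (metis cong_sym cong_trans)
    have c0p: "\<not> [c 0 = 0] (mod int p)"
    proof
      assume "[c 0 = 0] (mod int p)"
      then have "[1 = 0] (mod int p)" using mod_p[OF c0] by (metis cong_sym cong_trans)
      then show False using not_p_dvd_1 by (simp add: cong_0_iff)
    qed
    have "[v = z v] (mod int p)" using two_classes_fixed[OF c_in v czv] c0p by blast
    then have "[v = 0] (mod int p)" using z_p by (simp add: cong_0_iff cong_sym)
    then have "[c 0 = c v] (mod int p)" by (simp only: cong_p[OF c_in] cong_sym)
    also note v
    also note \<open>[v = 0] (mod int p)\<close>
    finally show False using c0p by blast
  qed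
  obtain k where k: "\<And>z. [c z = c 0 + ((a ^^ (p - 1)) ^^ k) z] (mod n)"
    using fixpoint_free_form[OF c_in free] by blast
  have "[(c ^^ (p ^ e)) x = x + int p ^ e] (mod n)" for x
  proof -
    interpret A: skew_morphism p n "a ^^ (p - 1)" by (rule skew_morphism_A)
    define g where "g x = c 0 + ((a ^^ (p - 1)) ^^ k) x" for x
    have "[(c ^^ (p ^ e)) x = (g ^^ (p ^ e)) x] (mod n)"
      by (rule funpow_cong_mod) (simp_all only: g_def k A.pow_cong_iff cong_add_lcancel)
    also have "[(g ^^ (p ^ e)) x = x + int p ^ e * c 0] (mod n)"
      unfolding g_def[abs_def] n_eq
      by (rule skew_affine_funpow[OF skew_morphism_A[unfolded n_eq] odd_p a_pow_trivial_p]) simp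
    also have "[x + int p ^ e * c 0 = x + int p ^ e * 1] (mod n)" by (intro cong_add cong_mult cong_refl c0)
    finally show ?thesis by simp
  qed
  then show ?thesis using that[OF c_in z_in z0 zczc zz] by blast
qed

text \<open>The negation commutes with \<open>a\<close>, so the skew rule \<open>a (1 + z) = a 1 + a\<^sup>k z\<close> gives
  \<open>a\<^sup>k (1 + z) = a 1 + a z\<close>, hence \<open>a (2 + z) = 2 a 1 + a z\<close>; and \<open>n\<close> is odd.\<close>

lemma a_linear:
  assumes neg: "uminus \<in> H" shows "[a y = a 1 * y] (mod n)"
proof -
  \<comment> \<open>Negation fixes \<open>0\<close>, so it is itself a power of \<open>a\<close> and
    commutes with all powers of \<open>a\<close>.\<close>
  obtain i where i: "\<And>z. [- z = (a ^^ i) z] (mod n)" using stabilizer[OF neg] by auto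
  have a_pow_neg: "[(a ^^ k) (- y) = - (a ^^ k) y] (mod n)" for y k
  proof -
    have "[(a ^^ k) (- y) = (a ^^ k) ((a ^^ i) y)] (mod n)" using i by (simp only: cong_n[OF a_pow_in])
    also have "(a ^^ k) ((a ^^ i) y) = (a ^^ i) ((a ^^ k) y)"
      by (simp add: add.commute flip: comp_apply[of "a ^^ _"] funpow_add)
    also have "[(a ^^ i) ((a ^^ k) y) = - (a ^^ k) y] (mod n)" by (rule cong_sym[OF i])
    finally show ?thesis .
  qed
  obtain k where k: "\<And>z. [a (1 + z) = a 1 + (a ^^ k) z] (mod n)" using skew_form[OF a_in] by blast
  have k1: "[(a ^^ k) (1 + z) = a 1 + a z] (mod n)" for z
  proof -
    have "[- a z = a (- z)] (mod n)" using cong_sym[OF a_pow_neg[of 1 z]] by simp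
    \<comment> \<open>Writing \<open>- z\<close> as \<open>1 + - (1 + z)\<close> brings the skew
      rule at 1 into play.\<close>
    also have "[a (- z) = a 1 + (a ^^ k) (- (1 + z))] (mod n)" using k[of "- (1 + z)"] by simp
    also have "[a 1 + (a ^^ k) (- (1 + z)) = a 1 + - (a ^^ k) (1 + z)] (mod n)"
      by (intro cong_add cong_refl a_pow_neg)
    finally have "n dvd - a z - (a 1 + - (a ^^ k) (1 + z))" by (simp only: cong_iff_dvd_diff)
    also have "- a z - (a 1 + - (a ^^ k) (1 + z)) = (a ^^ k) (1 + z) - (a 1 + a z)" by simp
    finally show ?thesis by (simp only: cong_iff_dvd_diff)
  qed
  have a2: "[a (2 + z) = 2 * a 1 + a z] (mod n)" for z
  proof -
    have "[a (1 + (1 + z)) = a 1 + (a ^^ k) (1 + z)] (mod n)" by (rule k)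
    also have "[a 1 + (a ^^ k) (1 + z) = a 1 + (a 1 + a z)] (mod n)" by (intro cong_add cong_refl k1)
    finally show ?thesis by (simp add: algebra_simps)
  qed
  have even: "[a (2 * int l) = 2 * a 1 * int l] (mod n)" for l
  proof (induction l)
    case (Suc l)
    have "[a (2 + 2 * int l) = 2 * a 1 + a (2 * int l)] (mod n)" by (rule a2)
    also have "[2 * a 1 + a (2 * int l) = 2 * a 1 + 2 * a 1 * int l] (mod n)" by (intro cong_add cong_refl Suc)
    finally show ?case by (simp add: algebra_simps)
  qed (simp add: a_zero)
  have "coprime 2 n" using odd_p by (simp add: n_eq)
  then obtain u where u: "[2 * u = 1] (mod n)" using cong_solve_coprime_int by blast
  define l where "l = nat (u * y mod n)"
  have "[2 * int l = 2 * (u * y)] (mod n)" using n_gt_1 by (intro cong_mult cong_refl) (simp add: l_def)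
  also have "2 * (u * y) = (2 * u) * y" by simp
  also have "[(2 * u) * y = 1 * y] (mod n)" by (intro cong_mult u cong_refl)
  finally have l: "[2 * int l = y] (mod n)" by simp
  then have "[a y = a (2 * int l)] (mod n)" by (simp only: cong_n[OF a_in] cong_sym)
  also note even
  also have "2 * a 1 * int l = a 1 * (2 * int l)" by simp
  also have "[a 1 * (2 * int l) = a 1 * y] (mod n)" by (intro cong_mult l cong_refl)
  finally show ?thesis .
qed

lemma a_pow_linear:
  assumes "uminus \<in> H" shows "[(a ^^ i) y = a 1 ^ i * y] (mod n)"
proof (induction i)
  case (Suc i)
  have "[(a ^^ Suc i) y = a 1 * (a ^^ i) y] (mod n)" using a_linear[OF assms] by simp
  also have "[a 1 * (a ^^ i) y = a 1 * (a 1 ^ i * y)] (mod n)" by (intro cong_mult cong_refl Suc)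
  finally show ?case by (simp add: mult.assoc)
qed simp

text \<open>For linear \<open>a\<close> the iterates of 1 are the powers of \<open>a 1\<close>; its
  multiplicative order is thus the cycle length \<open>N\<close> of \<open>a\<close> on the
  units.\<close>

lemma a_primroot:
  assumes "uminus \<in> H" shows "residue_primroot (p ^ Suc e) (nat (a 1 mod n))"
proof -
  define s where "s = nat (a 1 mod n)"
  have s: "[int s = a 1] (mod n)" using n_gt_1 by (simp add: s_def)
  have s_pow: "[s ^ i = 1] (mod p ^ Suc e) \<longleftrightarrow> N dvd i" for i
  proof -
    have "[s ^ i = 1] (mod p ^ Suc e) \<longleftrightarrow> [int (s ^ i) = int 1] (mod int (p ^ Suc e))"
      by (simp only: cong_int_iff)
    also have "\<dots> \<longleftrightarrow> [int s ^ i = 1] (mod n)" by (simp add: n_eq)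
    also have "\<dots> \<longleftrightarrow> [(a ^^ i) 1 = 1] (mod n)"
      using a_pow_linear[OF assms, of i 1] cong_pow[OF s, of i] by (simp, metis cong_sym cong_trans)
    also have "\<dots> \<longleftrightarrow> N dvd i" by (rule a_period_n[OF not_p_dvd_1])
    finally show ?thesis .
  qed
  have "N > 0" using p_ge by (simp add: N_def)
  have ord: "ord (p ^ Suc e) s = N"
    using s_pow ord_divides by (metis dvd_antisym dvd_refl)
  then have "coprime (p ^ Suc e) s" using \<open>N > 0\<close> ord_gt_0_iff by metis
  then show ?thesis
    using ord p_ge totient_prime_power_Suc[OF prime_p, of e] by (simp add: residue_primroot_def N_def s_def)
qed

end

section \<open>Automorphisms of an embedding\<close>


lemma prime_power_dvd_not_dvd_imp_eq:
  fixes p k :: nat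
  assumes "Factorial_Ring.prime p" "k dvd p ^ Suc e" "\<not> k dvd p ^ e" shows "k = p ^ Suc e"
proof -
  obtain i where i: "i \<le> Suc e" "k = p ^ i" using assms divides_primepow_nat by blast
  then have "\<not> i \<le> e" using assms(3) le_imp_power_dvd by blast
  then show ?thesis using i by (metis le_SucE)
qed

locale regular_Kmn =
  fixes p e :: nat and n :: int and D :: "'d set" and R L :: "'d \<Rightarrow> 'd"
  assumes prime_p: "Factorial_Ring.prime p" and p_ge: "p \<ge> 3" and n_eq: "n = int p ^ Suc e"
    and embedding: "orientably_regular_embedding_Kmn D R L p (p ^ e)"
begin

lemma n_gt_1: "n > 1"
  unfolding n_eq using p_ge by (intro one_less_power) auto

lemma finite_D: "finite D" and bij_R: "bij_betw R D D"
  and bij_L: "bij_betw L D D" and LL: "d \<in> D \<Longrightarrow> L (L d) = d"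
  using embedding by (auto simp: orientably_regular_embedding_Kmn_def orientable_map_def)

lemma R_in: "d \<in> D \<Longrightarrow> R d \<in> D" and L_in: "d \<in> D \<Longrightarrow> L d \<in> D"
  using bij_R bij_L by (auto dest: bij_betwE)

lemma R_pow_in: "d \<in> D \<Longrightarrow> (R ^^ i) d \<in> D"
  by (induction i) (auto simp: R_in)

text \<open>Values outside \<open>D\<close> are left free, unlike in \<open>map_aut\<close>, so that
  plain composition and iteration of functions stay inside the notion.\<close>

definition aut :: "('d \<Rightarrow> 'd) \<Rightarrow> bool" where
  "aut f \<longleftrightarrow> bij_betw f D D \<and> (\<forall>x\<in>D. f (R x) = R (f x) \<and> f (L x) = L (f x))"

lemma aut_iff_carrier: "aut f \<longleftrightarrow> restrict f D \<in> carrier (map_aut D R L)"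
proof -
  have "bij_betw (restrict f D) D D \<longleftrightarrow> bij_betw f D D" by (rule bij_betw_cong) simp
  then show ?thesis by (auto simp: aut_def map_aut_def Bij_def R_in L_in)
qed

lemma carrier_imp_aut: "f \<in> carrier (map_aut D R L) \<Longrightarrow> aut f"
  by (auto simp: aut_def map_aut_def Bij_def)

lemma aut_in: "aut f \<Longrightarrow> d \<in> D \<Longrightarrow> f d \<in> D"
  by (auto simp: aut_def dest: bij_betwE)

lemma aut_inj: "aut f \<Longrightarrow> inj_on f D"
  by (auto simp: aut_def bij_betw_def)

lemma aut_image: "aut f \<Longrightarrow> f ` D = D"
  by (auto simp: aut_def bij_betw_def)

lemma aut_comp: "aut f \<Longrightarrow> aut g \<Longrightarrow> aut (f \<circ> g)"
  using bij_betw_trans[of g D D f D] aut_in[of g] by (auto simp: aut_def)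

lemma aut_pow: "aut f \<Longrightarrow> aut (f ^^ i)"
proof (induction i)
  case 0
  show ?case by (auto simp: aut_def bij_betw_def)
qed (simp add: aut_comp)

lemma aut_unique:
  assumes "aut f" "aut g" "d \<in> D" "f d = g d" "x \<in> D" shows "f x = g x"
proof -
  have "g d \<in> D" using assms aut_in by blast
  then have "\<exists>!f. f \<in> carrier (map_aut D R L) \<and> f d = g d"
    using embedding assms(3) by (auto simp: orientably_regular_embedding_Kmn_def)
  moreover have "restrict f D d = g d" "restrict g D d = g d" using assms by auto
  ultimately have "restrict f D = restrict g D" using assms(1,2) unfolding aut_iff_carrier by metis
  then show ?thesis using assms(5) by (metis restrict_apply')
qed

lemma aut_exists:
  assumes "c \<in> D" "d \<in> D" obtains f where "aut f" "f c = d"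
proof -
  have "\<exists>f. f \<in> carrier (map_aut D R L) \<and> f c = d"
    using embedding assms unfolding orientably_regular_embedding_Kmn_def by blast
  then show ?thesis using that carrier_imp_aut by blast
qed

section \<open>Vertices, parts and the action of automorphisms\<close>

abbreviation vtx :: "'d \<Rightarrow> 'd set" where "vtx \<equiv> map_vertex R"
abbreviation tip :: "'d \<Rightarrow> 'd set" where "tip d \<equiv> vtx (L d)"
abbreviation V :: "'d set set" where "V \<equiv> vtx ` D"
abbreviation act :: "('d \<Rightarrow> 'd) \<Rightarrow> 'd set \<Rightarrow> 'd set" where "act f \<equiv> image f"

lemma in_vtx: "d \<in> vtx d"
proof -
  have "d = (R ^^ 0) d" by simp
  then show ?thesis unfolding map_vertex_def by blast
qed

lemma vtx_subset: "d \<in> D \<Longrightarrow> vtx d \<subseteq> D"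
  by (auto simp: map_vertex_def R_pow_in)

lemma vertex_subset: "w \<in> V \<Longrightarrow> w \<subseteq> D"
  using vtx_subset by blast

text \<open>A vertex collects forward iterates only; finiteness closes the cycle, so
  \<open>d\<close> is reached again from \<open>R d\<close>.\<close>

lemma vtx_R:
  assumes d: "d \<in> D" shows "vtx (R d) = vtx d"
proof
  show "vtx (R d) \<subseteq> vtx d"
  proof
    fix x assume "x \<in> vtx (R d)"
    then obtain i where "x = (R ^^ i) (R d)" by (auto simp: map_vertex_def)
    then have "x = (R ^^ Suc i) d" by (simp add: funpow_swap1)
    then show "x \<in> vtx d" unfolding map_vertex_def by blast
  qed
  define S where "S = range (\<lambda>i. (R ^^ i) d)"
  have SD: "S \<subseteq> D" using R_pow_in[OF d] by (auto simp: S_def)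
  then have S: "finite S" "inj_on R S"
    using finite_D bij_R by (auto intro: finite_subset inj_on_subset simp: bij_betw_def)
  have per: "(R ^^ card S) d = d" using funpow_eq_self_iff_card_orbit_dvd[OF S S_def] by simp
  have "card S \<noteq> 0" using S by (auto simp: S_def)
  then obtain m where m: "card S = Suc m" by (cases "card S") auto
  show "vtx d \<subseteq> vtx (R d)"
  proof
    fix x assume "x \<in> vtx d"
    then obtain i where "x = (R ^^ i) d" by (auto simp: map_vertex_def)
    also have "\<dots> = (R ^^ i) ((R ^^ card S) d)" by (simp add: per)
    also have "\<dots> = (R ^^ (i + m)) (R d)" by (simp add: m funpow_add funpow_swap1)
    finally show "x \<in> vtx (R d)" unfolding map_vertex_def by blast
  qed
qed

lemma aut_R_pow: "aut f \<Longrightarrow> d \<in> D \<Longrightarrow> f ((R ^^ i) d) = (R ^^ i) (f d)"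
  by (induction i) (auto simp: aut_def R_pow_in)

lemma act_vtx: "aut f \<Longrightarrow> d \<in> D \<Longrightarrow> act f (vtx d) = vtx (f d)"
proof -
  have "vtx d = range (\<lambda>i. (R ^^ i) d)" for d by (auto simp: map_vertex_def)
  then show "aut f \<Longrightarrow> d \<in> D \<Longrightarrow> act f (vtx d) = vtx (f d)" by (simp add: image_image aut_R_pow)
qed

lemma act_tip: "aut f \<Longrightarrow> d \<in> D \<Longrightarrow> act f (tip d) = tip (f d)"
  using act_vtx[OF _ L_in] by (simp add: aut_def)

lemma act_in: "aut f \<Longrightarrow> w \<in> V \<Longrightarrow> act f w \<in> V"
  by (auto simp: act_vtx aut_in)

lemma act_eq_iff: "aut f \<Longrightarrow> w \<in> V \<Longrightarrow> w' \<in> V \<Longrightarrow> act f w = act f w' \<longleftrightarrow> w = w'"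
  by (rule inj_on_image_eq_iff[OF aut_inj]) (use vertex_subset in blast)+

lemma act_pow: "(act f ^^ i) w = act (f ^^ i) w"
  by (induction i) (simp_all add: image_comp)

lemma finite_V: "finite V"
  using finite_D by simp

text \<open>Only the colouring by parts is kept from the isomorphism with the multipartite graph;
  names of vertices inside a part are dropped, since the vertices get relabelled along a
  cycle.\<close>

definition is_partition :: "('d set \<Rightarrow> nat) \<Rightarrow> bool" where
  "is_partition \<pi> \<longleftrightarrow> (\<forall>d\<in>D. \<pi> (vtx d) \<noteq> \<pi> (tip d)) \<and>
     (\<forall>u\<in>V. \<forall>v\<in>V. \<pi> u \<noteq> \<pi> v \<longrightarrow> (\<exists>!d. d \<in> D \<and> vtx d = u \<and> tip d = v)) \<and>
     (\<forall>u\<in>V. card {v \<in> V. \<pi> v = \<pi> u} = p ^ e)"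

lemma ex_partition: "card V = p ^ Suc e" "\<exists>\<pi>. is_partition \<pi>"
proof -
  have "underlying_graph_is_Kmn D R L p (p ^ e)"
    using embedding by (simp add: orientably_regular_embedding_Kmn_def)
  then obtain \<phi> where \<phi>: "bij_betw \<phi> V ({0..<p} \<times> {0..<p ^ e})"
    "\<forall>d\<in>D. fst (\<phi> (vtx d)) \<noteq> fst (\<phi> (tip d))"
    "\<forall>u\<in>{0..<p} \<times> {0..<p ^ e}. \<forall>v\<in>{0..<p} \<times> {0..<p ^ e}. fst u \<noteq> fst v \<longrightarrow>
       (\<exists>!d. d \<in> D \<and> \<phi> (vtx d) = u \<and> \<phi> (tip d) = v)"
    unfolding underlying_graph_is_Kmn_def by (elim exE conjE) (erule (2) that)
  have inj: "inj_on \<phi> V" and im: "\<phi> ` V = {0..<p} \<times> {0..<p ^ e}"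
    using \<phi>(1) by (auto simp: bij_betw_def)
  show "card V = p ^ Suc e" using bij_betw_same_card[OF \<phi>(1)] by (simp add: card_cartesian_product)
  show "\<exists>\<pi>. is_partition \<pi>"
    unfolding is_partition_def
  proof (intro exI[of _ "\<lambda>w. fst (\<phi> w)"] conjI ballI impI)
    show "fst (\<phi> (vtx d)) \<noteq> fst (\<phi> (tip d))" if "d \<in> D" for d using \<phi>(2) that by (rule bspec)
    show "\<exists>!d. d \<in> D \<and> vtx d = u \<and> tip d = v"
      if uv: "u \<in> V" "v \<in> V" "fst (\<phi> u) \<noteq> fst (\<phi> v)" for u v
    proof -
      have "\<phi> u \<in> {0..<p} \<times> {0..<p ^ e}" "\<phi> v \<in> {0..<p} \<times> {0..<p ^ e}" using im uv by blast+
      from \<phi>(3)[THEN bspec, OF this(1), THEN bspec, OF this(2), THEN mp, OF uv(3)] have "\<exists>!d. d \<in> D \<and> \<phi> (vtx d) = \<phi> u \<and> \<phi> (tip d) = \<phi> v" .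
      moreover have "\<phi> (vtx d) = \<phi> u \<longleftrightarrow> vtx d = u" "\<phi> (tip d) = \<phi> v \<longleftrightarrow> tip d = v" if "d \<in> D" for d
        using inj_on_eq_iff[OF inj] uv L_in that by blast+
      ultimately show ?thesis by (metis (no_types, lifting))
    qed
    show "card {v \<in> V. fst (\<phi> v) = fst (\<phi> u)} = p ^ e" if "u \<in> V" for u
    proof -
      have "\<phi> ` {v \<in> V. fst (\<phi> v) = fst (\<phi> u)} = {fst (\<phi> u)} \<times> {0..<p ^ e}"
      proof
        show "\<phi> ` {v \<in> V. fst (\<phi> v) = fst (\<phi> u)} \<subseteq> {fst (\<phi> u)} \<times> {0..<p ^ e}"
        proof
          fix q assume "q \<in> \<phi> ` {v \<in> V. fst (\<phi> v) = fst (\<phi> u)}"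
          then have "q \<in> {0..<p} \<times> {0..<p ^ e}" "fst q = fst (\<phi> u)" using im by blast+
          then show "q \<in> {fst (\<phi> u)} \<times> {0..<p ^ e}" by (cases q) auto
        qed
        show "{fst (\<phi> u)} \<times> {0..<p ^ e} \<subseteq> \<phi> ` {v \<in> V. fst (\<phi> v) = fst (\<phi> u)}"
        proof
          fix q assume q: "q \<in> {fst (\<phi> u)} \<times> {0..<p ^ e}"
          have "\<phi> u \<in> {0..<p} \<times> {0..<p ^ e}" using im that by blast
          then have "q \<in> {0..<p} \<times> {0..<p ^ e}" using q by auto
          then obtain v where "v \<in> V" "q = \<phi> v" using im by (metis imageE)
          then show "q \<in> \<phi> ` {v \<in> V. fst (\<phi> v) = fst (\<phi> u)}" using q by auto
        qed
      qed
      then have "card {v \<in> V. fst (\<phi> v) = fst (\<phi> u)} = card ({fst (\<phi> u)} \<times> {0..<p ^ e})"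
        using inj by (metis (no_types, lifting) card_image inj_on_subset mem_Collect_eq subsetI)
      then show ?thesis by (simp add: card_cartesian_product)
    qed
  qed
qed

definition part :: "'d set \<Rightarrow> nat" where "part = (SOME \<pi>. is_partition \<pi>)"

lemma is_partition_part: "is_partition part"
  unfolding part_def using ex_partition(2) by (rule someI_ex)

lemma part_neq: "d \<in> D \<Longrightarrow> part (vtx d) \<noteq> part (tip d)"
  using is_partition_part by (simp add: is_partition_def)

lemma card_part: "u \<in> V \<Longrightarrow> card {v \<in> V. part v = part u} = p ^ e"
  by (rule is_partition_part[unfolded is_partition_def, THEN conjunct2, THEN conjunct2, THEN bspec])

lemma ex1_dart: "u \<in> V \<Longrightarrow> v \<in> V \<Longrightarrow> part u \<noteq> part v \<Longrightarrow> \<exists>!d. d \<in> D \<and> vtx d = u \<and> tip d = v"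
  by (rule is_partition_part[unfolded is_partition_def, THEN conjunct2, THEN conjunct1,
        THEN bspec, THEN bspec, THEN mp])

lemma ex_dart:
  assumes "u \<in> V" "v \<in> V" "part u \<noteq> part v"
  obtains d where "d \<in> D" "vtx d = u" "tip d = v"
  using ex1_implies_ex[OF ex1_dart[OF assms]] by blast

lemma dart_unique:
  assumes "c \<in> D" "d \<in> D" "vtx c = vtx d" "tip c = tip d" shows "c = d"
proof -
  have "\<exists>!x. x \<in> D \<and> vtx x = vtx d \<and> tip x = tip d"
    using assms(2) L_in part_neq by (intro ex1_dart) auto
  then show ?thesis using assms by (elim ex1E) metis
qed

text \<open>Different parts means joined by a dart, which automorphisms preserve; surjectivity on
  the darts gives the other direction.\<close>

lemma act_part_iff:
  assumes f: "aut f" and uv: "u \<in> V" "v \<in> V"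
  shows "part (act f u) = part (act f v) \<longleftrightarrow> part u = part v"
proof
  assume eq: "part (act f u) = part (act f v)"
  show "part u = part v"
  proof (rule ccontr)
    assume "part u \<noteq> part v"
    then obtain d where d: "d \<in> D" "vtx d = u" "tip d = v" using ex_dart[OF uv] by blast
    then have "part (act f u) \<noteq> part (act f v)"
      using part_neq[OF aut_in[OF f d(1)]] act_vtx[OF f d(1)] act_tip[OF f d(1)] by simp
    then show False using eq by simp
  qed
next
  assume eq: "part u = part v"
  show "part (act f u) = part (act f v)"
  proof (rule ccontr)
    assume "part (act f u) \<noteq> part (act f v)"
    then obtain d' where d': "d' \<in> D" "vtx d' = act f u" "tip d' = act f v"
      using ex_dart[OF act_in[OF f uv(1)] act_in[OF f uv(2)]] by blast
    then obtain d where d: "d \<in> D" "d' = f d" using aut_image[OF f] by blast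
    have "act f (vtx d) = act f u" "act f (tip d) = act f v"
      using d d' act_vtx[OF f d(1)] act_tip[OF f d(1)] by simp_all
    then have "vtx d = u" "tip d = v" using act_eq_iff[OF f] d(1) L_in uv by (simp_all add: image_eqI)
    then show False using part_neq[OF d(1)] eq by simp
  qed
qed

section \<open>From the exponent of the Sylow subgroup to a moved vertex\<close>

lemma nat_pow_map_aut:
  assumes f: "f \<in> carrier (map_aut D R L)"
  shows "f [^]\<^bsub>map_aut D R L\<^esub> (k :: nat) = restrict (f ^^ k) D"
proof (induction k)
  case 0
  show ?case by (simp add: nat_pow_def map_aut_def BijGroup_def id_def)
next
  case (Suc k)
  have f': "aut f" using f by (rule carrier_imp_aut)
  have "f \<in> Bij D" using f by (simp add: map_aut_def)
  moreover have "restrict (f ^^ k) D \<in> Bij D"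
    using aut_pow[OF f', of k] unfolding aut_iff_carrier by (simp add: map_aut_def)
  ultimately have "restrict (f ^^ k) D \<otimes>\<^bsub>map_aut D R L\<^esub> f = compose D (restrict (f ^^ k) D) f"
    unfolding map_aut_def BijGroup_def by (simp only: monoid.simps partial_object.simps restrict_apply')
  moreover have "f [^]\<^bsub>map_aut D R L\<^esub> Suc k = f [^]\<^bsub>map_aut D R L\<^esub> k \<otimes>\<^bsub>map_aut D R L\<^esub> f"
    by (simp add: nat_pow_def)
  ultimately have "f [^]\<^bsub>map_aut D R L\<^esub> Suc k = compose D (restrict (f ^^ k) D) f"
    by (simp only: Suc)
  also have "\<dots> = restrict (f ^^ Suc k) D"
    using aut_in[OF f'] by (auto simp: compose_def fun_eq_iff funpow_swap1)
  finally show ?case .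
qed

lemma one_map_aut: "\<one>\<^bsub>map_aut D R L\<^esub> = restrict id D"
  by (simp add: map_aut_def BijGroup_def id_def)

text \<open>Exhibits one positive exponent killing all automorphisms, so that the
  \<open>LEAST\<close> in \<open>group_exponent\<close> is attained.\<close>

lemma aut_pow_fact:
  assumes f: "aut f" and d: "d \<in> D" shows "(f ^^ fact (card D)) d = d"
proof -
  define S where "S = range (\<lambda>i. (f ^^ i) d)"
  have SD: "S \<subseteq> D" using aut_in[OF aut_pow[OF f] d] by (auto simp: S_def)
  then have S: "finite S" "inj_on f S"
    using finite_D aut_inj[OF f] by (auto intro: finite_subset inj_on_subset)
  have "card S \<le> card D" using SD finite_D by (rule card_mono[rotated])
  moreover have "card S > 0" using S by (auto simp: S_def card_gt_0_iff)
  ultimately have "card S dvd fact (card D)" by (intro dvd_fact) auto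
  then show ?thesis using funpow_eq_self_iff_card_orbit_dvd[OF S S_def] by simp
qed

text \<open>By minimality of the exponent some \<open>t\<close> has a nontrivial
  \<open>p ^ e\<close>-th power. That power moves a dart, and since a dart is determined by its two
  ends it moves a vertex.\<close>

lemma exponent_element:
  assumes P: "sylow_p_subgroup (map_aut D R L) p P" and ex: "group_exponent (map_aut D R L) P = p ^ Suc e"
  obtains t w where "aut t" "w \<in> V" "(act t ^^ (p ^ e)) w \<noteq> w" "(act t ^^ (p ^ Suc e)) w = w"
proof -
  have PG: "P \<subseteq> carrier (map_aut D R L)" using P by (auto simp: sylow_p_subgroup_def subgroup_def)
  define Q where "Q k \<longleftrightarrow> 0 < k \<and> (\<forall>x\<in>P. x [^]\<^bsub>map_aut D R L\<^esub> k = \<one>\<^bsub>map_aut D R L\<^esub>)" for k :: nat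
  have least: "p ^ Suc e = (LEAST k. Q k)" using ex by (simp add: group_exponent_def Q_def)
  have "x [^]\<^bsub>map_aut D R L\<^esub> (fact (card D) :: nat) = \<one>\<^bsub>map_aut D R L\<^esub>" if "x \<in> P" for x
    using that PG aut_pow_fact[OF carrier_imp_aut]
    by (subst nat_pow_map_aut) (auto simp: one_map_aut fun_eq_iff)
  then have "Q (fact (card D))" by (simp add: Q_def)
  then have Q1: "Q (p ^ Suc e)" unfolding least by (rule LeastI)
  have "p ^ e < p ^ Suc e" using p_ge by simp
  then have "\<not> Q (p ^ e)" unfolding least by (rule not_less_Least)
  then obtain t where t: "t \<in> P" "t [^]\<^bsub>map_aut D R L\<^esub> (p ^ e) \<noteq> \<one>\<^bsub>map_aut D R L\<^esub>"
    using p_ge by (auto simp: Q_def)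
  have tc: "t \<in> carrier (map_aut D R L)" using t PG by blast
  have at: "aut t" using tc by (rule carrier_imp_aut)
  have "restrict (t ^^ (p ^ Suc e)) D = restrict id D"
    using Q1 t(1) nat_pow_map_aut[OF tc] by (auto simp: Q_def one_map_aut)
  then have id: "(t ^^ (p ^ Suc e)) d = d" if "d \<in> D" for d using that by (metis id_apply restrict_apply')
  have "restrict (t ^^ (p ^ e)) D \<noteq> restrict id D"
    using t(2) nat_pow_map_aut[OF tc] by (simp add: one_map_aut)
  then obtain d where d: "d \<in> D" "(t ^^ (p ^ e)) d \<noteq> d" by (auto simp: restrict_def fun_eq_iff split: if_splits)
  have ap: "aut (t ^^ (p ^ e))" using at by (rule aut_pow)
  have "vtx ((t ^^ (p ^ e)) d) \<noteq> vtx d \<or> tip ((t ^^ (p ^ e)) d) \<noteq> tip d"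
    using d dart_unique aut_in[OF ap] by blast
  then have "(act t ^^ (p ^ e)) (vtx d) \<noteq> vtx d \<or> (act t ^^ (p ^ e)) (tip d) \<noteq> tip d"
    using act_vtx[OF ap d(1)] act_tip[OF ap d(1)] by (simp add: act_pow)
  then obtain w where w: "w \<in> V" "(act t ^^ (p ^ e)) w \<noteq> w" using d L_in by blast
  have "(act t ^^ (p ^ Suc e)) w = w"
    unfolding act_pow using id vertex_subset[OF w(1)] by (intro image_cong[of w w _ id, simplified]) (auto simp del: funpow.simps power_Suc)
  then show ?thesis using that at w by blast
qed

end

section \<open>Cyclic labellings of the vertices\<close>


text \<open>Interpreted twice: for the element provided by the exponent, and for the cycle that is
  inverted by an involution.\<close>

locale cyclic_labelling = regular_Kmn p e n D R L
  for p e :: nat and n :: int and D :: "'d set" and R L :: "'d \<Rightarrow> 'd" +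
  fixes t :: "'d \<Rightarrow> 'd" and w0 :: "'d set"
  assumes aut_t: "aut t" and w0_in: "w0 \<in> V"
    and moved: "(act t ^^ (p ^ e)) w0 \<noteq> w0" and periodic: "(act t ^^ (p ^ Suc e)) w0 = w0"
begin

text \<open>The orbit length divides \<open>p ^ Suc e\<close> but not \<open>p ^ e\<close>, so it is
  \<open>p ^ Suc e\<close>, the number of all vertices.\<close>

lemma orbit: "range (\<lambda>i. (act t ^^ i) w0) = V"
  and orbit_eq_iff: "(act t ^^ i) w0 = (act t ^^ j) w0 \<longleftrightarrow> [i = j] (mod p ^ Suc e)"
proof -
  define S where "S = range (\<lambda>i. (act t ^^ i) w0)"
  have SV: "S \<subseteq> V"
  proof
    fix w assume "w \<in> S"
    then obtain i where "w = act (t ^^ i) w0" by (auto simp: S_def act_pow)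
    then show "w \<in> V" using act_in[OF aut_pow[OF aut_t] w0_in] by simp
  qed
  have "inj_on (act t) V" using act_eq_iff[OF aut_t] by (intro inj_onI) simp
  then have S: "finite S" "inj_on (act t) S"
    using SV finite_V by (auto intro: finite_subset inj_on_subset)
  note per = funpow_eq_self_iff_card_orbit_dvd[OF S S_def]
  have c: "card S = p ^ Suc e"
    using per[of "p ^ e"] per[of "p ^ Suc e"] moved periodic
    by (intro prime_power_dvd_not_dvd_imp_eq[OF prime_p]) auto
  then show "range (\<lambda>i. (act t ^^ i) w0) = V"
    using card_subset_eq[OF finite_V SV] ex_partition(1) by (simp add: S_def)
  show "(act t ^^ i) w0 = (act t ^^ j) w0 \<longleftrightarrow> [i = j] (mod p ^ Suc e)"
    using funpow_eq_iff_cong_card_orbit[OF S S_def] c by simp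
qed

definition label :: "int \<Rightarrow> 'd set" where "label x = (act t ^^ nat (x mod n)) w0"

lemma label_eq_iff: "label x = label y \<longleftrightarrow> [x = y] (mod n)"
proof -
  have "label x = label y \<longleftrightarrow> [int (nat (x mod n)) = int (nat (y mod n))] (mod int (p ^ Suc e))"
    by (simp only: label_def orbit_eq_iff cong_int_iff)
  also have "\<dots> \<longleftrightarrow> [x = y] (mod n)" using n_gt_1 by (simp add: n_eq cong_def)
  finally show ?thesis .
qed

lemma label_int: "label (int i) = (act t ^^ i) w0"
proof -
  have "[int (nat (int i mod n)) = int i] (mod int (p ^ Suc e))"
    using n_gt_1 by (simp add: n_eq cong_def)
  then show ?thesis by (simp only: label_def orbit_eq_iff cong_int_iff)
qed

lemma label_0: "label 0 = w0"
  using label_int[of 0] by simp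

lemma range_label: "range label = V"
proof
  show "range label \<subseteq> V" using orbit by (auto simp: label_def)
  show "V \<subseteq> range label" using orbit label_int by (metis (no_types, lifting) rangeE rangeI subsetI)
qed

lemma label_in: "label x \<in> V"
  using range_label by blast

lemma ex_nat_cong: obtains k where "[x = int k] (mod n)"
  using that[of "nat (x mod n)"] n_gt_1 by (simp add: cong_def)

lemma act_t_pow_label: "act (t ^^ i) (label x) = label (x + int i)"
proof -
  obtain k where k: "[x = int k] (mod n)" by (rule ex_nat_cong)
  then have "label x = label (int k)" by (simp only: label_eq_iff)
  then have "act (t ^^ i) (label x) = (act t ^^ (i + k)) w0"
    by (simp add: label_int funpow_add act_pow)
  also have "\<dots> = label (int (i + k))" by (simp only: label_int)
  also have "\<dots> = label (x + int i)"
    using cong_add[OF cong_sym[OF k] cong_refl, of "int i"] by (simp only: label_eq_iff of_nat_add add.commute)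
  finally show ?thesis .
qed

lemma part_translate: "part (label (x + c)) = part (label (y + c)) \<longleftrightarrow> part (label x) = part (label y)"
proof -
  obtain k where k: "[c = int k] (mod n)" by (rule ex_nat_cong)
  have "label (z + c) = act (t ^^ k) (label z)" for z
    using cong_add[OF cong_refl k, of z] by (simp only: act_t_pow_label label_eq_iff)
  then show ?thesis using act_part_iff[OF aut_pow[OF aut_t] label_in label_in] by simp
qed

lemma card_residues: "card {0..<n} = p ^ Suc e"
proof -
  have "nat n = p ^ Suc e" unfolding n_eq by (simp only: of_nat_power[symmetric] nat_int)
  then show ?thesis by simp
qed

lemma card_multiples: "card {x \<in> {0..<n}. int p dvd x} = p ^ e"
proof -
  define U where "U = {x \<in> {0..<n}. \<not> int p dvd x}"
  have "finite U" "U \<subseteq> {0..<n}" unfolding U_def by (auto intro: finite_subset[of _ "{0..<n}"])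
  then have "card ({0..<n} - U) = p ^ Suc e - card U" by (simp only: card_Diff_subset card_residues)
  also have "card U = p ^ e * (p - 1)"
    unfolding U_def n_eq by (rule card_units_mod_prime_power[OF prime_p])
  also have "p ^ Suc e - p ^ e * (p - 1) = p ^ e" using p_ge by (simp add: algebra_simps diff_mult_distrib2)
  also have "{0..<n} - U = {x \<in> {0..<n}. int p dvd x}" by (auto simp: U_def)
  finally show ?thesis .
qed

text \<open>Translations preserve the parts, so the labels in the part of \<open>0\<close> form a
  subgroup with \<open>p ^ e\<close> classes modulo \<open>n\<close>. A unit would generate
  everything; hence the subgroup consists of multiples of \<open>p\<close>, and counting gives all
  of them.\<close>

lemma part_label_iff: "part (label x) = part (label y) \<longleftrightarrow> [x = y] (mod int p)"
proof -
  define S where "S = {x. part (label x) = part (label 0)}"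
  have S_diff: "part (label x) = part (label y) \<longleftrightarrow> x - y \<in> S" for x y
    using part_translate[of "x - y" y 0] by (simp add: S_def)
  have S_add: "x + y \<in> S" if "x \<in> S" "y \<in> S" for x y
    using S_diff[of "x + y" y] that by (simp add: S_def)
  have S_cong: "x \<in> S \<longleftrightarrow> y \<in> S" if "[x = y] (mod n)" for x y
  proof -
    have "label x = label y" using that by (simp only: label_eq_iff)
    then show ?thesis by (simp add: S_def)
  qed
  have S_mult: "int k * x \<in> S" if "x \<in> S" for k x
    using that S_add by (induction k) (auto simp: S_def algebra_simps)
  have cardS: "card {x \<in> {0..<n}. x \<in> S} = p ^ e"
  proof -
    have "inj_on label {x \<in> {0..<n}. x \<in> S}" by (auto simp: inj_on_def label_eq_iff cong_def)
    moreover have "label ` {x \<in> {0..<n}. x \<in> S} = {v \<in> V. part v = part (label 0)}"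
    proof
      show "label ` {x \<in> {0..<n}. x \<in> S} \<subseteq> {v \<in> V. part v = part (label 0)}"
        using label_in by (auto simp: S_def)
      show "{v \<in> V. part v = part (label 0)} \<subseteq> label ` {x \<in> {0..<n}. x \<in> S}"
      proof
        fix v assume v: "v \<in> {v \<in> V. part v = part (label 0)}"
        then obtain x where x: "v = label x" using range_label by blast
        have lx: "label (x mod n) = label x" by (simp add: label_eq_iff cong_def)
        then have "x mod n \<in> S" using v x by (simp add: S_def)
        then show "v \<in> label ` {x \<in> {0..<n}. x \<in> S}"
          using x lx n_gt_1 by (intro image_eqI[of _ _ "x mod n"]) simp_all
      qed
    qed
    ultimately show ?thesis using card_part[OF label_in, of 0] by (metis card_image)
  qed
  have S_dvd: "int p dvd x" if "x \<in> S" for x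
  proof (rule ccontr)
    assume "\<not> int p dvd x"
    then have "coprime x n" unfolding n_eq using int_prime_not_dvd_iff_coprime_power[OF prime_p] by blast
    then obtain u where u: "[x * u = 1] (mod n)" using cong_solve_coprime_int by blast
    have "y \<in> S" for y
    proof -
      obtain k where k: "[u * y = int k] (mod n)" by (rule ex_nat_cong)
      have "[int k * x = (u * y) * x] (mod n)" by (intro cong_mult cong_refl cong_sym[OF k])
      also have "(u * y) * x = (x * u) * y" by simp
      also have "[(x * u) * y = 1 * y] (mod n)" by (intro cong_mult cong_refl u)
      finally show ?thesis using S_mult[OF that, of k] S_cong by simp
    qed
    then have "{x \<in> {0..<n}. x \<in> S} = {0..<n}" by blast
    then have "p ^ Suc e = p ^ e" using cardS card_residues by metis
    then show False using p_ge by simp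
  qed
  have eq: "{x \<in> {0..<n}. x \<in> S} = {x \<in> {0..<n}. int p dvd x}"
    using S_dvd cardS card_multiples
    by (intro card_subset_eq) (auto intro: finite_subset[of _ "{0..<n}"])
  have "x \<in> S \<longleftrightarrow> int p dvd x" for x
  proof -
    have "x \<in> S \<longleftrightarrow> x mod n \<in> S" by (rule S_cong) (simp add: cong_def)
    also have "\<dots> \<longleftrightarrow> x mod n \<in> {x \<in> {0..<n}. x \<in> S}" using n_gt_1 by simp
    also have "\<dots> \<longleftrightarrow> int p dvd x mod n" unfolding eq using n_gt_1 by simp
    also have "\<dots> \<longleftrightarrow> int p dvd x" by (rule dvd_mod_iff) (simp add: n_eq)
    finally show ?thesis .
  qed
  then show ?thesis by (simp add: S_diff cong_iff_dvd_diff)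
qed

section \<open>Darts and automorphisms in coordinates\<close>

definition dart :: "int \<Rightarrow> int \<Rightarrow> 'd" where
  "dart x y = (THE d. d \<in> D \<and> vtx d = label x \<and> tip d = label y)"

lemma dart_props:
  assumes "\<not> int p dvd y - x"
  shows "dart x y \<in> D" "vtx (dart x y) = label x" "tip (dart x y) = label y"
proof -
  have "part (label x) \<noteq> part (label y)"
    using assms unfolding part_label_iff by (metis cong_iff_dvd_diff cong_sym)
  from theI'[OF ex1_dart[OF label_in label_in this]]
  show "dart x y \<in> D" "vtx (dart x y) = label x" "tip (dart x y) = label y"
    by (simp_all add: dart_def)
qed

lemma dart_eqI:
  assumes "d \<in> D" "vtx d = label x" "tip d = label y" shows "d = dart x y" "\<not> int p dvd y - x"
proof -
  have "part (label x) \<noteq> part (label y)" using part_neq[OF assms(1)] assms(2,3) by simp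
  then show *: "\<not> int p dvd y - x" unfolding part_label_iff by (metis cong_iff_dvd_diff cong_sym)
  show "d = dart x y" using dart_unique[OF assms(1) dart_props(1)[OF *]] dart_props[OF *] assms by simp
qed

text \<open>A relation, because \<open>g\<close> is determined only modulo \<open>n\<close>:
  translations and negation can then be used literally, while \<open>index\<close> supplies some
  representative.\<close>

definition induces :: "('d \<Rightarrow> 'd) \<Rightarrow> (int \<Rightarrow> int) \<Rightarrow> bool" where
  "induces f g \<longleftrightarrow> aut f \<and> (\<forall>x. act f (label x) = label (g x))"

definition index :: "('d \<Rightarrow> 'd) \<Rightarrow> int \<Rightarrow> int" where
  "index f x = (SOME y. act f (label x) = label y)"

lemma induces_index: "aut f \<Longrightarrow> induces f (index f)"
proof -
  assume f: "aut f"
  have "act f (label x) = label (index f x)" for x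
  proof -
    have "act f (label x) \<in> range label" unfolding range_label by (rule act_in[OF f label_in])
    then have "\<exists>y. act f (label x) = label y" by blast
    then show ?thesis unfolding index_def by (rule someI_ex)
  qed
  then show ?thesis using f by (simp add: induces_def)
qed

lemma induces_dart:
  assumes "induces f g" "\<not> int p dvd y - x" shows "f (dart x y) = dart (g x) (g y)"
proof (rule dart_eqI)
  note d = dart_props[OF assms(2)]
  have f: "aut f" "\<And>x. act f (label x) = label (g x)" using assms(1) by (auto simp: induces_def)
  show "f (dart x y) \<in> D" using aut_in[OF f(1) d(1)] .
  show "vtx (f (dart x y)) = label (g x)" using act_vtx[OF f(1) d(1)] d f(2) by simp
  show "tip (f (dart x y)) = label (g y)" using act_tip[OF f(1) d(1)] d f(2) by simp
qed

lemma induces_pow: "induces f g \<Longrightarrow> induces (f ^^ i) (g ^^ i)"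
proof (induction i)
  case (Suc i)
  then have "act ((f ^^ i)) (label x) = label ((g ^^ i) x)" "act f (label x) = label (g x)" for x
    by (auto simp: induces_def)
  then have "act (f ^^ Suc i) (label x) = label ((g ^^ Suc i) x)" for x
    by (simp only: funpow.simps(2) image_comp[symmetric] comp_apply)
  then show ?case using Suc.prems aut_pow[of f "Suc i"] by (simp only: induces_def) simp
qed (use aut_pow[OF aut_t, of 0] in \<open>simp add: induces_def\<close>)

definition base :: 'd where "base = dart 0 1"

text \<open>The automorphism imitating \<open>R\<close> at the base dart; it generates the
  stabiliser of \<open>w0\<close>, whereas \<open>R\<close> belongs to the monodromy.\<close>

definition rot :: "'d \<Rightarrow> 'd" where "rot = (SOME f. aut f \<and> f base = R base)"

lemma unit_0_1: "\<not> int p dvd 1 - 0"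
  using p_ge by auto

lemma base_in: "base \<in> D" and vtx_base: "vtx base = w0"
  using dart_props[OF unit_0_1] by (simp_all add: base_def label_0)

lemma rot: "aut rot" "rot base = R base"
proof -
  have "\<exists>f. aut f \<and> f base = R base" using aut_exists[OF base_in R_in[OF base_in]] by blast
  from someI_ex[OF this] show "aut rot" "rot base = R base" by (auto simp: rot_def)
qed

lemma rot_pow: "(rot ^^ i) base = (R ^^ i) base"
proof (induction i)
  case (Suc i)
  then show ?case using aut_R_pow[OF rot(1) base_in, of i] rot(2) by (simp add: funpow_swap1)
qed simp

lemma arc_group: "arc_group p e n {g. \<exists>f. induces f g} (index rot)"
proof
  show "Factorial_Ring.prime p" "3 \<le> p" "n = int p ^ Suc e" by (fact prime_p p_ge n_eq)+
next
  fix g x y assume "g \<in> {g. \<exists>f. induces f g}"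
  then obtain f where f: "aut f" "\<And>x. act f (label x) = label (g x)" by (auto simp: induces_def)
  show "[g x = g y] (mod n) \<longleftrightarrow> [x = y] (mod n)"
    using act_eq_iff[OF f(1) label_in label_in] by (simp add: f(2) label_eq_iff)
  show "[g x = g y] (mod int p) \<longleftrightarrow> [x = y] (mod int p)"
    using act_part_iff[OF f(1) label_in label_in] by (simp add: f(2) part_label_iff)
next
  fix g h assume "g \<in> {g. \<exists>f. induces f g}" "h \<in> {g. \<exists>f. induces f g}"
  then obtain f f' where "induces f g" "induces f' h" by blast
  then have "induces (f \<circ> f') (g \<circ> h)"
    using aut_comp[of f f'] by (simp only: induces_def image_comp[symmetric] comp_apply simp_thms)
  then show "g \<circ> h \<in> {g. \<exists>f. induces f g}" by blast
next
  fix c :: int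
  obtain k where k: "[c = int k] (mod n)" by (rule ex_nat_cong)
  have "label (z + c) = act (t ^^ k) (label z)" for z
    using cong_add[OF cong_refl k, of z] by (simp only: act_t_pow_label label_eq_iff)
  then have "induces (t ^^ k) (\<lambda>x. x + c)" using aut_pow[OF aut_t] by (simp add: induces_def)
  then show "(\<lambda>x. x + c) \<in> {g. \<exists>f. induces f g}" by blast
next
  fix x y x' y' :: int assume xy: "\<not> int p dvd y - x" and xy': "\<not> int p dvd y' - x'"
  obtain f where f: "aut f" "f (dart x y) = dart x' y'"
    using aut_exists[OF dart_props(1)[OF xy] dart_props(1)[OF xy']] .
  have ind: "induces f (index f)" using f(1) by (rule induces_index)
  have "label (index f x) = act f (label x)" using ind by (simp add: induces_def)
  also have "\<dots> = vtx (f (dart x y))" using act_vtx[OF f(1) dart_props(1)[OF xy]] dart_props[OF xy] by simp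
  also have "\<dots> = label x'" using f(2) dart_props[OF xy'] by simp
  finally have "[index f x = x'] (mod n)" by (simp only: label_eq_iff)
  moreover have "label (index f y) = act f (label y)" using ind by (simp add: induces_def)
  then have "label (index f y) = tip (f (dart x y))"
    using act_tip[OF f(1) dart_props(1)[OF xy]] dart_props[OF xy] by simp
  then have "label (index f y) = label y'" using f(2) dart_props[OF xy'] by simp
  then have "[index f y = y'] (mod n)" by (simp only: label_eq_iff)
  ultimately show "\<exists>g\<in>{g. \<exists>f. induces f g}. [g x = x'] (mod n) \<and> [g y = y'] (mod n)"
    using ind by blast
next
  fix g x y z assume "g \<in> {g. \<exists>f. induces f g}" and g: "[g x = x] (mod n)" "[g y = y] (mod n)"
    and xy: "\<not> int p dvd y - x"
  then obtain f where f: "aut f" "\<And>x. act f (label x) = label (g x)" by (auto simp: induces_def)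
  note d = dart_props[OF xy]
  have "label (g x) = label x" "label (g y) = label y" using g by (simp_all only: label_eq_iff)
  then have "vtx (f (dart x y)) = label x" "tip (f (dart x y)) = label y"
    using act_vtx[OF f(1) d(1)] act_tip[OF f(1) d(1)] d f(2) by simp_all
  then have fd: "f (dart x y) = dart x y" by (rule dart_eqI(1)[OF aut_in[OF f(1) d(1)]])
  have "f u = id u" if "u \<in> D" for u
    using aut_unique[OF f(1) _ d(1) _ that, of id] fd aut_pow[OF f(1), of 0] by simp
  then have "act f (label z) = label z" using vertex_subset[OF label_in, of z] by force
  then show "[g z = z] (mod n)" by (simp only: f(2) label_eq_iff)
next
  show "index rot \<in> {g. \<exists>f. induces f g}" using induces_index[OF rot(1)] by blast
  have "label (index rot 0) = act rot w0"
    using induces_index[OF rot(1)] label_0 by (metis induces_def)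
  also have "\<dots> = vtx (R base)" using act_vtx[OF rot(1) base_in] rot(2) vtx_base by simp
  also have "\<dots> = label 0" using vtx_R[OF base_in] vtx_base label_0 by simp
  finally show "[index rot 0 = 0] (mod n)" by (simp only: label_eq_iff)
next
  fix g assume "g \<in> {g. \<exists>f. induces f g}" and g0: "[g 0 = 0] (mod n)"
  then obtain f where f: "aut f" "\<And>x. act f (label x) = label (g x)" by (auto simp: induces_def)
  have "label (g 0) = label 0" using g0 by (simp only: label_eq_iff)
  then have "vtx (f base) = vtx base" using act_vtx[OF f(1) base_in] f(2)[of 0] vtx_base by (simp add: label_0)
  \<comment> \<open>The image of the base dart starts at the same vertex, so it is a rotation of it;
    regularity then identifies \<open>f\<close> with a power of \<open>rot\<close>.\<close>
  then have "f base \<in> vtx base" using in_vtx[of "f base"] by simp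
  then obtain i where "f base = (R ^^ i) base" by (auto simp: map_vertex_def)
  then have i: "f u = (rot ^^ i) u" if "u \<in> D" for u
    using aut_unique[OF f(1) aut_pow[OF rot(1)] base_in _ that] rot_pow by simp
  have "[g z = (index rot ^^ i) z] (mod n)" for z
  proof -
    have "label (g z) = act f (label z)" by (simp add: f(2))
    also have "\<dots> = act (rot ^^ i) (label z)"
      using i vertex_subset[OF label_in, of z] by (intro image_cong) auto
    also have "\<dots> = label ((index rot ^^ i) z)"
      using induces_pow[OF induces_index[OF rot(1)], of i] by (simp add: induces_def)
    finally show ?thesis by (simp only: label_eq_iff)
  qed
  then show "\<exists>i. \<forall>z. [g z = (index rot ^^ i) z] (mod n)" by blast
qed

text \<open>Once \<open>a\<close> is linear, the automorphism taking the base dart to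
  \<open>dart x y\<close> is \<open>z \<mapsto> x + (y - x) * z\<close> modulo \<open>n\<close>. It
  commutes with \<open>R\<close>, so the rotation at the base dart determines the rotation at every
  dart.\<close>

lemma affine_map_of_inversion:
  assumes neg: "induces f uminus"
  shows "affine_map p e (nat (index rot 1 mod n)) n dart D R L"
proof -
  interpret arc_group p e n "{g. \<exists>f. induces f g}" "index rot" by (rule arc_group)
  have neg': "uminus \<in> {g. \<exists>f. induces f g}" using neg by blast
  define s where "s = nat (index rot 1 mod n)"
  have s: "[int s = index rot 1] (mod n)" using n_gt_1 by (simp add: s_def)
  have dart_cong: "dart x y = dart x' y'" if "[x = x'] (mod n)" "[y = y'] (mod n)" for x y x' y'
  proof -
    have "label x = label x'" "label y = label y'" using that by (simp_all only: label_eq_iff)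
    then show ?thesis by (simp add: dart_def)
  qed
  have R_base: "R base = dart 0 (int s)"
  proof -
    have "R base = dart (index rot 0) (index rot 1)"
      using induces_dart[OF induces_index[OF rot(1)] unit_0_1] rot(2) by (simp add: base_def)
    also have "\<dots> = dart 0 (int s)" by (rule dart_cong[OF a_zero cong_sym[OF s]])
    finally show ?thesis .
  qed
  have s_unit: "\<not> int p dvd int s - 0"
  proof -
    have "int p dvd int s \<longleftrightarrow> int p dvd index rot 1"
      using s p_dvd_n by (rule cong_modulus_dvd)
    then show ?thesis using a_dvd_p[of 1] not_p_dvd_1 by simp
  qed
  have "affine_map p e s n dart D R L"
  proof
    show "Factorial_Ring.prime p" "3 \<le> p" "n = int p ^ Suc e" by (fact prime_p p_ge n_eq)+
    show "residue_primroot (p ^ Suc e) s" unfolding s_def using neg' by (rule a_primroot)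
    show "D = {dart x y | x y. \<not> int p dvd y - x}"
    proof
      show "D \<subseteq> {dart x y | x y. \<not> int p dvd y - x}"
      proof
        fix d assume d: "d \<in> D"
        then have "vtx d \<in> range label" "tip d \<in> range label" unfolding range_label using L_in by auto
        then obtain x y where "vtx d = label x" "tip d = label y" by (elim rangeE) blast
        from dart_eqI[OF d this] show "d \<in> {dart x y | x y. \<not> int p dvd y - x}" by blast
      qed
    qed (use dart_props(1) in auto)
    fix x y assume xy: "\<not> int p dvd y - x"
    note d = dart_props[OF xy]
    show "L (dart x y) = dart y x"
      by (rule dart_eqI(1)) (use d L_in LL in simp_all)
    show "dart x y = dart x' y' \<longleftrightarrow> [x = x'] (mod n) \<and> [y = y'] (mod n)"
      if xy': "\<not> int p dvd y' - x'" for x' y'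
    proof
      assume "dart x y = dart x' y'"
      then have "label x = label x'" "label y = label y'" using d dart_props[OF xy'] by simp_all
      then show "[x = x'] (mod n) \<and> [y = y'] (mod n)" by (simp only: label_eq_iff)
    qed (use dart_cong in blast)
    obtain f where f: "aut f" "f base = dart x y" using aut_exists[OF base_in d(1)] .
    define g where "g = index f"
    have g: "induces f g" unfolding g_def using f(1) by (rule induces_index)
    have "act f (vtx base) = label x" "act f (tip base) = label y"
      using act_vtx[OF f(1) base_in] act_tip[OF f(1) base_in] f(2) d by simp_all
    then have "label (g 0) = label x" "label (g 1) = label y"
      using g dart_props[OF unit_0_1] by (simp_all add: induces_def base_def)
    then have gx: "[g 0 = x] (mod n)" and gy: "[g 1 = y] (mod n)" by (simp_all only: label_eq_iff)
    obtain i where i: "\<And>z. [g z = g 0 + (index rot ^^ i) z] (mod n)" using affine_form[of g] g by blast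
    have gz: "[g z = x + int s ^ i * z] (mod n)" for z
    proof -
      have "[g z = g 0 + (index rot ^^ i) z] (mod n)" by (rule i)
      also have "[g 0 + (index rot ^^ i) z = x + index rot 1 ^ i * z] (mod n)"
        by (intro cong_add gx a_pow_linear[OF neg'])
      also have "[x + index rot 1 ^ i * z = x + int s ^ i * z] (mod n)"
        by (intro cong_add cong_mult cong_pow cong_refl cong_sym[OF s])
      finally show ?thesis .
    qed
    have si: "[int s ^ i = y - x] (mod n)"
    proof -
      have "[x + int s ^ i * 1 = g 1] (mod n)" by (rule cong_sym[OF gz])
      also note gy
      finally have "[x + int s ^ i * 1 - x = y - x] (mod n)" by (intro cong_diff cong_refl)
      then show ?thesis by simp
    qed
    have "R (dart x y) = f (R base)" using f base_in by (simp add: aut_def)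
    also have "\<dots> = dart (g 0) (g (int s))" unfolding R_base by (rule induces_dart[OF g s_unit])
    also have "\<dots> = dart x (x + int s * (y - x))"
    proof (rule dart_cong[OF gx])
      have "[g (int s) = x + int s ^ i * int s] (mod n)" by (rule gz)
      also have "[x + int s ^ i * int s = x + (y - x) * int s] (mod n)" by (intro cong_add cong_mult cong_refl si)
      finally show "[g (int s) = x + int s * (y - x)] (mod n)" by (simp add: mult.commute)
    qed
    finally show "R (dart x y) = dart x (x + int s * (y - x))" .
  qed
  then show ?thesis by (simp only: s_def)
qed

end

lemma (in regular_Kmn) exponent_imp_affine_map:
  assumes "sylow_p_subgroup (map_aut D R L) p P" "group_exponent (map_aut D R L) P = p ^ Suc e"
  shows "\<exists>s dart. affine_map p e s n dart D R L"
proof -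
  obtain t w where t: "aut t" "w \<in> V" "(act t ^^ (p ^ e)) w \<noteq> w" "(act t ^^ (p ^ Suc e)) w = w"
    using exponent_element[OF assms] .
  interpret T: cyclic_labelling p e n D R L t w by unfold_locales (fact t)+
  interpret A: arc_group p e n "{g. \<exists>f. T.induces f g}" "T.index T.rot" by (rule T.arc_group)
  obtain c z where "c \<in> {g. \<exists>f. T.induces f g}" "z \<in> {g. \<exists>f. T.induces f g}" and z0: "[z 0 = 0] (mod n)"
    and zczc: "\<And>x. [z (c (z (c x))) = x] (mod n)" and zz: "\<And>x. [z (z x) = x] (mod n)"
    and c: "\<And>x. [(c ^^ (p ^ e)) x = x + int p ^ e] (mod n)"
    using A.inverted_cycle by blast
  then obtain fc fz where fc: "T.induces fc c" and fz: "T.induces fz z" by blast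
  have act_c: "(act fc ^^ i) w = T.label ((c ^^ i) 0)" for i
    using T.induces_pow[OF fc, of i] T.label_0 unfolding act_pow by (metis T.induces_def)
  \<comment> \<open>In the labels of \<open>T\<close> the \<open>p ^ e\<close>-th power of
    \<open>c\<close> is translation by \<open>p ^ e\<close>, so it is nontrivial while its
    \<open>p\<close>-th power is trivial: the two requirements on the new cycle.\<close>
  have c_pow: "[((c ^^ (p ^ e)) ^^ i) x = x + int i * int p ^ e] (mod n)" for i x
  proof (induction i)
    case (Suc i)
    have "[((c ^^ (p ^ e)) ^^ Suc i) x = ((c ^^ (p ^ e)) ^^ i) x + int p ^ e] (mod n)" using c by simp
    also have "[((c ^^ (p ^ e)) ^^ i) x + int p ^ e = x + int i * int p ^ e + int p ^ e] (mod n)"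
      by (intro cong_add Suc cong_refl)
    finally show ?case by (simp add: algebra_simps)
  qed simp
  interpret C: cyclic_labelling p e n D R L fc w
  proof
    show "aut fc" using fc by (simp add: T.induces_def)
    show "w \<in> V" by (rule t(2))
    have "\<not> [(c ^^ (p ^ e)) 0 = 0] (mod n)"
    proof
      assume "[(c ^^ (p ^ e)) 0 = 0] (mod n)"
      then have "[int p ^ e = 0] (mod n)" using c[of 0] by (simp, metis cong_sym cong_trans)
      then have "int p ^ Suc e dvd int p ^ e" by (simp only: cong_0_iff n_eq)
      then show False using p_ge zdvd_imp_le[of "int p ^ Suc e" "int p ^ e"] by simp
    qed
    then show "(act fc ^^ (p ^ e)) w \<noteq> w"
      unfolding act_c using T.label_eq_iff[of _ 0] by (simp add: T.label_0)
    have "[(c ^^ (p ^ Suc e)) 0 = 0] (mod n)"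
    proof -
      have "(c ^^ (p ^ Suc e)) 0 = ((c ^^ (p ^ e)) ^^ p) 0" by (simp add: funpow_mult mult.commute)
      also have "[\<dots> = 0 + int p * int p ^ e] (mod n)" by (rule c_pow)
      also have "[0 + int p * int p ^ e = 0] (mod n)" by (simp add: n_eq cong_0_iff)
      finally show ?thesis .
    qed
    then show "(act fc ^^ (p ^ Suc e)) w = w"
      unfolding act_c using T.label_eq_iff[of _ 0] by (simp add: T.label_0)
  qed
  have lab: "\<exists>x. C.label k = T.label x" for k using C.label_in T.range_label by blast
  have act_z: "act fz (T.label x) = T.label (z x)" and act_c': "act fc (T.label x) = T.label (c x)" for x
    using fz fc unfolding T.induces_def by blast+
  \<comment> \<open>The relations are moved from the labels of \<open>T\<close> to the vertices
    themselves, where they can be read in the labels of \<open>C\<close>.\<close>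
  have zzV: "act fz (act fz (C.label k)) = C.label k" for k
  proof -
    obtain x where "C.label k = T.label x" using lab by blast
    then show ?thesis by (simp only: act_z T.label_eq_iff zz)
  qed
  have zczcV: "act fz (act fc (act fz (act fc (C.label k)))) = C.label k" for k
  proof -
    obtain x where "C.label k = T.label x" using lab by blast
    then show ?thesis by (simp only: act_z act_c' T.label_eq_iff zczc)
  qed
  have act_fc: "act fc (C.label k) = C.label (k + 1)" for k using C.act_t_pow_label[of 1 k] by simp
  have autz: "aut fz" using fz by (simp add: T.induces_def)
  \<comment> \<open>In the labels of \<open>C\<close> the element \<open>c\<close> is
    \<open>k \<mapsto> k + 1\<close>, so \<open>z c z c = 1\<close> gives
    \<open>z (k + 1) = z k - 1\<close>; together with \<open>z 0 = 0\<close> this is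
    negation.\<close>
  have neg_nat: "act fz (C.label (int k)) = C.label (- int k)" for k
  proof (induction k)
    case 0
    have "act fz w = w" using fz z0 T.label_eq_iff T.label_0 by (metis T.induces_def)
    then show ?case by (simp add: C.label_0)
  next
    case (Suc k)
    have "act fz (C.label (int k + 1)) \<in> range C.label"
      unfolding C.range_label by (rule act_in[OF autz C.label_in])
    then obtain x where x: "act fz (C.label (int k + 1)) = C.label x" by blast
    have "act fz (C.label (x + 1)) = C.label (int k)"
      using zczcV[of "int k"] by (simp add: act_fc x)
    then have "C.label (x + 1) = C.label (- int k)" using zzV[of "x + 1"] Suc by simp
    then have "[(x + 1) - 1 = - int k - 1] (mod n)" by (intro cong_diff cong_refl) (simp only: C.label_eq_iff)
    moreover have "- int k - 1 = - int (Suc k)" "(x + 1) - 1 = x" by simp_all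
    ultimately have "C.label x = C.label (- int (Suc k))" by (simp only: C.label_eq_iff)
    then show ?case using x by (simp add: add.commute)
  qed
  have "act fz (C.label x) = C.label (- x)" for x
  proof -
    obtain k where k: "[x = int k] (mod n)" by (rule C.ex_nat_cong)
    then have "C.label x = C.label (int k)" "C.label (- x) = C.label (- int k)"
      by (simp_all add: C.label_eq_iff cong_minus_minus_iff)
    then show ?thesis using neg_nat by simp
  qed
  then have "C.induces fz uminus" using autz by (simp add: C.induces_def)
  then show ?thesis using C.affine_map_of_inversion by blast
qed

section \<open>Assembling the classification\<close>

lemma affine_map_cong:
  assumes "affine_map p e s n dart D R L" and s: "[int s = int s'] (mod n)"
  shows "affine_map p e s' n dart D R L"
proof -
  interpret affine_map p e s n dart D R L by fact
  have "[s = s'] (mod p ^ Suc e)" using s by (simp add: n_eq flip: cong_int_iff)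
  then have s': "residue_primroot (p ^ Suc e) s'" using primroot residue_primroot_cong by blast
  have "R (dart x y) = dart x (x + int s' * (y - x))" if "\<not> int p dvd y - x" for x y
  proof -
    have "dart x (x + int s * (y - x)) = dart x (x + int s' * (y - x))"
      using rot_unit[OF that, of 1] by (intro dart_cong cong_add cong_mult cong_refl s) simp
    then show ?thesis using R_dart[OF that] by simp
  qed
  then show ?thesis
    using prime_p p_ge n_eq s' D_eq dart_eq_iff L_dart by unfold_locales
qed

theorem theorem3p1:
  fixes p e r :: nat
  assumes "Factorial_Ring.prime p" and "p \<ge> 5" and "e \<ge> 1"
    and "residue_primroot (p^(e+1)) r"
  shows "(\<forall>(D :: 'd set) R L P.
            orientably_regular_embedding_Kmn D R L p (p^e) \<and>
            sylow_p_subgroup (map_aut D R L) p P \<and>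
            group_exponent (map_aut D R L) P = p^(e+1) \<longrightarrow>
            (\<exists>j<p^e*(p-1). coprime j (p^e*(p-1)) \<and>
               map_iso D R L (M1_D p e r j) (M1_R p e r j) M1_L))
       \<and> (\<forall>j<p^e*(p-1). coprime j (p^e*(p-1)) \<longrightarrow>
            orientably_regular_embedding_Kmn (M1_D p e r j) (M1_R p e r j) M1_L p (p^e))
       \<and> (\<forall>j1<p^e*(p-1). \<forall>j2<p^e*(p-1). coprime j1 (p^e*(p-1)) \<and> coprime j2 (p^e*(p-1)) \<and>
            map_iso (M1_D p e r j1) (M1_R p e r j1) M1_L (M1_D p e r j2) (M1_R p e r j2) M1_L
            \<longrightarrow> j1 = j2)"
  proof -
  have r: "residue_primroot (p ^ Suc e) r" using assms(4) by simp
  interpret G1_params p e r by unfold_locales (use assms r in auto)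
  have M_eq: "int M = int p ^ Suc e" by (simp add: M_def)
  have classify: "\<exists>j<N. coprime j N \<and> map_iso D R L (M1_D p e r j) (M1_R p e r j) M1_L"
    if emb: "orientably_regular_embedding_Kmn D R L p (p ^ e)" "sylow_p_subgroup (map_aut D R L) p P"
      "group_exponent (map_aut D R L) P = p ^ Suc e" for D :: "'d set" and R L P
  proof -
    interpret E: regular_Kmn p e "int M" D R L by unfold_locales (use emb p_ge prime_p M_eq in auto)
    obtain s dart where s: "affine_map p e s (int M) dart D R L"
      using E.exponent_imp_affine_map[OF emb(2,3)] by blast
    interpret S: affine_map p e s "int M" dart D R L by (rule s)
    obtain j where j: "j < N" "[int s = int r ^ j] (mod int M)" using unit_eq_r_power[OF S.s_unit] .
    have "affine_map p e (r ^ j) (int M) dart D R L" using j(2) by (intro affine_map_cong[OF s]) simp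
    then have rj: "residue_primroot M (r ^ j)" by (simp add: affine_map_def M_def)
    have rM: "residue_primroot M r" using r by (simp add: M_def)
    \<comment> \<open>Both \<open>r\<close> and \<open>r ^ j\<close> have order \<open>N\<close>,
      and the order of \<open>r ^ j\<close> is \<open>N div gcd j N\<close>; hence \<open>j\<close>
      is prime to \<open>N\<close>.\<close>
    then have "N div gcd j N = N" using rj ord_power[of M r j] by (simp add: residue_primroot_def N_eq_totient)
    moreover have "gcd j N * (N div gcd j N) = N" by simp
    ultimately have "gcd j N * N = 1 * N" by simp
    then have "coprime j N" using N_pos by (simp only: mult_right_cancel coprime_iff_gcd_eq_1)
    moreover have "map_iso D R L (M1_D p e r j) (M1_R p e r j) M1_L"
      using affine_map_iso[OF \<open>affine_map p e (r ^ j) _ _ _ _ _\<close> affine_map_M1[OF \<open>coprime j N\<close> j(1)]] .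
    ultimately show ?thesis using j(1) by blast
  qed
  have regular: "orientably_regular_embedding_Kmn (M1_D p e r j) (M1_R p e r j) M1_L p (p ^ e)"
    if "j < N" "coprime j N" for j
    using affine_map.orientably_regular[OF affine_map_M1[OF that(2,1)]] .
  have distinct: "j1 = j2"
    if j: "j1 < N" "j2 < N" "coprime j1 N" "coprime j2 N"
      and iso: "map_iso (M1_D p e r j1) (M1_R p e r j1) M1_L (M1_D p e r j2) (M1_R p e r j2) M1_L" for j1 j2
  proof -
    have "[int (r ^ j1) = int (r ^ j2)] (mod int M)"
      by (rule affine_map_iso_imp_cong[OF affine_map_M1[OF j(3,1)] affine_map_M1[OF j(4,2)] iso])
    then have "[r ^ j1 = r ^ j2] (mod M)" by (simp only: cong_int_iff)
    moreover have "coprime M r" "ord M r = N" using r by (simp_all add: residue_primroot_def M_def N_eq_totient)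
    ultimately have "[j1 = j2] (mod N)" by (simp add: order_divides_expdiff)
    then show ?thesis using j(1,2) by (simp add: cong_def)
  qed
  show ?thesis
    unfolding N_def[symmetric] Suc_eq_plus1[symmetric]
  proof (intro conjI allI impI)
    fix D :: "'d set" and R L P
    assume "orientably_regular_embedding_Kmn D R L p (p ^ e) \<and> sylow_p_subgroup (map_aut D R L) p P \<and>
      group_exponent (map_aut D R L) P = p ^ Suc e"
    then show "\<exists>j<N. coprime j N \<and> map_iso D R L (M1_D p e r j) (M1_R p e r j) M1_L"
      by (elim conjE) (rule classify)
  next
    fix j1 j2
    assume "j1 < N" "j2 < N" "coprime j1 N \<and> coprime j2 N \<and>
      map_iso (M1_D p e r j1) (M1_R p e r j1) M1_L (M1_D p e r j2) (M1_R p e r j2) M1_L"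
    then show "j1 = j2" by (elim conjE) (rule distinct)
  qed (rule regular)
qed


end
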